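(* The 2-monad $\mathrm{T}_c:\mathbf{ED}\to\mathbf{ED}$ of the comprehension completion, on the 2-category $\mathbf{ED}$ of elementary doctrines, is colax-idempotent.
   Context: $\mathbf{InfSL}$ is the category of posets with finite meets and functions preserving finite meets. Let $\mathcal C$ be a category with binary products. An elementary doctrine on $\mathcal C$ is a functor $P:\mathcal C^{\mathrm{op}}\to\mathbf{InfSL}$ (write $P_f=P(f)$) such that for every object $A$ there is $\delta_A\in P(A\times A)$ with: (1) $\alpha\mapsto P_{\mathrm{pr}_1}(\alpha)\wedge\delta_A$ is left adjoint to $P_{\langle \mathrm{id}_A,\mathrm{id}_A\rangle}:P(A\times A)\to P(A)$; (2) for every $e=\langle \mathrm{pr}_1,\mathrm{pr}_2,\mathrm{pr}_2\rangle:X\times A\to X\times A\times A$, the assignment $\alpha\mapsto P_{\langle \mathrm{pr}_1,\mathrm{pr}_2\rangle}(\alpha)\wedge P_{\langle \mathrm{pr}_2,\mathrm{pr}_3\rangle}(\delta_A)$ is left adjoint to $P_e:P(X\times A\times A)\to P(X\times A)$. The 2-category $\mathbf{ED}$: 0-cells are elementary doctrines; a 1-cell $(F,b):P\to R$ (with $P$ on $\mathcal C$, $R$ on $\mathcal D$) is a product-preserving functor $F:\mathcal C\to\mathcal D$ with a natural transformation $b:P\Rightarrow R\circ F^{\mathrm{op}}$ such that each $b_A$ preserves finite meets and $b_{A\times A}(\delta_A)=R_{\langle F\mathrm{pr}_1,F\mathrm{pr}_2\rangle}(\delta_{FA})$; a 2-cell $(F,b)\Rightarrow(G,c)$ is a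 natural transformation $\theta:F\Rightarrow G$ with $b_A(\alpha)\le R_{\theta_A}(c_A(\alpha))$ for all $A$ and $\alpha\in P(A)$. The 2-monad $\mathrm{T}_c$: for $P$ on $\mathcal C$, $\mathcal G_P$ is the category of pairs $(A,\alpha)$ with $\alpha\in P(A)$, an arrow $f:(A,\alpha)\to(B,\beta)$ being an arrow $f:A\to B$ of $\mathcal C$ with $\alpha\le P_f(\beta)$; $\mathrm{T}_c(P)=P_c:\mathcal G_P^{\mathrm{op}}\to\mathbf{InfSL}$ is $P_c(A,\alpha)=\{\gamma\in P(A):\gamma\le\alpha\}$, $P_c(f)(\gamma)=P_f(\gamma)\wedge\alpha$, an elementary doctrine with $\delta_{(A,\alpha)}=\delta_A\wedge P_{\mathrm{pr}_1}(\alpha)\wedge P_{\mathrm{pr}_2}(\alpha)$. On a 1-cell, $\mathrm{T}_c(F,b)=(\widehat F,\widehat b)$ with $\widehat F(A,\alpha)=(FA,b_A(\alpha))$, $\widehat F(f)=F(f)$ and $\widehat b$ the restriction of $b$; on a 2-cell, $\widehat\theta_{(A,\alpha)}=\theta_A$. The unit $\eta_P:P\to P_c$ is $A\mapsto(A,\top_A)$, identity on arrows and on elements. The multiplication $\mu_P:(P_c)_c\to P_c$ is $((A,\alpha),\gamma)\mapsto(A,\gamma)$, acting identically on arrows and on elements. For a 2-monad $(\mathrm T,\mu,\eta)$: a (strict) $\mathrm T$-algebra is $(A,a:\mathrm TA\to A)$ with $a\circ\mathrm Ta=a\circ\mu_A$ and $a\circ\eta_A=1_A$. A colax $\mathrm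 T$-morphism $(f,\bar f):(A,a)\to(B,b)$ is a 1-cell $f:A\to B$ with a 2-cell $\bar f:f\circ a\Rightarrow b\circ\mathrm Tf$ such that $\bar f\mu_A=(b\,\mathrm T\bar f)\cdot(\bar f\,\mathrm Ta)$ and $\bar f\eta_A=\mathrm{id}_f$. The 2-monad $\mathrm T$ is colax-idempotent if for all $\mathrm T$-algebras $(A,a)$, $(B,b)$ and every 1-cell $f:A\to B$ there is a unique 2-cell $\bar f:f\circ a\Rightarrow b\circ\mathrm Tf$ such that $(f,\bar f)$ is a colax $\mathrm T$-morphism. *)

theory Defs
  imports "HOL-Algebra.Galois_Connection"
begin

section \<open>Strict 2-categories and 2-monads\<close>

record ('x, 'f, 's) two_cat =
  cell0 :: "'x set"
  cell1 :: "'f set"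
  cell2 :: "'s set"
  src :: "'f \<Rightarrow> 'x"
  trg :: "'f \<Rightarrow> 'x"
  one1 :: "'x \<Rightarrow> 'f"
  comp1 :: "'f \<Rightarrow> 'f \<Rightarrow> 'f"  (infixr \<open>\<odot>\<index>\<close> 70)
  dom2 :: "'s \<Rightarrow> 'f"
  cod2 :: "'s \<Rightarrow> 'f"
  one2 :: "'f \<Rightarrow> 's"
  vcomp :: "'s \<Rightarrow> 's \<Rightarrow> 's"  (infixr \<open>\<bullet>\<index>\<close> 65)
  hcomp :: "'s \<Rightarrow> 's \<Rightarrow> 's"  (infixr \<open>\<star>\<index>\<close> 70)

text \<open>All compositions are written in applicative order: \<open>g \<odot> f\<close>, \<open>t \<bullet> s\<close> and \<open>t \<star> s\<close>
  mean first \<open>f\<close> (resp. \<open>s\<close>), then \<open>g\<close> (resp. \<open>t\<close>).\<close>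

definition in_hom1 :: "('x, 'f, 's, 'm) two_cat_scheme \<Rightarrow> 'f \<Rightarrow> 'x \<Rightarrow> 'x \<Rightarrow> bool" where
  "in_hom1 K f x y \<longleftrightarrow> x \<in> cell0 K \<and> y \<in> cell0 K \<and> f \<in> cell1 K \<and> src K f = x \<and> trg K f = y"

definition in_hom2 :: "('x, 'f, 's, 'm) two_cat_scheme \<Rightarrow> 's \<Rightarrow> 'f \<Rightarrow> 'f \<Rightarrow> bool" where
  "in_hom2 K s f g \<longleftrightarrow> s \<in> cell2 K \<and> f \<in> cell1 K \<and> g \<in> cell1 K \<and> dom2 K s = f \<and> cod2 K s = g"

locale two_category =
  fixes K :: "('x, 'f, 's, 'm) two_cat_scheme" (structure)
  assumes cell1_hom: "f \<in> cell1 K \<Longrightarrow> in_hom1 K f (src K f) (trg K f)"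
    and cell2_hom: "s \<in> cell2 K \<Longrightarrow> in_hom2 K s (dom2 K s) (cod2 K s)"
    and cell2_parallel: "s \<in> cell2 K \<Longrightarrow>
      src K (dom2 K s) = src K (cod2 K s) \<and> trg K (dom2 K s) = trg K (cod2 K s)"
    and one1_hom: "x \<in> cell0 K \<Longrightarrow> in_hom1 K (one1 K x) x x"
    and comp1_hom: "\<lbrakk>in_hom1 K f x y; in_hom1 K g y z\<rbrakk> \<Longrightarrow> in_hom1 K (g \<odot> f) x z"
    and comp1_assoc: "\<lbrakk>in_hom1 K f x y; in_hom1 K g y z; in_hom1 K h z w\<rbrakk> \<Longrightarrow>
      (h \<odot> g) \<odot> f = h \<odot> (g \<odot> f)"
    and comp1_one_left: "in_hom1 K f x y \<Longrightarrow> one1 K y \<odot> f = f"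
    and comp1_one_right: "in_hom1 K f x y \<Longrightarrow> f \<odot> one1 K x = f"
    and one2_hom: "f \<in> cell1 K \<Longrightarrow> in_hom2 K (one2 K f) f f"
    and vcomp_hom: "\<lbrakk>in_hom2 K s f g; in_hom2 K t g h\<rbrakk> \<Longrightarrow> in_hom2 K (t \<bullet> s) f h"
    and vcomp_assoc: "\<lbrakk>in_hom2 K s f g; in_hom2 K t g h; in_hom2 K u h k\<rbrakk> \<Longrightarrow>
      (u \<bullet> t) \<bullet> s = u \<bullet> (t \<bullet> s)"
    and vcomp_one_left: "in_hom2 K s f g \<Longrightarrow> one2 K g \<bullet> s = s"
    and vcomp_one_right: "in_hom2 K s f g \<Longrightarrow> s \<bullet> one2 K f = s"
    and hcomp_hom: "\<lbrakk>in_hom2 K s f f'; in_hom2 K t g g'; trg K f = src K g\<rbrakk> \<Longrightarrow>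
      in_hom2 K (t \<star> s) (g \<odot> f) (g' \<odot> f')"
    and hcomp_assoc: "\<lbrakk>in_hom2 K s f f'; in_hom2 K t g g'; in_hom2 K u h h';
        trg K f = src K g; trg K g = src K h\<rbrakk> \<Longrightarrow> (u \<star> t) \<star> s = u \<star> (t \<star> s)"
    and hcomp_one_left: "in_hom2 K s f f' \<Longrightarrow> one2 K (one1 K (trg K f)) \<star> s = s"
    and hcomp_one_right: "in_hom2 K s f f' \<Longrightarrow> s \<star> one2 K (one1 K (src K f)) = s"
    and hcomp_one2: "\<lbrakk>in_hom1 K f x y; in_hom1 K g y z\<rbrakk> \<Longrightarrow>
      one2 K g \<star> one2 K f = one2 K (g \<odot> f)"
    and interchange: "\<lbrakk>in_hom2 K s f f'; in_hom2 K s' f' f''; in_hom2 K t g g'; in_hom2 K t' g' g'';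
        trg K f = src K g\<rbrakk> \<Longrightarrow> (t' \<bullet> t) \<star> (s' \<bullet> s) = (t' \<star> s') \<bullet> (t \<star> s)"

record ('x, 'f, 's) endo_two_functor =
  fun0 :: "'x \<Rightarrow> 'x"
  fun1 :: "'f \<Rightarrow> 'f"
  fun2 :: "'s \<Rightarrow> 's"

record ('x, 'f, 's) two_monad = "('x, 'f, 's) endo_two_functor" +
  mult :: "'x \<Rightarrow> 'f"
  unit :: "'x \<Rightarrow> 'f"

locale two_endofunctor = two_category K
  for K :: "('x, 'f, 's, 'm) two_cat_scheme" (structure) +
  fixes T :: "('x, 'f, 's, 'n) endo_two_functor_scheme"
  assumes fun0_cell0: "x \<in> cell0 K \<Longrightarrow> fun0 T x \<in> cell0 K"
    and fun1_hom: "in_hom1 K f x y \<Longrightarrow> in_hom1 K (fun1 T f) (fun0 T x) (fun0 T y)"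
    and fun2_hom: "in_hom2 K s f g \<Longrightarrow> in_hom2 K (fun2 T s) (fun1 T f) (fun1 T g)"
    and fun1_one: "x \<in> cell0 K \<Longrightarrow> fun1 T (one1 K x) = one1 K (fun0 T x)"
    and fun1_comp: "\<lbrakk>in_hom1 K f x y; in_hom1 K g y z\<rbrakk> \<Longrightarrow> fun1 T (g \<odot> f) = fun1 T g \<odot> fun1 T f"
    and fun2_one: "f \<in> cell1 K \<Longrightarrow> fun2 T (one2 K f) = one2 K (fun1 T f)"
    and fun2_vcomp: "\<lbrakk>in_hom2 K s f g; in_hom2 K t g h\<rbrakk> \<Longrightarrow>
      fun2 T (t \<bullet> s) = fun2 T t \<bullet> fun2 T s"
    and fun2_hcomp: "\<lbrakk>in_hom2 K s f f'; in_hom2 K t g g'; trg K f = src K g\<rbrakk> \<Longrightarrow>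
      fun2 T (t \<star> s) = fun2 T t \<star> fun2 T s"

locale two_monad = two_endofunctor K T
  for K :: "('x, 'f, 's, 'm) two_cat_scheme" (structure)
    and T :: "('x, 'f, 's, 'n) two_monad_scheme" +
  assumes unit_hom: "x \<in> cell0 K \<Longrightarrow> in_hom1 K (unit T x) x (fun0 T x)"
    and unit_nat1: "in_hom1 K f x y \<Longrightarrow> fun1 T f \<odot> unit T x = unit T y \<odot> f"
    and unit_nat2: "\<lbrakk>in_hom2 K s f g; in_hom1 K f x y\<rbrakk> \<Longrightarrow>
      fun2 T s \<star> one2 K (unit T x) = one2 K (unit T y) \<star> s"
    and mult_hom: "x \<in> cell0 K \<Longrightarrow> in_hom1 K (mult T x) (fun0 T (fun0 T x)) (fun0 T x)"
    and mult_nat1: "in_hom1 K f x y \<Longrightarrow> fun1 T f \<odot> mult T x = mult T y \<odot> fun1 T (fun1 T f)"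
    and mult_nat2: "\<lbrakk>in_hom2 K s f g; in_hom1 K f x y\<rbrakk> \<Longrightarrow>
      fun2 T s \<star> one2 K (mult T x) = one2 K (mult T y) \<star> fun2 T (fun2 T s)"
    and mult_assoc: "x \<in> cell0 K \<Longrightarrow> mult T x \<odot> fun1 T (mult T x) = mult T x \<odot> mult T (fun0 T x)"
    and mult_unit: "x \<in> cell0 K \<Longrightarrow> mult T x \<odot> unit T (fun0 T x) = one1 K (fun0 T x)"
    and mult_fun_unit: "x \<in> cell0 K \<Longrightarrow> mult T x \<odot> fun1 T (unit T x) = one1 K (fun0 T x)"
begin

definition algebra :: "'x \<Rightarrow> 'f \<Rightarrow> bool" where
  "algebra A a \<longleftrightarrow> A \<in> cell0 K \<and> in_hom1 K a (fun0 T A) A \<and>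
     a \<odot> fun1 T a = a \<odot> mult T A \<and> a \<odot> unit T A = one1 K A"

definition colax_morphism :: "'x \<Rightarrow> 'f \<Rightarrow> 'x \<Rightarrow> 'f \<Rightarrow> 'f \<Rightarrow> 's \<Rightarrow> bool" where
  "colax_morphism A a B b f s \<longleftrightarrow>
     algebra A a \<and> algebra B b \<and> in_hom1 K f A B \<and>
     in_hom2 K s (f \<odot> a) (b \<odot> fun1 T f) \<and>
     s \<star> one2 K (mult T A) = (one2 K b \<star> fun2 T s) \<bullet> (s \<star> one2 K (fun1 T a)) \<and>
     s \<star> one2 K (unit T A) = one2 K f"

end

locale colax_idempotent_two_monad = two_monad K T
  for K :: "('x, 'f, 's, 'm) two_cat_scheme" (structure)
    and T :: "('x, 'f, 's, 'n) two_monad_scheme" +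
  assumes unique_colax: "\<lbrakk>algebra A a; algebra B b; in_hom1 K f A B\<rbrakk> \<Longrightarrow>
    \<exists>!s. colax_morphism A a B b f s"


section \<open>Categories with binary products\<close>

text \<open>Hom-sets are indexed by pairs of objects and need not be disjoint; hence composition
  \<open>Cmp C X Y Z g f\<close> (of \<open>f : X \<rightarrow> Y\<close> and \<open>g : Y \<rightarrow> Z\<close>) is indexed by the objects involved.
  The binary products are chosen, but functors are only required to preserve them up to
  isomorphism.\<close>

record ('o, 'a) pcat =
  Obj :: "'o set"
  Hom :: "'o \<Rightarrow> 'o \<Rightarrow> 'a set"
  Idt :: "'o \<Rightarrow> 'a"
  Cmp :: "'o \<Rightarrow> 'o \<Rightarrow> 'o \<Rightarrow> 'a \<Rightarrow> 'a \<Rightarrow> 'a"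
  Prd :: "'o \<Rightarrow> 'o \<Rightarrow> 'o"
  Pr1 :: "'o \<Rightarrow> 'o \<Rightarrow> 'a"
  Pr2 :: "'o \<Rightarrow> 'o \<Rightarrow> 'a"

definition is_product ::
    "('o, 'a, 'm) pcat_scheme \<Rightarrow> 'o \<Rightarrow> 'o \<Rightarrow> 'o \<Rightarrow> 'a \<Rightarrow> 'a \<Rightarrow> bool" where
  "is_product C A B W p q \<longleftrightarrow>
     A \<in> Obj C \<and> B \<in> Obj C \<and> W \<in> Obj C \<and> p \<in> Hom C W A \<and> q \<in> Hom C W B \<and>
     (\<forall>X\<in>Obj C. \<forall>f\<in>Hom C X A. \<forall>g\<in>Hom C X B.
        \<exists>!h. h \<in> Hom C X W \<and> Cmp C X W A p h = f \<and> Cmp C X W B q h = g)"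

locale product_category =
  fixes C :: "('o, 'a, 'm) pcat_scheme"
  assumes Hom_Obj: "f \<in> Hom C A B \<Longrightarrow> A \<in> Obj C \<and> B \<in> Obj C"
    and Idt_Hom: "A \<in> Obj C \<Longrightarrow> Idt C A \<in> Hom C A A"
    and Cmp_Hom: "\<lbrakk>f \<in> Hom C X Y; g \<in> Hom C Y Z\<rbrakk> \<Longrightarrow> Cmp C X Y Z g f \<in> Hom C X Z"
    and Cmp_Idt_left: "f \<in> Hom C X Y \<Longrightarrow> Cmp C X Y Y (Idt C Y) f = f"
    and Cmp_Idt_right: "f \<in> Hom C X Y \<Longrightarrow> Cmp C X X Y f (Idt C X) = f"
    and Cmp_assoc: "\<lbrakk>f \<in> Hom C X Y; g \<in> Hom C Y Z; h \<in> Hom C Z W\<rbrakk> \<Longrightarrow>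
      Cmp C X Y W (Cmp C Y Z W h g) f = Cmp C X Z W h (Cmp C X Y Z g f)"
    and Prd_product: "\<lbrakk>A \<in> Obj C; B \<in> Obj C\<rbrakk> \<Longrightarrow>
      is_product C A B (Prd C A B) (Pr1 C A B) (Pr2 C A B)"

definition Pair_arr :: "('o, 'a, 'm) pcat_scheme \<Rightarrow> 'o \<Rightarrow> 'o \<Rightarrow> 'o \<Rightarrow> 'a \<Rightarrow> 'a \<Rightarrow> 'a" where
  "Pair_arr C X A B f g = (THE h. h \<in> Hom C X (Prd C A B) \<and>
     Cmp C X (Prd C A B) A (Pr1 C A B) h = f \<and> Cmp C X (Prd C A B) B (Pr2 C A B) h = g)"


section \<open>Elementary doctrines\<close>

locale infsl = lower_semilattice L + weak_partial_order_top L
  for L :: "('e, 'm) gorder_scheme" (structure)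

definition infsl_hom :: "('e, 'm) gorder_scheme \<Rightarrow> ('d, 'n) gorder_scheme \<Rightarrow> ('e \<Rightarrow> 'd) \<Rightarrow> bool" where
  "infsl_hom L M h \<longleftrightarrow> h \<in> carrier L \<rightarrow> carrier M \<and> h \<top>\<^bsub>L\<^esub> = \<top>\<^bsub>M\<^esub> \<and>
     (\<forall>x\<in>carrier L. \<forall>y\<in>carrier L. h (x \<sqinter>\<^bsub>L\<^esub> y) = h x \<sqinter>\<^bsub>M\<^esub> h y)"

text \<open>\<open>fib P A\<close> is the poset \<open>P(A)\<close>; for \<open>f : A \<rightarrow> B\<close>, \<open>sub P A B f\<close> is \<open>P\<^sub>f : P(B) \<rightarrow> P(A)\<close>.\<close>

record ('o, 'a, 'e) doctrine = "('o, 'a) pcat" +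
  fib :: "'o \<Rightarrow> 'e gorder"
  sub :: "'o \<Rightarrow> 'o \<Rightarrow> 'a \<Rightarrow> 'e \<Rightarrow> 'e"

locale doctrine = product_category P
  for P :: "('o, 'a, 'e) doctrine" +
  assumes fib_infsl: "A \<in> Obj P \<Longrightarrow> infsl (fib P A)"
    and sub_hom: "f \<in> Hom P A B \<Longrightarrow> infsl_hom (fib P B) (fib P A) (sub P A B f)"
    and sub_Idt: "\<lbrakk>A \<in> Obj P; x \<in> carrier (fib P A)\<rbrakk> \<Longrightarrow> sub P A A (Idt P A) x = x"
    and sub_Cmp: "\<lbrakk>f \<in> Hom P X Y; g \<in> Hom P Y Z; x \<in> carrier (fib P Z)\<rbrakk> \<Longrightarrow>
      sub P X Z (Cmp P X Y Z g f) x = sub P X Y f (sub P Y Z g x)"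

text \<open>Conditions (1) and (2) on \<open>d = \<delta>\<^sub>A \<in> P(A \<times> A)\<close>. The triple product \<open>X \<times> A \<times> A\<close> is taken to
  be \<open>(X \<times> A) \<times> A\<close>, with projections \<open>p1\<close>, \<open>p2\<close>, \<open>p3\<close>.\<close>

definition is_delta1 :: "('o, 'a, 'e) doctrine \<Rightarrow> 'o \<Rightarrow> 'e \<Rightarrow> bool" where
  "is_delta1 P A d \<longleftrightarrow>
     (let AA = Prd P A A in
      galois_connection \<lparr> orderA = fib P A, orderB = fib P AA,
        lower = (\<lambda>x. sub P AA A (Pr1 P A A) x \<sqinter>\<^bsub>fib P AA\<^esub> d),
        upper = sub P A AA (Pair_arr P A A A (Idt P A) (Idt P A)) \<rparr>)"

definition is_delta2 :: "('o, 'a, 'e) doctrine \<Rightarrow> 'o \<Rightarrow> 'e \<Rightarrow> 'o \<Rightarrow> bool" where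
  "is_delta2 P A d X \<longleftrightarrow>
     (let XA = Prd P X A; XAA = Prd P XA A; AA = Prd P A A;
          p1 = Cmp P XAA XA X (Pr1 P X A) (Pr1 P XA A);
          p2 = Cmp P XAA XA A (Pr2 P X A) (Pr1 P XA A);
          p3 = Pr2 P XA A;
          e = Pair_arr P XA XA A (Pair_arr P XA X A (Pr1 P X A) (Pr2 P X A)) (Pr2 P X A)
      in galois_connection \<lparr> orderA = fib P XA, orderB = fib P XAA,
        lower = (\<lambda>x. sub P XAA XA (Pair_arr P XAA X A p1 p2) x
                     \<sqinter>\<^bsub>fib P XAA\<^esub> sub P XAA AA (Pair_arr P XAA A A p2 p3) d),
        upper = sub P XA XAA e \<rparr>)"

definition is_delta :: "('o, 'a, 'e) doctrine \<Rightarrow> 'o \<Rightarrow> 'e \<Rightarrow> bool" where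
  "is_delta P A d \<longleftrightarrow> d \<in> carrier (fib P (Prd P A A)) \<and>
     is_delta1 P A d \<and> (\<forall>X\<in>Obj P. is_delta2 P A d X)"

locale elementary_doctrine = doctrine P
  for P :: "('o, 'a, 'e) doctrine" +
  assumes delta_exists: "A \<in> Obj P \<Longrightarrow> \<exists>d. is_delta P A d"

text \<open>The element \<open>\<delta>\<^sub>A\<close> is unique, being the value at \<open>\<top>\<close> of the left adjoint in (1).\<close>

definition delta :: "('o, 'a, 'e) doctrine \<Rightarrow> 'o \<Rightarrow> 'e" where
  "delta P A = (THE d. is_delta P A d)"


section \<open>The 2-category of elementary doctrines\<close>

text \<open>Cells carry their source and target, and their component functions are \<open>undefined\<close>
  outside the relevant carriers, so that equality of cells is equality in HOL.\<close>

record ('o, 'a, 'e) dmor =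
  dsrc :: "('o, 'a, 'e) doctrine"
  dtrg :: "('o, 'a, 'e) doctrine"
  ob :: "'o \<Rightarrow> 'o"
  ar :: "'o \<Rightarrow> 'o \<Rightarrow> 'a \<Rightarrow> 'a"
  el :: "'o \<Rightarrow> 'e \<Rightarrow> 'e"

locale ed_morphism =
  fixes F :: "('o, 'a, 'e) dmor"
    and P R :: "('o, 'a, 'e) doctrine"
  defines "P \<equiv> dsrc F" and "R \<equiv> dtrg F"
  assumes src_elementary: "elementary_doctrine P"
    and trg_elementary: "elementary_doctrine R"
    and ob_Obj: "ob F \<in> Obj P \<rightarrow>\<^sub>E Obj R"
    and ar_Hom: "ar F A B \<in> Hom P A B \<rightarrow>\<^sub>E Hom R (ob F A) (ob F B)"
    and ar_Idt: "A \<in> Obj P \<Longrightarrow> ar F A A (Idt P A) = Idt R (ob F A)"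
    and ar_Cmp: "\<lbrakk>f \<in> Hom P X Y; g \<in> Hom P Y Z\<rbrakk> \<Longrightarrow>
      ar F X Z (Cmp P X Y Z g f) = Cmp R (ob F X) (ob F Y) (ob F Z) (ar F Y Z g) (ar F X Y f)"
    and ar_product: "is_product P A B W p q \<Longrightarrow>
      is_product R (ob F A) (ob F B) (ob F W) (ar F W A p) (ar F W B q)"
    and el_extensional: "el F \<in> extensional (Obj P)"
    and el_fib: "A \<in> Obj P \<Longrightarrow> el F A \<in> extensional (carrier (fib P A))"
    and el_hom: "A \<in> Obj P \<Longrightarrow> infsl_hom (fib P A) (fib R (ob F A)) (el F A)"
    and el_natural: "\<lbrakk>f \<in> Hom P A B; x \<in> carrier (fib P B)\<rbrakk> \<Longrightarrow>
      el F A (sub P A B f x) = sub R (ob F A) (ob F B) (ar F A B f) (el F B x)"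
    and el_delta: "A \<in> Obj P \<Longrightarrow>
      el F (Prd P A A) (delta P A) =
        sub R (ob F (Prd P A A)) (Prd R (ob F A) (ob F A))
          (Pair_arr R (ob F (Prd P A A)) (ob F A) (ob F A)
             (ar F (Prd P A A) A (Pr1 P A A)) (ar F (Prd P A A) A (Pr2 P A A)))
          (delta R (ob F A))"

record ('o, 'a, 'e) dcell =
  ddom :: "('o, 'a, 'e) dmor"
  dcod :: "('o, 'a, 'e) dmor"
  cmpt :: "'o \<Rightarrow> 'a"

locale ed_cell =
  fixes \<theta> :: "('o, 'a, 'e) dcell"
    and F G :: "('o, 'a, 'e) dmor"
    and P R :: "('o, 'a, 'e) doctrine"
  defines "F \<equiv> ddom \<theta>" and "G \<equiv> dcod \<theta>" and "P \<equiv> dsrc F" and "R \<equiv> dtrg F"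
  assumes dom_morphism: "ed_morphism F"
    and cod_morphism: "ed_morphism G"
    and parallel: "dsrc G = P" "dtrg G = R"
    and cmpt_extensional: "cmpt \<theta> \<in> extensional (Obj P)"
    and cmpt_Hom: "A \<in> Obj P \<Longrightarrow> cmpt \<theta> A \<in> Hom R (ob F A) (ob G A)"
    and cmpt_natural: "f \<in> Hom P A B \<Longrightarrow>
      Cmp R (ob F A) (ob F B) (ob G B) (cmpt \<theta> B) (ar F A B f) =
      Cmp R (ob F A) (ob G A) (ob G B) (ar G A B f) (cmpt \<theta> A)"
    and cmpt_le: "\<lbrakk>A \<in> Obj P; x \<in> carrier (fib P A)\<rbrakk> \<Longrightarrow>
      el F A x \<sqsubseteq>\<^bsub>fib R (ob F A)\<^esub> sub R (ob F A) (ob G A) (cmpt \<theta> A) (el G A x)"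

definition dmor_id :: "('o, 'a, 'e) doctrine \<Rightarrow> ('o, 'a, 'e) dmor" where
  "dmor_id P = \<lparr> dsrc = P, dtrg = P,
     ob = (\<lambda>A\<in>Obj P. A),
     ar = (\<lambda>A B. \<lambda>f\<in>Hom P A B. f),
     el = (\<lambda>A\<in>Obj P. \<lambda>x\<in>carrier (fib P A). x) \<rparr>"

definition dmor_comp :: "('o, 'a, 'e) dmor \<Rightarrow> ('o, 'a, 'e) dmor \<Rightarrow> ('o, 'a, 'e) dmor" where
  "dmor_comp G F = (let P = dsrc F in
     \<lparr> dsrc = P, dtrg = dtrg G,
       ob = (\<lambda>A\<in>Obj P. ob G (ob F A)),
       ar = (\<lambda>A B. \<lambda>f\<in>Hom P A B. ar G (ob F A) (ob F B) (ar F A B f)),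
       el = (\<lambda>A\<in>Obj P. \<lambda>x\<in>carrier (fib P A). el G (ob F A) (el F A x)) \<rparr>)"

definition dcell_id :: "('o, 'a, 'e) dmor \<Rightarrow> ('o, 'a, 'e) dcell" where
  "dcell_id F = \<lparr> ddom = F, dcod = F, cmpt = (\<lambda>A\<in>Obj (dsrc F). Idt (dtrg F) (ob F A)) \<rparr>"

definition dcell_vcomp :: "('o, 'a, 'e) dcell \<Rightarrow> ('o, 'a, 'e) dcell \<Rightarrow> ('o, 'a, 'e) dcell" where
  "dcell_vcomp \<phi> \<theta> = (let F = ddom \<theta>; G = dcod \<theta>; H = dcod \<phi> in
     \<lparr> ddom = F, dcod = H,
       cmpt = (\<lambda>A\<in>Obj (dsrc F). Cmp (dtrg F) (ob F A) (ob G A) (ob H A) (cmpt \<phi> A) (cmpt \<theta> A)) \<rparr>)"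

text \<open>For \<open>\<theta> : F \<Rightarrow> F'\<close> and \<open>\<phi> : G \<Rightarrow> G'\<close>, the component of \<open>\<phi> \<star> \<theta>\<close> at \<open>A\<close> is
  \<open>\<phi>\<close> at \<open>F' A\<close> after \<open>G\<close> of \<open>\<theta>\<close> at \<open>A\<close>.\<close>

definition dcell_hcomp :: "('o, 'a, 'e) dcell \<Rightarrow> ('o, 'a, 'e) dcell \<Rightarrow> ('o, 'a, 'e) dcell" where
  "dcell_hcomp \<phi> \<theta> = (let F = ddom \<theta>; F' = dcod \<theta>; G = ddom \<phi>; G' = dcod \<phi> in
     \<lparr> ddom = dmor_comp G F, dcod = dmor_comp G' F',
       cmpt = (\<lambda>A\<in>Obj (dsrc F).
         Cmp (dtrg G) (ob G (ob F A)) (ob G (ob F' A)) (ob G' (ob F' A))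
           (cmpt \<phi> (ob F' A)) (ar G (ob F A) (ob F' A) (cmpt \<theta> A))) \<rparr>)"

definition ED ::
    "(('o, 'a, 'e) doctrine, ('o, 'a, 'e) dmor, ('o, 'a, 'e) dcell) two_cat" where
  "ED = \<lparr> cell0 = {P. elementary_doctrine P},
     cell1 = {F. ed_morphism F},
     cell2 = {\<theta>. ed_cell \<theta>},
     src = dsrc, trg = dtrg, one1 = dmor_id, comp1 = dmor_comp,
     dom2 = ddom, cod2 = dcod, one2 = dcell_id, vcomp = dcell_vcomp, hcomp = dcell_hcomp \<rparr>"


section \<open>The comprehension completion\<close>

text \<open>The completion turns objects \<open>A\<close> into pairs \<open>(A, \<alpha>)\<close>, so to have it act on a single 2-category
  \<open>ED\<close> the type of objects must be closed under pairing with elements. The type below is the free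
  one over an arbitrary type \<open>'b\<close>: \<open>Ext A \<alpha>\<close> is the pair \<open>(A, \<alpha>)\<close>, and a doctrine whose
  objects live in \<open>'b\<close> is represented through \<open>Base\<close>. Doctrines in \<open>ED\<close> may use any set of
  objects of this type.\<close>

datatype ('b, 'e) obj = Base 'b | Ext (under: "('b, 'e) obj") (pred: 'e)

type_synonym ('b, 'a, 'e) cdoctrine = "(('b, 'e) obj, 'a, 'e) doctrine"
type_synonym ('b, 'a, 'e) cdmor = "(('b, 'e) obj, 'a, 'e) dmor"
type_synonym ('b, 'a, 'e) cdcell = "(('b, 'e) obj, 'a, 'e) dcell"

text \<open>The base category of \<open>Tc0 P\<close> is \<open>\<G>\<^sub>P\<close>, whose product of \<open>(A, \<alpha>)\<close> and \<open>(B, \<beta>)\<close> is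
  \<open>A \<times> B\<close> with the meet of the reindexings of \<open>\<alpha>\<close> and \<open>\<beta>\<close> along the projections.\<close>

definition Tc0 :: "('b, 'a, 'e) cdoctrine \<Rightarrow> ('b, 'a, 'e) cdoctrine" where
  "Tc0 P =
   (let Ob = {Ext A \<alpha> | A \<alpha>. A \<in> Obj P \<and> \<alpha> \<in> carrier (fib P A)} in
    \<lparr> Obj = Ob,
      Hom = (\<lambda>X Y. {f. X \<in> Ob \<and> Y \<in> Ob \<and> f \<in> Hom P (under X) (under Y) \<and>
        pred X \<sqsubseteq>\<^bsub>fib P (under X)\<^esub> sub P (under X) (under Y) f (pred Y)}),
      Idt = (\<lambda>X. Idt P (under X)),
      Cmp = (\<lambda>X Y Z. Cmp P (under X) (under Y) (under Z)),
      Prd = (\<lambda>X Y. let A = under X; B = under Y; AB = Prd P A B in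
        Ext AB (sub P AB A (Pr1 P A B) (pred X) \<sqinter>\<^bsub>fib P AB\<^esub> sub P AB B (Pr2 P A B) (pred Y))),
      Pr1 = (\<lambda>X Y. Pr1 P (under X) (under Y)),
      Pr2 = (\<lambda>X Y. Pr2 P (under X) (under Y)),
      fib = (\<lambda>X. \<lparr> carrier = {\<gamma> \<in> carrier (fib P (under X)). \<gamma> \<sqsubseteq>\<^bsub>fib P (under X)\<^esub> pred X},
                   eq = (=), le = le (fib P (under X)) \<rparr>),
      sub = (\<lambda>X Y f \<gamma>. sub P (under X) (under Y) f \<gamma> \<sqinter>\<^bsub>fib P (under X)\<^esub> pred X) \<rparr>)"

definition Tc1 :: "('b, 'a, 'e) cdmor \<Rightarrow> ('b, 'a, 'e) cdmor" where
  "Tc1 F = (let Q = Tc0 (dsrc F) in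
     \<lparr> dsrc = Q, dtrg = Tc0 (dtrg F),
       ob = (\<lambda>X\<in>Obj Q. Ext (ob F (under X)) (el F (under X) (pred X))),
       ar = (\<lambda>X Y. \<lambda>f\<in>Hom Q X Y. ar F (under X) (under Y) f),
       el = (\<lambda>X\<in>Obj Q. \<lambda>\<gamma>\<in>carrier (fib Q X). el F (under X) \<gamma>) \<rparr>)"

definition Tc2 :: "('b, 'a, 'e) cdcell \<Rightarrow> ('b, 'a, 'e) cdcell" where
  "Tc2 \<theta> = \<lparr> ddom = Tc1 (ddom \<theta>), dcod = Tc1 (dcod \<theta>),
     cmpt = (\<lambda>X\<in>Obj (Tc0 (dsrc (ddom \<theta>))). cmpt \<theta> (under X)) \<rparr>"

definition Tc_unit :: "('b, 'a, 'e) cdoctrine \<Rightarrow> ('b, 'a, 'e) cdmor" where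
  "Tc_unit P = \<lparr> dsrc = P, dtrg = Tc0 P,
     ob = (\<lambda>A\<in>Obj P. Ext A \<top>\<^bsub>fib P A\<^esub>),
     ar = (\<lambda>A B. \<lambda>f\<in>Hom P A B. f),
     el = (\<lambda>A\<in>Obj P. \<lambda>x\<in>carrier (fib P A). x) \<rparr>"

definition Tc_mult :: "('b, 'a, 'e) cdoctrine \<Rightarrow> ('b, 'a, 'e) cdmor" where
  "Tc_mult P = (let Q = Tc0 (Tc0 P) in
     \<lparr> dsrc = Q, dtrg = Tc0 P,
       ob = (\<lambda>X\<in>Obj Q. Ext (under (under X)) (pred X)),
       ar = (\<lambda>X Y. \<lambda>f\<in>Hom Q X Y. f),
       el = (\<lambda>X\<in>Obj Q. \<lambda>\<gamma>\<in>carrier (fib Q X). \<gamma>) \<rparr>)"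

definition Tc :: "(('b, 'a, 'e) cdoctrine, ('b, 'a, 'e) cdmor, ('b, 'a, 'e) cdcell) two_monad" where
  "Tc = \<lparr> fun0 = Tc0, fun1 = Tc1, fun2 = Tc2, mult = Tc_mult, unit = Tc_unit \<rparr>"

end

theory Submission
  imports Defs
begin

text \<open>
  Write \<open>T\<close> for the comprehension completion, with unit \<open>\<eta>\<close> and multiplication \<open>\<mu>\<close>. An object of
  \<open>T P\<close> is a pair \<open>(A, \<alpha>)\<close>, and there are two ways of viewing it as an object of \<open>T (T P)\<close>: the unit of
  \<open>T P\<close> gives \<open>((A, \<alpha>), \<alpha>)\<close> and the completion of \<open>\<eta>\<close> gives \<open>((A, \<top>), \<alpha>)\<close>. The identity of \<open>A\<close> is
  an arrow from the first to the second. These arrows form a 2-cell \<open>\<lambda> : \<eta> T \<Rightarrow> T \<eta>\<close> which is an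
  identity on objects \<open>(A, \<top>)\<close> and becomes an identity after \<open>\<mu>\<close>, because \<open>\<mu>\<close> sends both objects to
  \<open>(A, \<alpha>)\<close>.

  Such a comparison cell makes any 2-monad colax-idempotent (\<open>comparison_two_monad.colax_idempotent\<close>).
  If \<open>a\<close> is an algebra, then \<open>\<epsilon> = T a \<star> \<lambda> : \<eta> \<odot> a \<Rightarrow> 1\<close> is the counit of an adjunction in which \<open>\<eta>\<close>
  is left adjoint to \<open>a\<close> and the unit is an identity. For the completion this says that \<open>a (A, \<alpha>)\<close> is a
  comprehension of \<open>\<alpha>\<close>, with the component of \<open>\<epsilon>\<close> as its inclusion into \<open>A\<close>. For a 1-cell \<open>f\<close> between
  algebras \<open>a\<close> and \<open>b\<close> the cell \<open>b \<star> T f \<star> \<epsilon>\<close> goes from \<open>b \<odot> T f \<odot> \<eta> \<odot> a = f \<odot> a\<close> to \<open>b \<odot> T f\<close>, and it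
  is the only possible structure of a colax morphism on \<open>f\<close> (\<open>colax_cell_eq\<close>,
  \<open>colax_morphism_counit\<close>): uniqueness follows by evaluating the horizontal composite of a structure
  cell with \<open>\<epsilon>\<close> in both orders, and the multiplicativity axiom by transposing along the adjunction
  (\<open>counit_mult\<close>).

  It remains to see that elementary doctrines form a 2-category and that \<open>T\<close> is a 2-monad on it.
  Equations between cells are checked on components, where they reduce to category laws. The
  mathematical content lies in the typing of \<open>T\<close>. Its 1-cells preserve products because the
  products in the completion are exactly the products below equipped with the meet of the
  reindexed predicates (\<open>is_product_Tc0I\<close>, \<open>is_product_Tc0D\<close>). Its values are elementary because the
  adjunctions that define equality predicates restrict to elements below a given predicate
  (\<open>adjunction_restrict\<close>), so that the equality predicate of \<open>(A, \<alpha>)\<close> is that of \<open>A\<close> truncated to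
  \<open>\<alpha>\<close> in both variables (\<open>Tc0_delta\<close>).
\<close>

section \<open>Two-monads with a comparison cell\<close>

context two_category
begin

lemma in_hom1D:
  assumes "in_hom1 K f x y"
  shows "f \<in> cell1 K" "src K f = x" "trg K f = y" "x \<in> cell0 K" "y \<in> cell0 K"
  using assms by (auto simp: in_hom1_def)

lemma one2_hom': "in_hom1 K f x y \<Longrightarrow> in_hom2 K (one2 K f) f f"
  by (simp add: one2_hom in_hom1D)

lemma hcomp_hom':
  assumes "in_hom2 K s f f'" "in_hom2 K t g g'" "in_hom1 K f x y" "in_hom1 K g y z"
  shows "in_hom2 K (t \<star> s) (g \<odot> f) (g' \<odot> f')"
  using assms hcomp_hom in_hom1D by metis

lemma hcomp_assoc':
  assumes "in_hom2 K s f f'" "in_hom2 K t g g'" "in_hom2 K u h h'"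
    and "in_hom1 K f x y" "in_hom1 K g y z" "in_hom1 K h z w"
  shows "(u \<star> t) \<star> s = u \<star> (t \<star> s)"
  using assms hcomp_assoc in_hom1D by metis

lemma in_hom2_parallel:
  assumes "in_hom2 K s f g" "in_hom1 K f x y"
  shows "in_hom1 K g x y"
proof -
  have "in_hom1 K g (src K g) (trg K g)"
    using assms cell1_hom by (auto simp: in_hom2_def)
  then show ?thesis
    using assms cell2_parallel[of s] by (auto simp: in_hom1_def in_hom2_def)
qed

text \<open>The two ways of writing a horizontal composite as a vertical composite of whiskerings. That
  they agree is naturality, and both uniqueness arguments below compare them.\<close>
lemma hcomp_inner_first:
  assumes s: "in_hom2 K s f f'" and t: "in_hom2 K t g g'"
    and f: "in_hom1 K f x y" and g: "in_hom1 K g y z"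
  shows "t \<star> s = (t \<star> one2 K f') \<bullet> (one2 K g \<star> s)"
proof -
  have f': "in_hom1 K f' x y" and g': "in_hom1 K g' y z"
    using in_hom2_parallel s t f g by blast+
  have "(t \<bullet> one2 K g) \<star> (one2 K f' \<bullet> s) = (t \<star> one2 K f') \<bullet> (one2 K g \<star> s)"
    by (rule interchange[OF s one2_hom'[OF f'] one2_hom'[OF g] t]) (simp add: in_hom1D[OF f] in_hom1D[OF g])
  then show ?thesis
    by (simp add: vcomp_one_left[OF s] vcomp_one_right[OF t])
qed

lemma hcomp_outer_first:
  assumes s: "in_hom2 K s f f'" and t: "in_hom2 K t g g'"
    and f: "in_hom1 K f x y" and g: "in_hom1 K g y z"
  shows "t \<star> s = (one2 K g' \<star> s) \<bullet> (t \<star> one2 K f)"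
proof -
  have f': "in_hom1 K f' x y" and g': "in_hom1 K g' y z"
    using in_hom2_parallel s t f g by blast+
  have "(one2 K g' \<bullet> t) \<star> (s \<bullet> one2 K f) = (one2 K g' \<star> s) \<bullet> (t \<star> one2 K f)"
    by (rule interchange[OF one2_hom'[OF f] s t one2_hom'[OF g']]) (simp add: in_hom1D[OF f] in_hom1D[OF g])
  then show ?thesis
    by (simp add: vcomp_one_left[OF t] vcomp_one_right[OF s])
qed

lemma whisker_left_vcomp:
  assumes s: "in_hom2 K s f f'" and s': "in_hom2 K s' f' f''"
    and f: "in_hom1 K f x y" and g: "in_hom1 K g y z"
  shows "one2 K g \<star> (s' \<bullet> s) = (one2 K g \<star> s') \<bullet> (one2 K g \<star> s)"
  using interchange[OF s s' one2_hom'[OF g] one2_hom'[OF g]]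
  by (simp add: vcomp_one_left[OF one2_hom'[OF g]] in_hom1D[OF f] in_hom1D[OF g])

end

text \<open>The cell \<open>lam\<close> is the one that witnesses, for Kock-Zoeberlein monads, that algebra
  structures are adjoint to units: it compares the two ways \<open>\<eta> T\<close> and
  \<open>T \<eta>\<close> of freely extending a free object, and it becomes an identity both on generators and after
  multiplication. Its direction, from \<open>\<eta> T\<close> to \<open>T \<eta>\<close>, makes the 2-monad colax-idempotent; the
  opposite direction would make it lax-idempotent.\<close>

locale comparison_two_monad = two_monad K T
  for K :: "('x, 'f, 's, 'm) two_cat_scheme" (structure)
    and T :: "('x, 'f, 's, 'n) two_monad_scheme" +
  fixes lam :: "'x \<Rightarrow> 's"
  assumes lam_hom: "x \<in> cell0 K \<Longrightarrow>
      in_hom2 K (lam x) (unit T (fun0 T x)) (fun1 T (unit T x))"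
    and lam_unit: "x \<in> cell0 K \<Longrightarrow>
      lam x \<star> one2 K (unit T x) = one2 K (unit T (fun0 T x) \<odot> unit T x)"
    and mult_lam: "x \<in> cell0 K \<Longrightarrow> one2 K (mult T x) \<star> lam x = one2 K (one1 K (fun0 T x))"

context comparison_two_monad
begin

text \<open>For an algebra \<open>a\<close> this is the counit \<open>\<eta> \<odot> a \<Rightarrow> 1\<close> of an adjunction in which the unit \<open>\<eta>\<close> of
  the 2-monad is left adjoint to \<open>a\<close> and whose own unit is the identity \<open>1 = a \<odot> \<eta>\<close>: the source is
  \<open>T a \<odot> \<eta> T = \<eta> \<odot> a\<close> by naturality, the target \<open>T a \<odot> T \<eta> = T 1\<close> by the unit law of the algebra.\<close>
definition counit :: "'x \<Rightarrow> 'f \<Rightarrow> 's" where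
  "counit A a = one2 K (fun1 T a) \<star> lam A"

context
  fixes A :: 'x and a :: 'f
  assumes algebra: "algebra A a"
begin

lemma algebraD: "A \<in> cell0 K" "in_hom1 K a (fun0 T A) A"
    "a \<odot> fun1 T a = a \<odot> mult T A" "a \<odot> unit T A = one1 K A"
  using algebra by (auto simp: algebra_def)

lemma free_cell0: "fun0 T A \<in> cell0 K" "fun0 T (fun0 T A) \<in> cell0 K"
  using algebraD fun0_cell0 by auto

lemma algebra_hom1:
  "in_hom1 K (fun1 T a) (fun0 T (fun0 T A)) (fun0 T A)"
  "in_hom1 K (unit T A) A (fun0 T A)"
  "in_hom1 K (unit T (fun0 T A)) (fun0 T A) (fun0 T (fun0 T A))"
  "in_hom1 K (mult T A) (fun0 T (fun0 T A)) (fun0 T A)"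
  using algebraD free_cell0 by (auto intro: fun1_hom unit_hom mult_hom)

lemma counit_hom: "in_hom2 K (counit A a) (unit T A \<odot> a) (one1 K (fun0 T A))"
proof -
  have "in_hom2 K (counit A a) (fun1 T a \<odot> unit T (fun0 T A)) (fun1 T a \<odot> fun1 T (unit T A))"
    unfolding counit_def
    by (rule hcomp_hom'[OF lam_hom[OF algebraD(1)] one2_hom'[OF algebra_hom1(1)] algebra_hom1(3) algebra_hom1(1)])
  moreover have "fun1 T a \<odot> unit T (fun0 T A) = unit T A \<odot> a"
    by (rule unit_nat1[OF algebraD(2)])
  moreover have "fun1 T a \<odot> fun1 T (unit T A) = one1 K (fun0 T A)"
    by (simp add: fun1_comp[OF algebra_hom1(2) algebraD(2), symmetric] algebraD fun1_one)
  ultimately show ?thesis by simp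
qed

lemma unit_a: "in_hom1 K (unit T A \<odot> a) (fun0 T A) (fun0 T A)"
  using comp1_hom[OF algebraD(2) algebra_hom1(2)] .

text \<open>The first triangle identity: \<open>a \<odot> T a = a \<odot> \<mu>\<close>, so that whiskering with \<open>a\<close> turns the
  counit into a whiskering of \<open>\<mu> \<star> lam\<close>, which is an identity.\<close>
lemma structure_counit: "one2 K a \<star> counit A a = one2 K a"
proof -
  have l: "in_hom2 K (lam A) (unit T (fun0 T A)) (fun1 T (unit T A))"
    by (rule lam_hom[OF algebraD(1)])
  have "one2 K a \<star> counit A a = (one2 K a \<star> one2 K (fun1 T a)) \<star> lam A"
    unfolding counit_def
    by (rule hcomp_assoc'[OF l one2_hom'[OF algebra_hom1(1)] one2_hom'[OF algebraD(2)]
          algebra_hom1(3) algebra_hom1(1) algebraD(2), symmetric])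
  also have "\<dots> = (one2 K a \<star> one2 K (mult T A)) \<star> lam A"
    by (simp add: hcomp_one2[OF algebra_hom1(1) algebraD(2)] hcomp_one2[OF algebra_hom1(4) algebraD(2)] algebraD)
  also have "\<dots> = one2 K a \<star> (one2 K (mult T A) \<star> lam A)"
    by (rule hcomp_assoc'[OF l one2_hom'[OF algebra_hom1(4)] one2_hom'[OF algebraD(2)]
          algebra_hom1(3) algebra_hom1(4) algebraD(2)])
  also have "\<dots> = one2 K a"
    using hcomp_one_right[OF one2_hom'[OF algebraD(2)]] by (simp add: mult_lam algebraD in_hom1D[OF algebraD(2)])
  finally show ?thesis .
qed

text \<open>The second triangle identity, inherited from the behaviour of \<open>lam\<close> on generators.\<close>
lemma counit_unit: "counit A a \<star> one2 K (unit T A) = one2 K (unit T A)"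
proof -
  have l: "in_hom2 K (lam A) (unit T (fun0 T A)) (fun1 T (unit T A))"
    by (rule lam_hom[OF algebraD(1)])
  have "counit A a \<star> one2 K (unit T A) = one2 K (fun1 T a) \<star> (lam A \<star> one2 K (unit T A))"
    unfolding counit_def
    by (rule hcomp_assoc'[OF one2_hom'[OF algebra_hom1(2)] l one2_hom'[OF algebra_hom1(1)]
          algebra_hom1(2) algebra_hom1(3) algebra_hom1(1)])
  also have "\<dots> = one2 K (fun1 T a \<odot> (unit T (fun0 T A) \<odot> unit T A))"
    by (simp add: lam_unit[OF algebraD(1)] hcomp_one2[OF comp1_hom[OF algebra_hom1(2,3)] algebra_hom1(1)])
  also have "fun1 T a \<odot> (unit T (fun0 T A) \<odot> unit T A) = (unit T A \<odot> a) \<odot> unit T A"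
    by (simp add: comp1_assoc[OF algebra_hom1(2,3,1), symmetric] unit_nat1[OF algebraD(2)])
  also have "\<dots> = unit T A"
    by (simp add: comp1_assoc[OF algebra_hom1(2) algebraD(2) algebra_hom1(2)] algebraD comp1_one_right[OF algebra_hom1(2)])
  finally show ?thesis .
qed

text \<open>Transposition along the adjunction: cells \<open>\<eta> \<odot> g \<Rightarrow> h\<close> correspond to cells \<open>g \<Rightarrow> a \<odot> h\<close>, so
  two of them agree as soon as they agree after whiskering with \<open>a\<close>.\<close>
lemma cell_from_unit_determined:
  assumes u: "in_hom2 K u (unit T A \<odot> g) h" and g: "in_hom1 K g x A"
  shows "u = (counit A a \<star> one2 K h) \<bullet> (one2 K (unit T A) \<star> (one2 K a \<star> u))"
proof -
  have ug: "in_hom1 K (unit T A \<odot> g) x (fun0 T A)" by (rule comp1_hom[OF g algebra_hom1(2)])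
  have "u = one2 K (one1 K (fun0 T A)) \<star> u"
    using hcomp_one_left[OF u] by (simp add: in_hom1D[OF ug])
  have split: "counit A a \<star> u = (counit A a \<star> one2 K h) \<bullet> (one2 K (unit T A \<odot> a) \<star> u)"
    by (rule hcomp_inner_first[OF u counit_hom ug unit_a])
  have split': "counit A a \<star> u = (one2 K (one1 K (fun0 T A)) \<star> u) \<bullet>
      (counit A a \<star> one2 K (unit T A \<odot> g))"
    by (rule hcomp_outer_first[OF u counit_hom ug unit_a])
  have "counit A a \<star> one2 K (unit T A \<odot> g) = counit A a \<star> (one2 K (unit T A) \<star> one2 K g)"
    by (simp add: hcomp_one2[OF g algebra_hom1(2)])
  also have "\<dots> = (counit A a \<star> one2 K (unit T A)) \<star> one2 K g"
    by (rule hcomp_assoc'[OF one2_hom'[OF g] one2_hom'[OF algebra_hom1(2)] counit_hom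
          g algebra_hom1(2) unit_a, symmetric])
  also have "\<dots> = one2 K (unit T A \<odot> g)"
    by (simp add: counit_unit hcomp_one2[OF g algebra_hom1(2)])
  finally have "counit A a \<star> u = u"
    using split' \<open>u = one2 K (one1 K (fun0 T A)) \<star> u\<close> vcomp_one_right[OF u] by simp
  moreover have "one2 K (unit T A \<odot> a) \<star> u = one2 K (unit T A) \<star> (one2 K a \<star> u)"
    using hcomp_assoc'[OF u one2_hom'[OF algebraD(2)] one2_hom'[OF algebra_hom1(2)] ug algebraD(2) algebra_hom1(2)]
    by (simp add: hcomp_one2[OF algebraD(2) algebra_hom1(2)])
  ultimately show ?thesis using split by simp
qed

text \<open>The multiplicativity axiom of colax morphisms for the counit itself. Both sides start at
  \<open>\<eta> \<odot> (a \<odot> T a)\<close> and become the identity of \<open>a \<odot> T a\<close> after whiskering with \<open>a\<close>, by the first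
  triangle identity and associativity of the algebra; transposition gives equality.\<close>
lemma counit_mult:
  "counit A a \<star> one2 K (mult T A)
    = (one2 K (mult T A) \<star> fun2 T (counit A a)) \<bullet> (counit A a \<star> one2 K (fun1 T a))"
  (is "?l = ?r")
proof -
  let ?\<epsilon> = "counit A a" and ?\<mu> = "mult T A" and ?Ta = "fun1 T a" and ?\<eta> = "unit T A"
  have aTa: "in_hom1 K (a \<odot> ?Ta) (fun0 T (fun0 T A)) A" by (rule comp1_hom[OF algebra_hom1(1) algebraD(2)])
  have eq1: "(?\<eta> \<odot> a) \<odot> ?Ta = ?\<eta> \<odot> (a \<odot> ?Ta)"
    by (rule comp1_assoc[OF algebra_hom1(1) algebraD(2) algebra_hom1(2)])
  have eq2: "(?\<eta> \<odot> a) \<odot> ?\<mu> = ?\<eta> \<odot> (a \<odot> ?Ta)"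
    using comp1_assoc[OF algebra_hom1(4) algebraD(2) algebra_hom1(2)] by (simp add: algebraD)
  have one: "one1 K (fun0 T A) \<odot> ?\<mu> = ?\<mu>" "one1 K (fun0 T A) \<odot> ?Ta = ?Ta"
    by (rule comp1_one_left[OF algebra_hom1(4)], rule comp1_one_left[OF algebra_hom1(1)])
  have T\<epsilon>: "in_hom2 K (fun2 T ?\<epsilon>) (fun1 T ?\<eta> \<odot> ?Ta) (one1 K (fun0 T (fun0 T A)))"
    using fun2_hom[OF counit_hom] by (simp add: fun1_comp[OF algebraD(2) algebra_hom1(2)] fun1_one[OF free_cell0(1)])
  have T\<eta>: "in_hom1 K (fun1 T ?\<eta>) (fun0 T A) (fun0 T (fun0 T A))"
    by (rule fun1_hom[OF algebra_hom1(2)])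
  have T\<eta>a: "in_hom1 K (fun1 T ?\<eta> \<odot> ?Ta) (fun0 T (fun0 T A)) (fun0 T (fun0 T A))"
    by (rule comp1_hom[OF algebra_hom1(1) T\<eta>])
  have \<mu>T\<eta>a: "?\<mu> \<odot> (fun1 T ?\<eta> \<odot> ?Ta) = ?Ta"
    using comp1_assoc[OF algebra_hom1(1) T\<eta> algebra_hom1(4)] one by (simp add: mult_fun_unit[OF algebraD(1)])
  have l: "in_hom2 K ?l (?\<eta> \<odot> (a \<odot> ?Ta)) ?\<mu>"
    using hcomp_hom'[OF one2_hom'[OF algebra_hom1(4)] counit_hom algebra_hom1(4) unit_a] by (simp add: eq2 one)
  have r1: "in_hom2 K (?\<epsilon> \<star> one2 K ?Ta) (?\<eta> \<odot> (a \<odot> ?Ta)) ?Ta"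
    using hcomp_hom'[OF one2_hom'[OF algebra_hom1(1)] counit_hom algebra_hom1(1) unit_a] by (simp add: eq1 one)
  have r2: "in_hom2 K (one2 K ?\<mu> \<star> fun2 T ?\<epsilon>) ?Ta ?\<mu>"
    using hcomp_hom'[OF T\<epsilon> one2_hom'[OF algebra_hom1(4)] T\<eta>a algebra_hom1(4)]
    by (simp add: \<mu>T\<eta>a comp1_one_right[OF algebra_hom1(4)])
  have r: "in_hom2 K ?r (?\<eta> \<odot> (a \<odot> ?Ta)) ?\<mu>"
    by (rule vcomp_hom[OF r1 r2])
  have "one2 K a \<star> ?l = (one2 K a \<star> ?\<epsilon>) \<star> one2 K ?\<mu>"
    by (rule hcomp_assoc'[OF one2_hom'[OF algebra_hom1(4)] counit_hom one2_hom'[OF algebraD(2)]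
          algebra_hom1(4) unit_a algebraD(2), symmetric])
  also have "\<dots> = one2 K (a \<odot> ?Ta)"
    by (simp add: structure_counit hcomp_one2[OF algebra_hom1(4) algebraD(2)] algebraD)
  finally have al: "one2 K a \<star> ?l = one2 K (a \<odot> ?Ta)" .
  have "one2 K a \<star> (?\<epsilon> \<star> one2 K ?Ta) = (one2 K a \<star> ?\<epsilon>) \<star> one2 K ?Ta"
    by (rule hcomp_assoc'[OF one2_hom'[OF algebra_hom1(1)] counit_hom one2_hom'[OF algebraD(2)]
          algebra_hom1(1) unit_a algebraD(2), symmetric])
  also have "\<dots> = one2 K (a \<odot> ?Ta)"
    by (simp add: structure_counit hcomp_one2[OF algebra_hom1(1) algebraD(2)])
  finally have ar1: "one2 K a \<star> (?\<epsilon> \<star> one2 K ?Ta) = one2 K (a \<odot> ?Ta)" .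
  have "one2 K a \<star> (one2 K ?\<mu> \<star> fun2 T ?\<epsilon>) = (one2 K a \<star> one2 K ?\<mu>) \<star> fun2 T ?\<epsilon>"
    by (rule hcomp_assoc'[OF T\<epsilon> one2_hom'[OF algebra_hom1(4)] one2_hom'[OF algebraD(2)]
          T\<eta>a algebra_hom1(4) algebraD(2), symmetric])
  also have "\<dots> = (one2 K a \<star> one2 K ?Ta) \<star> fun2 T ?\<epsilon>"
    by (simp add: hcomp_one2[OF algebra_hom1(1) algebraD(2)] hcomp_one2[OF algebra_hom1(4) algebraD(2)] algebraD)
  also have "\<dots> = one2 K a \<star> (one2 K ?Ta \<star> fun2 T ?\<epsilon>)"
    by (rule hcomp_assoc'[OF T\<epsilon> one2_hom'[OF algebra_hom1(1)] one2_hom'[OF algebraD(2)]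
          T\<eta>a algebra_hom1(1) algebraD(2)])
  also have "one2 K ?Ta \<star> fun2 T ?\<epsilon> = fun2 T (one2 K a \<star> ?\<epsilon>)"
    using fun2_hcomp[OF counit_hom one2_hom'[OF algebraD(2)]]
    by (simp add: in_hom1D[OF unit_a] in_hom1D[OF algebraD(2)] fun2_one)
  also have "\<dots> = one2 K ?Ta"
    by (simp add: structure_counit fun2_one in_hom1D[OF algebraD(2)])
  also have "one2 K a \<star> one2 K ?Ta = one2 K (a \<odot> ?Ta)"
    by (rule hcomp_one2[OF algebra_hom1(1) algebraD(2)])
  finally have ar2: "one2 K a \<star> (one2 K ?\<mu> \<star> fun2 T ?\<epsilon>) = one2 K (a \<odot> ?Ta)" .
  have "one2 K a \<star> ?r = one2 K (a \<odot> ?Ta) \<bullet> one2 K (a \<odot> ?Ta)"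
    using whisker_left_vcomp[OF r1 r2 comp1_hom[OF aTa algebra_hom1(2)] algebraD(2)] by (simp add: ar1 ar2)
  also have "\<dots> = one2 K (a \<odot> ?Ta)"
    by (rule vcomp_one_left[OF one2_hom'[OF aTa]])
  finally have "one2 K a \<star> ?r = one2 K a \<star> ?l" using al by simp
  then show ?thesis
    using cell_from_unit_determined[OF l aTa] cell_from_unit_determined[OF r aTa] by metis
qed

end

text \<open>Uniqueness: the composite \<open>s \<star> \<epsilon>\<close> of \<open>s\<close> with the counit \<open>\<epsilon>\<close> equals \<open>s\<close> when \<open>\<epsilon>\<close> is
  applied first, because \<open>a \<star> \<epsilon>\<close> is an identity, and equals the whiskered counit when \<open>s\<close> is applied
  first, because \<open>s \<star> \<eta>\<close> is an identity.\<close>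
lemma colax_cell_eq:
  assumes A: "algebra A a" and B: "algebra B b" and f: "in_hom1 K f A B"
    and s: "in_hom2 K s (f \<odot> a) (b \<odot> fun1 T f)" and s_unit: "s \<star> one2 K (unit T A) = one2 K f"
  shows "s = one2 K (b \<odot> fun1 T f) \<star> counit A a"
proof -
  note a = algebraD(2)[OF A] and b = algebraD(2)[OF B] and Tf = fun1_hom[OF f] and \<eta> = algebra_hom1(2)[OF A]
  note \<eta>a = unit_a[OF A] and \<epsilon> = counit_hom[OF A]
  have fa: "in_hom1 K (f \<odot> a) (fun0 T A) B" by (rule comp1_hom[OF a f])
  have bTf: "in_hom1 K (b \<odot> fun1 T f) (fun0 T A) B" by (rule comp1_hom[OF Tf b])
  have "s \<star> counit A a = (s \<star> one2 K (one1 K (fun0 T A))) \<bullet> (one2 K (f \<odot> a) \<star> counit A a)"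
    by (rule hcomp_inner_first[OF \<epsilon> s \<eta>a fa])
  also have "s \<star> one2 K (one1 K (fun0 T A)) = s"
    using hcomp_one_right[OF s] by (simp add: in_hom1D[OF fa])
  also have "one2 K (f \<odot> a) \<star> counit A a = one2 K f \<star> (one2 K a \<star> counit A a)"
    using hcomp_assoc'[OF \<epsilon> one2_hom'[OF a] one2_hom'[OF f] \<eta>a a f]
    by (simp add: hcomp_one2[OF a f])
  also have "\<dots> = one2 K (f \<odot> a)"
    by (simp add: structure_counit[OF A] hcomp_one2[OF a f])
  also have "s \<bullet> one2 K (f \<odot> a) = s" by (rule vcomp_one_right[OF s])
  finally have 1: "s \<star> counit A a = s" .
  have "s \<star> counit A a
      = (one2 K (b \<odot> fun1 T f) \<star> counit A a) \<bullet> (s \<star> one2 K (unit T A \<odot> a))"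
    by (rule hcomp_outer_first[OF \<epsilon> s \<eta>a fa])
  also have "s \<star> one2 K (unit T A \<odot> a) = (s \<star> one2 K (unit T A)) \<star> one2 K a"
    using hcomp_assoc'[OF one2_hom'[OF a] one2_hom'[OF \<eta>] s a \<eta> fa]
    by (simp add: hcomp_one2[OF a \<eta>])
  also have "\<dots> = one2 K (f \<odot> a)" by (simp add: s_unit hcomp_one2[OF a f])
  also have "f \<odot> a = (b \<odot> fun1 T f) \<odot> (unit T A \<odot> a)"
  proof -
    have "(b \<odot> fun1 T f) \<odot> (unit T A \<odot> a) = ((b \<odot> fun1 T f) \<odot> unit T A) \<odot> a"
      by (rule comp1_assoc[OF a \<eta> bTf, symmetric])
    also have "(b \<odot> fun1 T f) \<odot> unit T A = b \<odot> (unit T B \<odot> f)"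
      by (simp add: comp1_assoc[OF \<eta> Tf b] unit_nat1[OF f])
    also have "\<dots> = f"
      using comp1_assoc[OF f algebra_hom1(2)[OF B] b]
      by (simp add: algebraD(4)[OF B] comp1_one_left[OF f])
    finally show ?thesis by simp
  qed
  also have "(one2 K (b \<odot> fun1 T f) \<star> counit A a) \<bullet> one2 K ((b \<odot> fun1 T f) \<odot> (unit T A \<odot> a))
      = one2 K (b \<odot> fun1 T f) \<star> counit A a"
    by (rule vcomp_one_right[OF hcomp_hom'[OF \<epsilon> one2_hom'[OF bTf] \<eta>a bTf]])
  finally show ?thesis using 1 by simp
qed

text \<open>Existence: with \<open>g = b \<odot> T f\<close> the axioms for \<open>g \<star> \<epsilon>\<close> follow from the corresponding
  properties of \<open>\<epsilon>\<close> by whiskering with \<open>g\<close>, since \<open>g \<odot> \<eta> = f\<close> and \<open>b \<odot> T g = g \<odot> \<mu>\<close>.\<close>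
lemma colax_morphism_counit:
  assumes A: "algebra A a" and B: "algebra B b" and f: "in_hom1 K f A B"
  shows "colax_morphism A a B b f (one2 K (b \<odot> fun1 T f) \<star> counit A a)"
proof -
  let ?\<epsilon> = "counit A a" and ?g = "b \<odot> fun1 T f"
  let ?s = "one2 K ?g \<star> ?\<epsilon>"
  note a = algebraD(2)[OF A] and b = algebraD(2)[OF B] and Tf = fun1_hom[OF f] and \<eta> = algebra_hom1(2)[OF A]
  note \<mu> = algebra_hom1(4)[OF A] and Ta = algebra_hom1(1)[OF A] and Tb = algebra_hom1(1)[OF B]
  note TTf = fun1_hom[OF Tf] and \<mu>B = algebra_hom1(4)[OF B]
  note \<eta>a = unit_a[OF A] and \<epsilon> = counit_hom[OF A]
  have g: "in_hom1 K ?g (fun0 T A) B" by (rule comp1_hom[OF Tf b])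
  have Tg: "in_hom1 K (fun1 T ?g) (fun0 T (fun0 T A)) (fun0 T B)" by (rule fun1_hom[OF g])
  have g\<eta>: "?g \<odot> unit T A = f"
    using comp1_assoc[OF f algebra_hom1(2)[OF B] b]
    by (simp add: comp1_assoc[OF \<eta> Tf b] unit_nat1[OF f] algebraD(4)[OF B] comp1_one_left[OF f])
  have g\<eta>a: "?g \<odot> (unit T A \<odot> a) = f \<odot> a"
    by (simp add: comp1_assoc[OF a \<eta> g, symmetric] g\<eta>)
  have s: "in_hom2 K ?s (f \<odot> a) ?g"
    using hcomp_hom'[OF \<epsilon> one2_hom'[OF g] \<eta>a g] by (simp add: g\<eta>a comp1_one_right[OF g])
  have "?s \<star> one2 K (unit T A) = one2 K ?g \<star> (?\<epsilon> \<star> one2 K (unit T A))"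
    by (rule hcomp_assoc'[OF one2_hom'[OF \<eta>] \<epsilon> one2_hom'[OF g] \<eta> \<eta>a g])
  also have "\<dots> = one2 K f"
    by (simp add: counit_unit[OF A] hcomp_one2[OF \<eta> g] g\<eta>)
  finally have s\<eta>: "?s \<star> one2 K (unit T A) = one2 K f" .
  have T\<epsilon>: "in_hom2 K (fun2 T ?\<epsilon>) (fun1 T (unit T A \<odot> a)) (one1 K (fun0 T (fun0 T A)))"
    using fun2_hom[OF \<epsilon>] by (simp add: fun1_one[OF free_cell0(1)[OF A]])
  have T\<eta>a: "in_hom1 K (fun1 T (unit T A \<odot> a)) (fun0 T (fun0 T A)) (fun0 T (fun0 T A))"
    by (rule fun1_hom[OF \<eta>a])
  have bTg: "b \<odot> fun1 T ?g = ?g \<odot> mult T A"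
  proof -
    have "b \<odot> fun1 T ?g = (b \<odot> fun1 T b) \<odot> fun1 T (fun1 T f)"
      by (simp add: fun1_comp[OF Tf b] comp1_assoc[OF TTf Tb b])
    also have "\<dots> = b \<odot> (mult T B \<odot> fun1 T (fun1 T f))"
      by (simp add: algebraD(3)[OF B] comp1_assoc[OF TTf \<mu>B b])
    also have "\<dots> = ?g \<odot> mult T A"
      by (simp add: mult_nat1[OF f, symmetric] comp1_assoc[OF \<mu> Tf b])
    finally show ?thesis .
  qed
  have "one2 K b \<star> fun2 T ?s = one2 K b \<star> (one2 K (fun1 T ?g) \<star> fun2 T ?\<epsilon>)"
    using fun2_hcomp[OF \<epsilon> one2_hom'[OF g]] by (simp add: in_hom1D[OF \<eta>a] in_hom1D[OF g] fun2_one)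
  also have "\<dots> = one2 K (?g \<odot> mult T A) \<star> fun2 T ?\<epsilon>"
    using hcomp_assoc'[OF T\<epsilon> one2_hom'[OF Tg] one2_hom'[OF b] T\<eta>a Tg b]
    by (simp add: hcomp_one2[OF Tg b] bTg)
  also have "\<dots> = one2 K ?g \<star> (one2 K (mult T A) \<star> fun2 T ?\<epsilon>)"
    using hcomp_assoc'[OF T\<epsilon> one2_hom'[OF \<mu>] one2_hom'[OF g] T\<eta>a \<mu> g]
    by (simp add: hcomp_one2[OF \<mu> g])
  finally have bTs: "one2 K b \<star> fun2 T ?s = one2 K ?g \<star> (one2 K (mult T A) \<star> fun2 T ?\<epsilon>)" .
  have sTa: "?s \<star> one2 K (fun1 T a) = one2 K ?g \<star> (?\<epsilon> \<star> one2 K (fun1 T a))"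
    by (rule hcomp_assoc'[OF one2_hom'[OF Ta] \<epsilon> one2_hom'[OF g] Ta \<eta>a g])
  have e1: "in_hom2 K (?\<epsilon> \<star> one2 K (fun1 T a)) ((unit T A \<odot> a) \<odot> fun1 T a) (fun1 T a)"
    using hcomp_hom'[OF one2_hom'[OF Ta] \<epsilon> Ta \<eta>a] by (simp add: comp1_one_left[OF Ta])
  have "mult T A \<odot> fun1 T (unit T A \<odot> a) = fun1 T a"
    using comp1_assoc[OF Ta fun1_hom[OF \<eta>] \<mu>]
    by (simp add: fun1_comp[OF a \<eta>] mult_fun_unit[OF algebraD(1)[OF A]] comp1_one_left[OF Ta])
  then have e2: "in_hom2 K (one2 K (mult T A) \<star> fun2 T ?\<epsilon>) (fun1 T a) (mult T A)"
    using hcomp_hom'[OF T\<epsilon> one2_hom'[OF \<mu>] T\<eta>a \<mu>] by (simp add: comp1_one_right[OF \<mu>])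
  have "?s \<star> one2 K (mult T A) = one2 K ?g \<star> (?\<epsilon> \<star> one2 K (mult T A))"
    by (rule hcomp_assoc'[OF one2_hom'[OF \<mu>] \<epsilon> one2_hom'[OF g] \<mu> \<eta>a g])
  also have "\<dots> = (one2 K b \<star> fun2 T ?s) \<bullet> (?s \<star> one2 K (fun1 T a))"
    using whisker_left_vcomp[OF e1 e2 comp1_hom[OF Ta \<eta>a] g]
    by (simp add: counit_mult[OF A] bTs sTa)
  finally show ?thesis
    using A B f s s\<eta> by (simp add: colax_morphism_def)
qed

theorem colax_idempotent: "colax_idempotent_two_monad K T"
proof unfold_locales
  fix A a B b f
  assume *: "algebra A a" "algebra B b" "in_hom1 K f A B"
  show "\<exists>!s. colax_morphism A a B b f s"
  proof (rule ex1I)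
    show "colax_morphism A a B b f (one2 K (b \<odot> fun1 T f) \<star> counit A a)"
      by (rule colax_morphism_counit[OF *])
    show "s = one2 K (b \<odot> fun1 T f) \<star> counit A a" if "colax_morphism A a B b f s" for s
      using that colax_cell_eq[OF *] by (auto simp: colax_morphism_def)
  qed
qed

end

section \<open>Meets, products and equality predicates in a doctrine\<close>

context infsl
begin

lemma meet_assoc:
  "\<lbrakk>x \<in> carrier L; y \<in> carrier L; z \<in> carrier L\<rbrakk> \<Longrightarrow> (x \<sqinter> y) \<sqinter> z = x \<sqinter> (y \<sqinter> z)"
  using weak_meet_assoc by (simp add: eq_is_equal)

lemma meet_lcomm:
  "\<lbrakk>x \<in> carrier L; y \<in> carrier L; z \<in> carrier L\<rbrakk> \<Longrightarrow> x \<sqinter> (y \<sqinter> z) = y \<sqinter> (x \<sqinter> z)"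
  using meet_assoc[of x y z] meet_assoc[of y x z] by (simp add: meet_comm[of L x y])

lemma le_meet_iff:
  assumes "x \<in> carrier L" "y \<in> carrier L" "z \<in> carrier L"
  shows "z \<sqsubseteq> x \<sqinter> y \<longleftrightarrow> z \<sqsubseteq> x \<and> z \<sqsubseteq> y"
  using assms meet_left[of x y] meet_right[of x y] meet_le[of z x y]
    le_trans[of z "x \<sqinter> y" x] le_trans[of z "x \<sqinter> y" y] by auto

lemma le_iff_meet:
  assumes "x \<in> carrier L" "y \<in> carrier L"
  shows "x \<sqsubseteq> y \<longleftrightarrow> x \<sqinter> y = x"
proof
  assume "x \<sqsubseteq> y"
  then show "x \<sqinter> y = x"
    using assms by (intro le_antisym) (simp_all add: meet_left le_meet_iff)
next
  assume "x \<sqinter> y = x"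
  then show "x \<sqsubseteq> y"
    using meet_right[OF assms] by simp
qed

lemma meet_idem: "x \<in> carrier L \<Longrightarrow> x \<sqinter> x = x"
  by (simp add: le_iff_meet[symmetric])

lemma meet_left_idem: "\<lbrakk>x \<in> carrier L; y \<in> carrier L\<rbrakk> \<Longrightarrow> x \<sqinter> (x \<sqinter> y) = x \<sqinter> y"
  by (simp add: meet_assoc[symmetric] meet_idem)

lemma meet_le_meet:
  assumes "x \<sqsubseteq> x'" "y \<sqsubseteq> y'"
    and "x \<in> carrier L" "x' \<in> carrier L" "y \<in> carrier L" "y' \<in> carrier L"
  shows "x \<sqinter> y \<sqsubseteq> x' \<sqinter> y'"
  using assms le_trans[of "x \<sqinter> y" x x'] le_trans[of "x \<sqinter> y" y y']
  by (simp add: le_meet_iff meet_left meet_right)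

lemma meet_unique:
  assumes "x \<in> carrier L" "y \<in> carrier L" "z \<in> carrier L" "z \<sqsubseteq> x" "z \<sqsubseteq> y"
    and "\<And>w. \<lbrakk>w \<in> carrier L; w \<sqsubseteq> x; w \<sqsubseteq> y\<rbrakk> \<Longrightarrow> w \<sqsubseteq> z"
  shows "x \<sqinter> y = z"
  using assms by (intro le_antisym) (simp_all add: le_meet_iff meet_left meet_right)

lemma top_unique:
  assumes "t \<in> carrier L" "\<And>x. x \<in> carrier L \<Longrightarrow> x \<sqsubseteq> t"
  shows "\<top> = t"
  using assms by (intro le_antisym) (simp_all add: top_higher)

lemma meet_top: "x \<in> carrier L \<Longrightarrow> x \<sqinter> \<top> = x"
  using le_iff_meet[of x "\<top>"] by (simp add: top_higher)

end

lemma infslI: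
  fixes L :: "('e, 'm) gorder_scheme" (structure)
  assumes "partial_order L"
    and "\<And>x y. \<lbrakk>x \<in> carrier L; y \<in> carrier L\<rbrakk> \<Longrightarrow>
      m x y \<in> carrier L \<and> m x y \<sqsubseteq> x \<and> m x y \<sqsubseteq> y"
    and "\<And>x y z. \<lbrakk>x \<in> carrier L; y \<in> carrier L; z \<in> carrier L; z \<sqsubseteq> x; z \<sqsubseteq> y\<rbrakk> \<Longrightarrow> z \<sqsubseteq> m x y"
    and "t \<in> carrier L" "\<And>x. x \<in> carrier L \<Longrightarrow> x \<sqsubseteq> t"
  shows "infsl L"
proof -
  interpret partial_order L by fact
  show ?thesis
  proof unfold_locales
    fix x y assume xy: "x \<in> carrier L" "y \<in> carrier L"
    show "\<exists>s. greatest L s (Lower L {x, y})"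
      by (rule exI[of _ "m x y"]) (use xy assms(2,3) in \<open>auto simp: greatest_def Lower_def\<close>)
  next
    show "\<exists>t. greatest L t (carrier L)"
      using assms(4,5) by (auto simp: greatest_def)
  qed
qed

lemma infsl_homD:
  assumes "infsl_hom L M h"
  shows "x \<in> carrier L \<Longrightarrow> h x \<in> carrier M"
    and "h \<top>\<^bsub>L\<^esub> = \<top>\<^bsub>M\<^esub>"
    and "\<lbrakk>x \<in> carrier L; y \<in> carrier L\<rbrakk> \<Longrightarrow> h (x \<sqinter>\<^bsub>L\<^esub> y) = h x \<sqinter>\<^bsub>M\<^esub> h y"
  using assms by (auto simp: infsl_hom_def)

lemma infsl_hom_mono:
  assumes "infsl L" "infsl M" "infsl_hom L M h" "x \<sqsubseteq>\<^bsub>L\<^esub> y" "x \<in> carrier L" "y \<in> carrier L"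
  shows "h x \<sqsubseteq>\<^bsub>M\<^esub> h y"
  using assms(4-6) infsl_homD(3)[OF assms(3,5,6)] infsl_homD(1)[OF assms(3)]
  by (simp add: infsl.le_iff_meet[OF assms(1)] infsl.le_iff_meet[OF assms(2)])

lemma galois_connection_iff:
  assumes "partial_order X" "partial_order Y"
    and "\<And>x. x \<in> carrier X \<Longrightarrow> l x \<in> carrier Y" "\<And>y. y \<in> carrier Y \<Longrightarrow> u y \<in> carrier X"
  shows "galois_connection \<lparr>orderA = X, orderB = Y, lower = l, upper = u\<rparr> \<longleftrightarrow>
    (\<forall>x\<in>carrier X. \<forall>y\<in>carrier Y. l x \<sqsubseteq>\<^bsub>Y\<^esub> y \<longleftrightarrow> x \<sqsubseteq>\<^bsub>X\<^esub> u y)"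
  using assms by (simp add: galois_connection_def connection_def galois_connection_axioms_def Ball_def)

context product_category
begin

lemma Hom_ObjD: "f \<in> Hom C A B \<Longrightarrow> A \<in> Obj C" "f \<in> Hom C A B \<Longrightarrow> B \<in> Obj C"
  using Hom_Obj by auto

lemma Prd_Obj: "\<lbrakk>A \<in> Obj C; B \<in> Obj C\<rbrakk> \<Longrightarrow> Prd C A B \<in> Obj C"
  and Pr1_Hom: "\<lbrakk>A \<in> Obj C; B \<in> Obj C\<rbrakk> \<Longrightarrow> Pr1 C A B \<in> Hom C (Prd C A B) A"
  and Pr2_Hom: "\<lbrakk>A \<in> Obj C; B \<in> Obj C\<rbrakk> \<Longrightarrow> Pr2 C A B \<in> Hom C (Prd C A B) B"
  using Prd_product by (auto simp: is_product_def)

lemma Pair_arr_ex1: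
  assumes "f \<in> Hom C X A" "g \<in> Hom C X B"
  shows "\<exists>!h. h \<in> Hom C X (Prd C A B) \<and> Cmp C X (Prd C A B) A (Pr1 C A B) h = f \<and>
    Cmp C X (Prd C A B) B (Pr2 C A B) h = g"
  using Prd_product[of A B] assms Hom_ObjD[OF assms(1)] Hom_ObjD[OF assms(2)]
  by (auto simp: is_product_def)

lemma Pair_arr_Hom: "\<lbrakk>f \<in> Hom C X A; g \<in> Hom C X B\<rbrakk> \<Longrightarrow> Pair_arr C X A B f g \<in> Hom C X (Prd C A B)"
  and Pr1_Pair_arr: "\<lbrakk>f \<in> Hom C X A; g \<in> Hom C X B\<rbrakk> \<Longrightarrow>
      Cmp C X (Prd C A B) A (Pr1 C A B) (Pair_arr C X A B f g) = f"
  and Pr2_Pair_arr: "\<lbrakk>f \<in> Hom C X A; g \<in> Hom C X B\<rbrakk> \<Longrightarrow>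
      Cmp C X (Prd C A B) B (Pr2 C A B) (Pair_arr C X A B f g) = g"
  using theI'[OF Pair_arr_ex1[of f X A g B]] unfolding Pair_arr_def by auto

lemma Pair_arr_unique:
  assumes "h \<in> Hom C X (Prd C A B)" "A \<in> Obj C" "B \<in> Obj C"
    and "Cmp C X (Prd C A B) A (Pr1 C A B) h = f" "Cmp C X (Prd C A B) B (Pr2 C A B) h = g"
  shows "Pair_arr C X A B f g = h"
proof -
  have "f \<in> Hom C X A" "g \<in> Hom C X B"
    using assms Cmp_Hom[OF assms(1) Pr1_Hom] Cmp_Hom[OF assms(1) Pr2_Hom] by auto
  then show ?thesis
    unfolding Pair_arr_def by (intro the1_equality[OF Pair_arr_ex1]) (use assms in auto)
qed

lemma Pair_arr_proj: "\<lbrakk>A \<in> Obj C; B \<in> Obj C\<rbrakk> \<Longrightarrow>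
    Pair_arr C (Prd C A B) A B (Pr1 C A B) (Pr2 C A B) = Idt C (Prd C A B)"
  by (rule Pair_arr_unique) (simp_all add: Idt_Hom Prd_Obj Cmp_Idt_right[OF Pr1_Hom] Cmp_Idt_right[OF Pr2_Hom])

lemma Cmp_Pair_arr:
  assumes "h \<in> Hom C Y X" "f \<in> Hom C X A" "g \<in> Hom C X B"
  shows "Cmp C Y X (Prd C A B) (Pair_arr C X A B f g) h
    = Pair_arr C Y A B (Cmp C Y X A f h) (Cmp C Y X B g h)"
proof -
  have AB: "A \<in> Obj C" "B \<in> Obj C" using assms Hom_Obj by auto
  note p = Pair_arr_Hom[OF assms(2,3)]
  show ?thesis
    by (rule Pair_arr_unique[symmetric])
      (simp_all add: AB Cmp_Hom[OF assms(1) p] Cmp_assoc[OF assms(1) p Pr1_Hom, symmetric]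
        Cmp_assoc[OF assms(1) p Pr2_Hom, symmetric] Pr1_Pair_arr Pr2_Pair_arr assms)
qed

lemma is_product_unique:
  assumes "is_product C A B W p q" "h \<in> Hom C X W" "k \<in> Hom C X W"
    and "Cmp C X W A p h = Cmp C X W A p k" "Cmp C X W B q h = Cmp C X W B q k"
  shows "h = k"
proof -
  have X: "X \<in> Obj C" using assms Hom_Obj by auto
  have "p \<in> Hom C W A" "q \<in> Hom C W B" using assms(1) by (auto simp: is_product_def)
  then have "Cmp C X W A p k \<in> Hom C X A" "Cmp C X W B q k \<in> Hom C X B"
    using assms(3) Cmp_Hom by auto
  then have "\<exists>!m. m \<in> Hom C X W \<and> Cmp C X W A p m = Cmp C X W A p k \<and> Cmp C X W B q m = Cmp C X W B q k"
    using assms(1) X by (auto simp: is_product_def)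
  then show ?thesis
    using assms(2-5) by blast
qed

end

context doctrine
begin

lemma fib_locales:
  assumes "A \<in> Obj P"
  shows "partial_order (fib P A)" "weak_partial_order (fib P A)"
    "weak_partial_order_top (fib P A)" "weak_lower_semilattice (fib P A)"
proof -
  interpret infsl "fib P A" by (rule fib_infsl[OF assms])
  show "partial_order (fib P A)" "weak_partial_order (fib P A)"
    "weak_partial_order_top (fib P A)" "weak_lower_semilattice (fib P A)"
    by unfold_locales
qed

lemmas fib_po = fib_locales(1)
  and fib_le_refl = weak_partial_order.le_refl[OF fib_locales(2)]
  and fib_le_trans = weak_partial_order.le_trans[OF fib_locales(2)]
  and fib_le_antisym = partial_order.le_antisym[OF fib_locales(1)]
  and fib_top = weak_partial_order_top.top_closed[OF fib_locales(3)]
  and fib_le_top = weak_partial_order_top.top_higher[OF fib_locales(3)]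
  and fib_meet = weak_lower_semilattice.meet_closed[OF fib_locales(4)]
  and fib_meet_left = weak_lower_semilattice.meet_left[OF fib_locales(4)]
  and fib_meet_right = weak_lower_semilattice.meet_right[OF fib_locales(4)]

lemma fib_top_le:
  assumes "A \<in> Obj P" "x \<in> carrier (fib P A)"
  shows "\<top>\<^bsub>fib P A\<^esub> \<sqsubseteq>\<^bsub>fib P A\<^esub> x \<longleftrightarrow> x = \<top>\<^bsub>fib P A\<^esub>"
  using fib_le_antisym[OF assms(1) fib_le_top[OF assms] _ assms(2) fib_top[OF assms(1)]]
    fib_le_refl[OF assms] by auto

lemmas fib_meet_assoc = infsl.meet_assoc[OF fib_infsl]
  and fib_meet_lcomm = infsl.meet_lcomm[OF fib_infsl]
  and fib_meet_idem = infsl.meet_idem[OF fib_infsl]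
  and fib_meet_left_idem = infsl.meet_left_idem[OF fib_infsl]
  and fib_le_iff_meet = infsl.le_iff_meet[OF fib_infsl]
  and fib_le_meet_iff = infsl.le_meet_iff[OF fib_infsl]
  and fib_meet_mono = infsl.meet_le_meet[OF fib_infsl]
  and fib_meet_top = infsl.meet_top[OF fib_infsl]

lemmas fib_meet_ac = fib_meet_assoc fib_meet_lcomm meet_comm fib_meet_idem fib_meet_left_idem

lemmas sub_closed = infsl_homD(1)[OF sub_hom]
  and sub_top = infsl_homD(2)[OF sub_hom]
  and sub_meet = infsl_homD(3)[OF sub_hom]

lemma sub_mono:
  assumes "f \<in> Hom P A B" "x \<sqsubseteq>\<^bsub>fib P B\<^esub> y" "x \<in> carrier (fib P B)" "y \<in> carrier (fib P B)"
  shows "sub P A B f x \<sqsubseteq>\<^bsub>fib P A\<^esub> sub P A B f y"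
  using infsl_hom_mono[OF fib_infsl fib_infsl sub_hom] assms Hom_ObjD[OF assms(1)] by simp

abbreviation diag :: "'o \<Rightarrow> 'a" where
  "diag A \<equiv> Pair_arr P A A A (Idt P A) (Idt P A)"

lemma diag_Hom: "A \<in> Obj P \<Longrightarrow> diag A \<in> Hom P A (Prd P A A)"
  by (simp add: Pair_arr_Hom Idt_Hom)

lemma is_delta1_iff:
  assumes A: "A \<in> Obj P" and d: "d \<in> carrier (fib P (Prd P A A))"
  shows "is_delta1 P A d \<longleftrightarrow>
    (\<forall>x\<in>carrier (fib P A). \<forall>y\<in>carrier (fib P (Prd P A A)).
      sub P (Prd P A A) A (Pr1 P A A) x \<sqinter>\<^bsub>fib P (Prd P A A)\<^esub> d \<sqsubseteq>\<^bsub>fib P (Prd P A A)\<^esub> y \<longleftrightarrow>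
      x \<sqsubseteq>\<^bsub>fib P A\<^esub> sub P A (Prd P A A) (diag A) y)"
  unfolding is_delta1_def Let_def using A d
  by (intro galois_connection_iff)
    (simp_all add: fib_po Prd_Obj fib_meet sub_closed[OF Pr1_Hom] sub_closed[OF diag_Hom])

text \<open>By adjointness, an equality predicate is the value of the left adjoint at the top element.
  This determines it, and it is the least predicate that is true on the diagonal.\<close>
lemma delta_least:
  assumes A: "A \<in> Obj P" and d: "is_delta P A d" and y: "y \<in> carrier (fib P (Prd P A A))"
  shows "d \<sqsubseteq>\<^bsub>fib P (Prd P A A)\<^esub> y \<longleftrightarrow> sub P A (Prd P A A) (diag A) y = \<top>\<^bsub>fib P A\<^esub>"
proof -
  have dc: "d \<in> carrier (fib P (Prd P A A))" and d1: "is_delta1 P A d"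
    using d by (auto simp: is_delta_def)
  have "sub P (Prd P A A) A (Pr1 P A A) \<top>\<^bsub>fib P A\<^esub> \<sqinter>\<^bsub>fib P (Prd P A A)\<^esub> d = d"
    unfolding sub_top[OF Pr1_Hom[OF A A]]
    by (rule trans[OF meet_comm fib_meet_top[OF Prd_Obj[OF A A] dc]])
  then have "d \<sqsubseteq>\<^bsub>fib P (Prd P A A)\<^esub> y \<longleftrightarrow> \<top>\<^bsub>fib P A\<^esub> \<sqsubseteq>\<^bsub>fib P A\<^esub> sub P A (Prd P A A) (diag A) y"
    using d1[unfolded is_delta1_iff[OF A dc], rule_format, OF fib_top[OF A] y] by simp
  then show ?thesis
    by (simp add: fib_top_le[OF A sub_closed[OF diag_Hom[OF A] y]])
qed

lemma sub_diag_delta: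
  assumes A: "A \<in> Obj P" and d: "is_delta P A d"
  shows "sub P A (Prd P A A) (diag A) d = \<top>\<^bsub>fib P A\<^esub>"
proof -
  have dc: "d \<in> carrier (fib P (Prd P A A))" using d by (simp add: is_delta_def)
  show ?thesis
    using delta_least[OF A d dc] fib_le_refl[OF Prd_Obj[OF A A] dc] by blast
qed

lemma delta_unique:
  assumes A: "A \<in> Obj P" and d: "is_delta P A d" and e: "is_delta P A e"
  shows "d = e"
proof -
  have dc: "d \<in> carrier (fib P (Prd P A A))" and ec: "e \<in> carrier (fib P (Prd P A A))"
    using d e by (simp_all add: is_delta_def)
  have "d \<sqsubseteq>\<^bsub>fib P (Prd P A A)\<^esub> e" "e \<sqsubseteq>\<^bsub>fib P (Prd P A A)\<^esub> d"
    using delta_least[OF A d ec] delta_least[OF A e dc] sub_diag_delta[OF A d] sub_diag_delta[OF A e]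
    by blast+
  then show ?thesis
    using dc ec by (rule fib_le_antisym[OF Prd_Obj[OF A A]])
qed

lemma delta_eq:
  assumes "A \<in> Obj P" "is_delta P A d"
  shows "delta P A = d"
  unfolding delta_def by (rule the_equality, rule assms(2), rule delta_unique[OF assms(1) _ assms(2)])

text \<open>The condition on \<open>X \<times> A \<times> A\<close> simplifies because the triple product is \<open>(X \<times> A) \<times> A\<close>:
  the arrow \<open>\<langle>pr1, pr2\<rangle>\<close> is its first projection and \<open>\<langle>pr1, pr2, pr2\<rangle>\<close> is \<open>\<langle>id, pr2\<rangle>\<close>.
  The two arrows that remain are \<open>\<langle>pr2, pr3\<rangle>\<close> and the parametrised diagonal
  \<open>param_diag\<close>.\<close>
abbreviation triple_proj :: "'o \<Rightarrow> 'o \<Rightarrow> 'a" where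
  "triple_proj X A \<equiv> Pair_arr P (Prd P (Prd P X A) A) A A
     (Cmp P (Prd P (Prd P X A) A) (Prd P X A) A (Pr2 P X A) (Pr1 P (Prd P X A) A)) (Pr2 P (Prd P X A) A)"

abbreviation param_diag :: "'o \<Rightarrow> 'o \<Rightarrow> 'a" where
  "param_diag X A \<equiv> Pair_arr P (Prd P X A) (Prd P X A) A (Idt P (Prd P X A)) (Pr2 P X A)"

lemma triple_proj_Hom: "\<lbrakk>X \<in> Obj P; A \<in> Obj P\<rbrakk> \<Longrightarrow>
    triple_proj X A \<in> Hom P (Prd P (Prd P X A) A) (Prd P A A)"
  by (intro Pair_arr_Hom Cmp_Hom[OF Pr1_Hom Pr2_Hom] Pr2_Hom Prd_Obj)

lemma param_diag_Hom: "\<lbrakk>X \<in> Obj P; A \<in> Obj P\<rbrakk> \<Longrightarrow>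
    param_diag X A \<in> Hom P (Prd P X A) (Prd P (Prd P X A) A)"
  by (intro Pair_arr_Hom Idt_Hom Pr2_Hom Prd_Obj)

lemma is_delta2_iff:
  assumes A: "A \<in> Obj P" and d: "d \<in> carrier (fib P (Prd P A A))" and X: "X \<in> Obj P"
  defines "XA \<equiv> Prd P X A"
  defines "XAA \<equiv> Prd P XA A"
  shows "is_delta2 P A d X \<longleftrightarrow>
    (\<forall>x\<in>carrier (fib P XA). \<forall>y\<in>carrier (fib P XAA).
      sub P XAA XA (Pr1 P XA A) x \<sqinter>\<^bsub>fib P XAA\<^esub> sub P XAA (Prd P A A) (triple_proj X A) d
        \<sqsubseteq>\<^bsub>fib P XAA\<^esub> y \<longleftrightarrow>
      x \<sqsubseteq>\<^bsub>fib P XA\<^esub> sub P XA XAA (param_diag X A) y)"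
proof -
  have XA: "XA \<in> Obj P" and XAA: "XAA \<in> Obj P" using A X Prd_Obj by (auto simp: XA_def XAA_def)
  have p: "Pair_arr P XAA X A (Cmp P XAA XA X (Pr1 P X A) (Pr1 P XA A))
      (Cmp P XAA XA A (Pr2 P X A) (Pr1 P XA A)) = Pr1 P XA A"
    unfolding XA_def XAA_def
    by (rule Pair_arr_unique) (use A X in \<open>auto intro: Pr1_Hom Prd_Obj\<close>)
  show ?thesis
    unfolding is_delta2_def Let_def XA_def[symmetric] XAA_def[symmetric] p Pair_arr_proj[OF X A, folded XA_def]
    by (intro galois_connection_iff fib_po XA XAA fib_meet sub_closed[OF Pr1_Hom[OF XA A, folded XAA_def]]
        sub_closed[OF triple_proj_Hom[OF X A, folded XA_def, folded XAA_def] d] sub_closed[OF param_diag_Hom[OF X A, folded XA_def, folded XAA_def]])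
qed

end

context elementary_doctrine
begin

lemma delta_is_delta: "A \<in> Obj P \<Longrightarrow> is_delta P A (delta P A)"
  using delta_exists delta_eq[of A] by auto

lemma delta_closed: "A \<in> Obj P \<Longrightarrow> delta P A \<in> carrier (fib P (Prd P A A))"
  using delta_is_delta by (auto simp: is_delta_def)

end

section \<open>The 2-category of elementary doctrines\<close>

lemma in_hom1_ED:
  "in_hom1 ED F P R \<longleftrightarrow>
    elementary_doctrine P \<and> elementary_doctrine R \<and> ed_morphism F \<and> dsrc F = P \<and> dtrg F = R"
  by (simp add: in_hom1_def ED_def)

lemma in_hom2_ED:
  "in_hom2 ED \<theta> F G \<longleftrightarrow> ed_cell \<theta> \<and> ed_morphism F \<and> ed_morphism G \<and> ddom \<theta> = F \<and> dcod \<theta> = G"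
  by (simp add: in_hom2_def ED_def)

lemma elementary_doctrine_locales:
  assumes "elementary_doctrine P"
  shows "doctrine P" "product_category P"
  using assms by (simp_all add: elementary_doctrine_def doctrine_def)

text \<open>The 1-cells constructed below are all restrictions, to the relevant carriers, of functions
  given by a formula. In that form extensionality is automatic and the conditions on 1-cells can be
  stated for the formula.\<close>
lemma ED_hom1I:
  assumes F_def: "F = \<lparr> dsrc = P, dtrg = R, ob = (\<lambda>A\<in>Obj P. h A),
      ar = (\<lambda>A B. \<lambda>f\<in>Hom P A B. a A B f), el = (\<lambda>A\<in>Obj P. \<lambda>x\<in>carrier (fib P A). e A x) \<rparr>"
    and P: "elementary_doctrine P" and R: "elementary_doctrine R"
    and ob: "\<And>A. A \<in> Obj P \<Longrightarrow> h A \<in> Obj R"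
    and ar: "\<And>A B f. f \<in> Hom P A B \<Longrightarrow> a A B f \<in> Hom R (h A) (h B)"
    and ar_Idt: "\<And>A. A \<in> Obj P \<Longrightarrow> a A A (Idt P A) = Idt R (h A)"
    and ar_Cmp: "\<And>X Y Z f g. \<lbrakk>f \<in> Hom P X Y; g \<in> Hom P Y Z\<rbrakk> \<Longrightarrow>
      a X Z (Cmp P X Y Z g f) = Cmp R (h X) (h Y) (h Z) (a Y Z g) (a X Y f)"
    and ar_product: "\<And>A B W p q. is_product P A B W p q \<Longrightarrow>
      is_product R (h A) (h B) (h W) (a W A p) (a W B q)"
    and el: "\<And>A x. \<lbrakk>A \<in> Obj P; x \<in> carrier (fib P A)\<rbrakk> \<Longrightarrow> e A x \<in> carrier (fib R (h A))"
    and el_top: "\<And>A. A \<in> Obj P \<Longrightarrow> e A \<top>\<^bsub>fib P A\<^esub> = \<top>\<^bsub>fib R (h A)\<^esub>"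
    and el_meet: "\<And>A x y. \<lbrakk>A \<in> Obj P; x \<in> carrier (fib P A); y \<in> carrier (fib P A)\<rbrakk> \<Longrightarrow>
      e A (x \<sqinter>\<^bsub>fib P A\<^esub> y) = e A x \<sqinter>\<^bsub>fib R (h A)\<^esub> e A y"
    and el_sub: "\<And>A B f x. \<lbrakk>f \<in> Hom P A B; x \<in> carrier (fib P B)\<rbrakk> \<Longrightarrow>
      e A (sub P A B f x) = sub R (h A) (h B) (a A B f) (e B x)"
    and el_delta: "\<And>A. A \<in> Obj P \<Longrightarrow> e (Prd P A A) (delta P A) =
      sub R (h (Prd P A A)) (Prd R (h A) (h A))
        (Pair_arr R (h (Prd P A A)) (h A) (h A) (a (Prd P A A) A (Pr1 P A A)) (a (Prd P A A) A (Pr2 P A A)))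
        (delta R (h A))"
  shows "in_hom1 ED F P R"
proof -
  interpret P: elementary_doctrine P by fact
  have sel: "dsrc F = P" "dtrg F = R" "ob F = (\<lambda>A\<in>Obj P. h A)"
    "ar F = (\<lambda>A B. \<lambda>f\<in>Hom P A B. a A B f)"
    "el F = (\<lambda>A\<in>Obj P. \<lambda>x\<in>carrier (fib P A). e A x)"
    by (simp_all add: F_def)
  have "ed_morphism F"
    unfolding ed_morphism_def sel
  proof (intro conjI allI impI)
    fix A B W p q assume "is_product P A B W p q"
    moreover from this have "A \<in> Obj P" "B \<in> Obj P" "W \<in> Obj P" "p \<in> Hom P W A" "q \<in> Hom P W B"
      by (auto simp: is_product_def)
    ultimately show "is_product R (restrict h (Obj P) A) (restrict h (Obj P) B) (restrict h (Obj P) W)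
        (restrict (a W A) (Hom P W A) p) (restrict (a W B) (Hom P W B) q)"
      by (simp add: ar_product)
  next
    fix A B
    show "restrict (a A B) (Hom P A B)
        \<in> Hom P A B \<rightarrow>\<^sub>E Hom R (restrict h (Obj P) A) (restrict h (Obj P) B)"
      by (auto simp: ar P.Hom_ObjD)
  next
    fix A assume A: "A \<in> Obj P"
    show "infsl_hom (fib P A) (fib R (restrict h (Obj P) A))
        ((\<lambda>A\<in>Obj P. \<lambda>x\<in>carrier (fib P A). e A x) A)"
      by (simp add: infsl_hom_def A el el_top el_meet P.fib_top P.fib_meet)
    show "(\<lambda>A\<in>Obj P. \<lambda>x\<in>carrier (fib P A). e A x) (Prd P A A) (delta P A) =
        sub R (restrict h (Obj P) (Prd P A A)) (Prd R (restrict h (Obj P) A) (restrict h (Obj P) A))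
          (Pair_arr R (restrict h (Obj P) (Prd P A A)) (restrict h (Obj P) A) (restrict h (Obj P) A)
            (restrict (a (Prd P A A) A) (Hom P (Prd P A A) A) (Pr1 P A A))
            (restrict (a (Prd P A A) A) (Hom P (Prd P A A) A) (Pr2 P A A)))
          (delta R (restrict h (Obj P) A))"
      by (simp add: A P.Prd_Obj P.delta_closed el_delta P.Pr1_Hom P.Pr2_Hom)
  next
    fix f A B x assume "f \<in> Hom P A B" "x \<in> carrier (fib P B)"
    then show "(\<lambda>A\<in>Obj P. \<lambda>x\<in>carrier (fib P A). e A x) A (sub P A B f x) =
        sub R (restrict h (Obj P) A) (restrict h (Obj P) B) (restrict (a A B) (Hom P A B) f)
          ((\<lambda>A\<in>Obj P. \<lambda>x\<in>carrier (fib P A). e A x) B x)"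
      by (simp add: P.Hom_ObjD[of f A B] P.sub_closed el_sub)
  qed (simp_all add: P R ob ar_Idt ar_Cmp P.Idt_Hom P.Cmp_Hom P.Hom_ObjD)
  then show ?thesis
    by (simp add: in_hom1_ED sel P R)
qed

lemma ED_hom1D:
  assumes "in_hom1 ED F P R"
  shows "elementary_doctrine P" "elementary_doctrine R" "dsrc F = P" "dtrg F = R"
    and "A \<in> Obj P \<Longrightarrow> ob F A \<in> Obj R"
    and "f \<in> Hom P A B \<Longrightarrow> ar F A B f \<in> Hom R (ob F A) (ob F B)"
    and "A \<in> Obj P \<Longrightarrow> ar F A A (Idt P A) = Idt R (ob F A)"
    and "\<lbrakk>f \<in> Hom P X Y; g \<in> Hom P Y Z\<rbrakk> \<Longrightarrow>
      ar F X Z (Cmp P X Y Z g f) = Cmp R (ob F X) (ob F Y) (ob F Z) (ar F Y Z g) (ar F X Y f)"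
    and "is_product P A B W p q \<Longrightarrow>
      is_product R (ob F A) (ob F B) (ob F W) (ar F W A p) (ar F W B q)"
    and "\<lbrakk>A \<in> Obj P; x \<in> carrier (fib P A)\<rbrakk> \<Longrightarrow> el F A x \<in> carrier (fib R (ob F A))"
    and "A \<in> Obj P \<Longrightarrow> el F A \<top>\<^bsub>fib P A\<^esub> = \<top>\<^bsub>fib R (ob F A)\<^esub>"
    and "\<lbrakk>A \<in> Obj P; x \<in> carrier (fib P A); y \<in> carrier (fib P A)\<rbrakk> \<Longrightarrow>
      el F A (x \<sqinter>\<^bsub>fib P A\<^esub> y) = el F A x \<sqinter>\<^bsub>fib R (ob F A)\<^esub> el F A y"
    and "\<lbrakk>f \<in> Hom P A B; x \<in> carrier (fib P B)\<rbrakk> \<Longrightarrow>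
      el F A (sub P A B f x) = sub R (ob F A) (ob F B) (ar F A B f) (el F B x)"
    and "A \<in> Obj P \<Longrightarrow> el F (Prd P A A) (delta P A) =
      sub R (ob F (Prd P A A)) (Prd R (ob F A) (ob F A))
        (Pair_arr R (ob F (Prd P A A)) (ob F A) (ob F A)
          (ar F (Prd P A A) A (Pr1 P A A)) (ar F (Prd P A A) A (Pr2 P A A)))
        (delta R (ob F A))"
    and "\<lbrakk>A \<in> Obj P; x \<in> carrier (fib P A); y \<in> carrier (fib P A); x \<sqsubseteq>\<^bsub>fib P A\<^esub> y\<rbrakk> \<Longrightarrow>
      el F A x \<sqsubseteq>\<^bsub>fib R (ob F A)\<^esub> el F A y"
proof -
  have F: "ed_morphism F" and eqs: "dsrc F = P" "dtrg F = R"
    and P: "elementary_doctrine P" and R: "elementary_doctrine R"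
    using assms by (simp_all add: in_hom1_ED)
  interpret P: elementary_doctrine P by fact
  interpret R: elementary_doctrine R by fact
  show "elementary_doctrine P" "elementary_doctrine R" "dsrc F = P" "dtrg F = R" by fact+
  show ob: "A \<in> Obj P \<Longrightarrow> ob F A \<in> Obj R" for A
    using ed_morphism.ob_Obj[OF F] by (auto simp: eqs)
  show "f \<in> Hom P A B \<Longrightarrow> ar F A B f \<in> Hom R (ob F A) (ob F B)"
    using ed_morphism.ar_Hom[OF F, of A B] by (auto simp: eqs)
  show "A \<in> Obj P \<Longrightarrow> ar F A A (Idt P A) = Idt R (ob F A)"
    using ed_morphism.ar_Idt[OF F, of A] by (simp add: eqs)
  show "\<lbrakk>f \<in> Hom P X Y; g \<in> Hom P Y Z\<rbrakk> \<Longrightarrow>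
      ar F X Z (Cmp P X Y Z g f) = Cmp R (ob F X) (ob F Y) (ob F Z) (ar F Y Z g) (ar F X Y f)"
    using ed_morphism.ar_Cmp[OF F, of f X Y g Z] by (simp add: eqs)
  show "is_product P A B W p q \<Longrightarrow>
      is_product R (ob F A) (ob F B) (ob F W) (ar F W A p) (ar F W B q)"
    using ed_morphism.ar_product[OF F, of A B W p q] by (simp add: eqs)
  have hom: "A \<in> Obj P \<Longrightarrow> infsl_hom (fib P A) (fib R (ob F A)) (el F A)" for A
    using ed_morphism.el_hom[OF F, of A] by (simp add: eqs)
  show "\<lbrakk>A \<in> Obj P; x \<in> carrier (fib P A)\<rbrakk> \<Longrightarrow> el F A x \<in> carrier (fib R (ob F A))"
    "A \<in> Obj P \<Longrightarrow> el F A \<top>\<^bsub>fib P A\<^esub> = \<top>\<^bsub>fib R (ob F A)\<^esub>"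
    "\<lbrakk>A \<in> Obj P; x \<in> carrier (fib P A); y \<in> carrier (fib P A)\<rbrakk> \<Longrightarrow>
      el F A (x \<sqinter>\<^bsub>fib P A\<^esub> y) = el F A x \<sqinter>\<^bsub>fib R (ob F A)\<^esub> el F A y"
    using infsl_homD[OF hom] by simp_all
  show "\<lbrakk>f \<in> Hom P A B; x \<in> carrier (fib P B)\<rbrakk> \<Longrightarrow>
      el F A (sub P A B f x) = sub R (ob F A) (ob F B) (ar F A B f) (el F B x)"
    using ed_morphism.el_natural[OF F, of f A B x] by (simp add: eqs)
  show "A \<in> Obj P \<Longrightarrow> el F (Prd P A A) (delta P A) =
      sub R (ob F (Prd P A A)) (Prd R (ob F A) (ob F A))
        (Pair_arr R (ob F (Prd P A A)) (ob F A) (ob F A)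
          (ar F (Prd P A A) A (Pr1 P A A)) (ar F (Prd P A A) A (Pr2 P A A)))
        (delta R (ob F A))"
    using ed_morphism.el_delta[OF F, of A] by (simp add: eqs)
  show "\<lbrakk>A \<in> Obj P; x \<in> carrier (fib P A); y \<in> carrier (fib P A); x \<sqsubseteq>\<^bsub>fib P A\<^esub> y\<rbrakk> \<Longrightarrow>
      el F A x \<sqsubseteq>\<^bsub>fib R (ob F A)\<^esub> el F A y"
    by (simp add: infsl_hom_mono[OF P.fib_infsl R.fib_infsl[OF ob] hom])
qed

lemmas ED_hom1_src = ED_hom1D(1) and ED_hom1_trg = ED_hom1D(2)
  and ED_hom1_dsrc = ED_hom1D(3) and ED_hom1_dtrg = ED_hom1D(4)
  and ob_closed = ED_hom1D(5) and ar_closed = ED_hom1D(6) and ar_Idt = ED_hom1D(7)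
  and ar_Cmp = ED_hom1D(8) and ar_product = ED_hom1D(9) and el_closed = ED_hom1D(10)
  and el_top = ED_hom1D(11) and el_meet = ED_hom1D(12) and el_sub = ED_hom1D(13)
  and el_delta = ED_hom1D(14) and el_mono = ED_hom1D(15)

lemma ED_hom1_eqI:
  assumes F: "in_hom1 ED F P R" and G: "in_hom1 ED G P R"
    and ob: "\<And>A. A \<in> Obj P \<Longrightarrow> ob F A = ob G A"
    and ar: "\<And>A B f. f \<in> Hom P A B \<Longrightarrow> ar F A B f = ar G A B f"
    and el: "\<And>A x. \<lbrakk>A \<in> Obj P; x \<in> carrier (fib P A)\<rbrakk> \<Longrightarrow> el F A x = el G A x"
  shows "F = G"
proof -
  have F': "ed_morphism F" "dsrc F = P" "dtrg F = R" and G': "ed_morphism G" "dsrc G = P" "dtrg G = R"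
    using F G by (simp_all add: in_hom1_ED)
  have "ob F = ob G"
    using ed_morphism.ob_Obj[OF F'(1)] ed_morphism.ob_Obj[OF G'(1)]
    by (intro extensionalityI[of _ "Obj P"]) (simp_all add: F' G' ob PiE_def)
  moreover have "ar F = ar G"
  proof (intro ext)
    fix A B f
    have "ar F A B = ar G A B"
      using ed_morphism.ar_Hom[OF F'(1), of A B] ed_morphism.ar_Hom[OF G'(1), of A B]
      by (intro extensionalityI[of _ "Hom P A B"]) (simp_all add: F' G' ar PiE_def)
    then show "ar F A B f = ar G A B f" by simp
  qed
  moreover have "el F = el G"
  proof (rule extensionalityI[of _ "Obj P"])
    show "el F \<in> extensional (Obj P)" "el G \<in> extensional (Obj P)"
      using ed_morphism.el_extensional[OF F'(1)] ed_morphism.el_extensional[OF G'(1)]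
      by (simp_all add: F' G')
    fix A assume A: "A \<in> Obj P"
    show "el F A = el G A"
      using ed_morphism.el_fib[OF F'(1), of A] ed_morphism.el_fib[OF G'(1), of A]
      by (intro extensionalityI[of _ "carrier (fib P A)"]) (simp_all add: F' G' A el)
  qed
  ultimately show ?thesis
    by (simp add: F' G')
qed

lemma ED_hom2I:
  assumes \<theta>_def: "\<theta> = \<lparr> ddom = F, dcod = G, cmpt = (\<lambda>A\<in>Obj P. t A) \<rparr>"
    and F: "in_hom1 ED F P R" and G: "in_hom1 ED G P R"
    and t: "\<And>A. A \<in> Obj P \<Longrightarrow> t A \<in> Hom R (ob F A) (ob G A)"
    and nat: "\<And>A B f. f \<in> Hom P A B \<Longrightarrow>
      Cmp R (ob F A) (ob F B) (ob G B) (t B) (ar F A B f) =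
      Cmp R (ob F A) (ob G A) (ob G B) (ar G A B f) (t A)"
    and le: "\<And>A x. \<lbrakk>A \<in> Obj P; x \<in> carrier (fib P A)\<rbrakk> \<Longrightarrow>
      el F A x \<sqsubseteq>\<^bsub>fib R (ob F A)\<^esub> sub R (ob F A) (ob G A) (t A) (el G A x)"
  shows "in_hom2 ED \<theta> F G"
proof -
  interpret P: elementary_doctrine P by (rule ED_hom1_src[OF F])
  have F': "ed_morphism F" "dsrc F = P" "dtrg F = R" and G': "ed_morphism G" "dsrc G = P" "dtrg G = R"
    using F G by (simp_all add: in_hom1_ED)
  have "ed_cell \<theta>"
    unfolding ed_cell_def by (auto simp: \<theta>_def F' G' t nat le P.Hom_ObjD)
  then show ?thesis
    by (simp add: in_hom2_ED F' G' \<theta>_def)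
qed

lemma ED_hom2D:
  assumes \<theta>: "in_hom2 ED \<theta> F G" and F: "in_hom1 ED F P R"
  shows "in_hom1 ED G P R" "ddom \<theta> = F" "dcod \<theta> = G"
    and "A \<in> Obj P \<Longrightarrow> cmpt \<theta> A \<in> Hom R (ob F A) (ob G A)"
    and "f \<in> Hom P A B \<Longrightarrow> Cmp R (ob F A) (ob F B) (ob G B) (cmpt \<theta> B) (ar F A B f) =
      Cmp R (ob F A) (ob G A) (ob G B) (ar G A B f) (cmpt \<theta> A)"
    and "\<lbrakk>A \<in> Obj P; x \<in> carrier (fib P A)\<rbrakk> \<Longrightarrow>
      el F A x \<sqsubseteq>\<^bsub>fib R (ob F A)\<^esub> sub R (ob F A) (ob G A) (cmpt \<theta> A) (el G A x)"
proof -
  have c: "ed_cell \<theta>" "ddom \<theta> = F" "dcod \<theta> = G" using \<theta> by (simp_all add: in_hom2_ED)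
  have eqs: "dsrc F = P" "dtrg F = R" using F by (simp_all add: in_hom1_ED)
  show "in_hom1 ED G P R"
    using ed_cell.parallel[OF c(1)] \<theta> F by (simp add: in_hom1_ED in_hom2_ED)
  show "ddom \<theta> = F" "dcod \<theta> = G" by fact+
  show "A \<in> Obj P \<Longrightarrow> cmpt \<theta> A \<in> Hom R (ob F A) (ob G A)"
    using ed_cell.cmpt_Hom[OF c(1), of A] by (simp add: c eqs)
  show "f \<in> Hom P A B \<Longrightarrow> Cmp R (ob F A) (ob F B) (ob G B) (cmpt \<theta> B) (ar F A B f) =
      Cmp R (ob F A) (ob G A) (ob G B) (ar G A B f) (cmpt \<theta> A)"
    using ed_cell.cmpt_natural[OF c(1), of f A B] by (simp add: c eqs)
  show "\<lbrakk>A \<in> Obj P; x \<in> carrier (fib P A)\<rbrakk> \<Longrightarrow>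
      el F A x \<sqsubseteq>\<^bsub>fib R (ob F A)\<^esub> sub R (ob F A) (ob G A) (cmpt \<theta> A) (el G A x)"
    using ed_cell.cmpt_le[OF c(1), of A x] by (simp add: c eqs)
qed

lemmas ED_hom2_cod = ED_hom2D(1) and ED_hom2_ddom = ED_hom2D(2) and ED_hom2_dcod = ED_hom2D(3)
  and cmpt_closed = ED_hom2D(4) and cmpt_natural = ED_hom2D(5) and cmpt_le = ED_hom2D(6)

lemma ED_hom2_eqI:
  assumes \<theta>: "in_hom2 ED \<theta> F G" and \<phi>: "in_hom2 ED \<phi> F G" and F: "in_hom1 ED F P R"
    and eq: "\<And>A. A \<in> Obj P \<Longrightarrow> cmpt \<theta> A = cmpt \<phi> A"
  shows "\<theta> = \<phi>"
proof -
  have c: "ed_cell \<theta>" "ed_cell \<phi>" "ddom \<theta> = F" "dcod \<theta> = G" "ddom \<phi> = F" "dcod \<phi> = G" "dsrc F = P"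
    using \<theta> \<phi> F by (simp_all add: in_hom2_ED in_hom1_ED)
  have "cmpt \<theta> = cmpt \<phi>"
    using ed_cell.cmpt_extensional[OF c(1)] ed_cell.cmpt_extensional[OF c(2)]
    by (intro extensionalityI[of _ "Obj P"]) (simp_all add: c eq)
  then show ?thesis by (simp add: c)
qed

subsection \<open>Composition of 1-cells\<close>

lemma dmor_id_hom:
  assumes P: "elementary_doctrine P"
  shows "in_hom1 ED (dmor_id P) P P"
proof -
  interpret elementary_doctrine P by fact
  show ?thesis
    by (rule ED_hom1I[OF dmor_id_def])
      (simp_all add: P Pair_arr_proj sub_Idt Prd_Obj delta_closed)
qed

lemma dmor_comp_hom:
  assumes F: "in_hom1 ED F P Q" and G: "in_hom1 ED G Q R"
  shows "in_hom1 ED (dmor_comp G F) P R"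
proof -
  interpret P: elementary_doctrine P by (rule ED_hom1_src[OF F])
  interpret Q: elementary_doctrine Q by (rule ED_hom1_src[OF G])
  interpret R: elementary_doctrine R by (rule ED_hom1_trg[OF G])
  note F' = ED_hom1D[OF F] and G' = ED_hom1D[OF G]
  have "dmor_comp G F = \<lparr> dsrc = P, dtrg = R, ob = (\<lambda>A\<in>Obj P. ob G (ob F A)),
      ar = (\<lambda>A B. \<lambda>f\<in>Hom P A B. ar G (ob F A) (ob F B) (ar F A B f)),
      el = (\<lambda>A\<in>Obj P. \<lambda>x\<in>carrier (fib P A). el G (ob F A) (el F A x)) \<rparr>"
    by (simp add: dmor_comp_def F' G')
  then show ?thesis
  proof (rule ED_hom1I)
    fix A assume A: "A \<in> Obj P"
    define AA p q where "AA = Prd P A A" and "p = Pr1 P A A" and "q = Pr2 P A A"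
    let ?FA = "ob F A" and ?FAA = "ob F AA" and ?Fp = "ar F AA A p" and ?Fq = "ar F AA A q"
    let ?D = "Prd Q ?FA ?FA" and ?GFA = "ob G (ob F A)" and ?GFAA = "ob G (ob F AA)"
    let ?k = "Pair_arr Q ?FAA ?FA ?FA ?Fp ?Fq"
    let ?m = "Pair_arr R (ob G ?D) ?GFA ?GFA (ar G ?D ?FA (Pr1 Q ?FA ?FA)) (ar G ?D ?FA (Pr2 Q ?FA ?FA))"
    have FA: "?FA \<in> Obj Q" and p: "?Fp \<in> Hom Q ?FAA ?FA" and q: "?Fq \<in> Hom Q ?FAA ?FA"
      using A P.Pr1_Hom[OF A A] P.Pr2_Hom[OF A A] by (simp_all add: F' AA_def p_def q_def)
    have D: "?D \<in> Obj Q" and k: "?k \<in> Hom Q ?FAA ?D" and GFA: "?GFA \<in> Obj R"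
      using FA p q by (simp_all add: Q.Prd_Obj Q.Pair_arr_Hom G')
    have d1: "ar G ?D ?FA (Pr1 Q ?FA ?FA) \<in> Hom R (ob G ?D) ?GFA"
      and d2: "ar G ?D ?FA (Pr2 Q ?FA ?FA) \<in> Hom R (ob G ?D) ?GFA"
      using FA by (simp_all add: G' Q.Pr1_Hom Q.Pr2_Hom)
    have m: "?m \<in> Hom R (ob G ?D) (Prd R ?GFA ?GFA)" and Gk: "ar G ?FAA ?D ?k \<in> Hom R ?GFAA (ob G ?D)"
      using d1 d2 k by (simp_all add: R.Pair_arr_Hom G')
    \<comment> \<open>The equality predicate of \<open>A\<close> is sent to that of \<open>F A\<close> along \<open>\<langle>F pr1, F pr2\<rangle>\<close>, whose
      image under \<open>G\<close> composes with \<open>\<langle>G pr1, G pr2\<rangle>\<close> to \<open>\<langle>G F pr1, G F pr2\<rangle>\<close>.\<close>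
    have "el G ?FAA (el F AA (delta P A)) = el G ?FAA (sub Q ?FAA ?D ?k (delta Q ?FA))"
      using F'(14)[OF A] by (simp add: AA_def p_def q_def)
    also have "\<dots> = sub R ?GFAA (ob G ?D) (ar G ?FAA ?D ?k) (el G ?D (delta Q ?FA))"
      by (rule G'(13)[OF k Q.delta_closed[OF FA]])
    also have "\<dots> = sub R ?GFAA (ob G ?D) (ar G ?FAA ?D ?k)
        (sub R (ob G ?D) (Prd R ?GFA ?GFA) ?m (delta R ?GFA))"
      by (simp add: G'(14)[OF FA])
    also have "\<dots> = sub R ?GFAA (Prd R ?GFA ?GFA)
        (Cmp R ?GFAA (ob G ?D) (Prd R ?GFA ?GFA) ?m (ar G ?FAA ?D ?k)) (delta R ?GFA)"
      by (rule R.sub_Cmp[OF Gk m R.delta_closed[OF GFA], symmetric])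
    also have "Cmp R ?GFAA (ob G ?D) (Prd R ?GFA ?GFA) ?m (ar G ?FAA ?D ?k)
        = Pair_arr R ?GFAA ?GFA ?GFA (ar G ?FAA ?FA ?Fp) (ar G ?FAA ?FA ?Fq)"
      by (simp add: R.Cmp_Pair_arr[OF Gk d1 d2] G'(8)[OF k, symmetric] FA Q.Pr1_Hom Q.Pr2_Hom
          Q.Pr1_Pair_arr[OF p q] Q.Pr2_Pair_arr[OF p q])
    finally show "el G (ob F (Prd P A A)) (el F (Prd P A A) (delta P A)) =
       sub R (ob G (ob F (Prd P A A))) (Prd R (ob G (ob F A)) (ob G (ob F A)))
        (Pair_arr R (ob G (ob F (Prd P A A))) (ob G (ob F A)) (ob G (ob F A))
          (ar G (ob F (Prd P A A)) (ob F A) (ar F (Prd P A A) A (Pr1 P A A)))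
          (ar G (ob F (Prd P A A)) (ob F A) (ar F (Prd P A A) A (Pr2 P A A))))
        (delta R (ob G (ob F A)))"
      by (simp add: AA_def p_def q_def)
  qed (simp_all add: F' G' P.Hom_ObjD P.elementary_doctrine_axioms R.elementary_doctrine_axioms)
qed

lemma dmor_id_sel:
  "dsrc (dmor_id P) = P" "dtrg (dmor_id P) = P"
  "A \<in> Obj P \<Longrightarrow> ob (dmor_id P) A = A"
  "f \<in> Hom P A B \<Longrightarrow> ar (dmor_id P) A B f = f"
  "\<lbrakk>A \<in> Obj P; x \<in> carrier (fib P A)\<rbrakk> \<Longrightarrow> el (dmor_id P) A x = x"
  by (simp_all add: dmor_id_def)

lemma dmor_comp_sel:
  assumes "in_hom1 ED F P Q"
  shows "dsrc (dmor_comp G F) = P" "dtrg (dmor_comp G F) = dtrg G"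
    "A \<in> Obj P \<Longrightarrow> ob (dmor_comp G F) A = ob G (ob F A)"
    "f \<in> Hom P A B \<Longrightarrow> ar (dmor_comp G F) A B f = ar G (ob F A) (ob F B) (ar F A B f)"
    "\<lbrakk>A \<in> Obj P; x \<in> carrier (fib P A)\<rbrakk> \<Longrightarrow> el (dmor_comp G F) A x = el G (ob F A) (el F A x)"
  using ED_hom1_dsrc[OF assms] by (simp_all add: dmor_comp_def)

lemma dmor_comp_assoc:
  assumes F: "in_hom1 ED F P Q" and G: "in_hom1 ED G Q R" and H: "in_hom1 ED H R S"
  shows "dmor_comp (dmor_comp H G) F = dmor_comp H (dmor_comp G F)"
  by (rule ED_hom1_eqI[OF dmor_comp_hom[OF F dmor_comp_hom[OF G H]] dmor_comp_hom[OF dmor_comp_hom[OF F G] H]])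
    (simp_all add: dmor_comp_sel[OF F] dmor_comp_sel[OF G] dmor_comp_sel[OF dmor_comp_hom[OF F G]]
      ob_closed[OF F] ar_closed[OF F] el_closed[OF F]
      product_category.Hom_ObjD[OF elementary_doctrine_locales(2)[OF ED_hom1_src[OF F]]])

lemma dmor_comp_id_left:
  assumes F: "in_hom1 ED F P Q"
  shows "dmor_comp (dmor_id Q) F = F"
  by (rule ED_hom1_eqI[OF dmor_comp_hom[OF F dmor_id_hom[OF ED_hom1_trg[OF F]]] F])
    (simp_all add: dmor_comp_sel[OF F] dmor_id_sel ob_closed[OF F] ar_closed[OF F] el_closed[OF F])

lemma dmor_comp_id_right:
  assumes F: "in_hom1 ED F P Q"
  shows "dmor_comp F (dmor_id P) = F"
  by (rule ED_hom1_eqI[OF dmor_comp_hom[OF dmor_id_hom[OF ED_hom1_src[OF F]] F] F])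
    (simp_all add: dmor_comp_sel[OF dmor_id_hom[OF ED_hom1_src[OF F]]] dmor_id_sel
      product_category.Hom_ObjD[OF elementary_doctrine_locales(2)[OF ED_hom1_src[OF F]]])

subsection \<open>Compositions of 2-cells\<close>

lemma dcell_id_cmpt:
  "in_hom1 ED F P R \<Longrightarrow> A \<in> Obj P \<Longrightarrow> cmpt (dcell_id F) A = Idt R (ob F A)"
  by (simp add: dcell_id_def ED_hom1_dsrc ED_hom1_dtrg)

lemma dcell_id_hom:
  assumes F: "in_hom1 ED F P R"
  shows "in_hom2 ED (dcell_id F) F F"
proof -
  interpret P: elementary_doctrine P by (rule ED_hom1_src[OF F])
  interpret R: elementary_doctrine R by (rule ED_hom1_trg[OF F])
  show ?thesis
    by (rule ED_hom2I[OF dcell_id_def[of F, unfolded ED_hom1_dsrc[OF F]] F F])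
      (simp_all add: ED_hom1D[OF F] R.Idt_Hom R.sub_Idt R.fib_le_refl
        R.Cmp_Idt_left[OF ar_closed[OF F]] R.Cmp_Idt_right[OF ar_closed[OF F]])
qed

lemma dcell_vcomp_cmpt:
  assumes \<theta>: "in_hom2 ED \<theta> F G" and \<phi>: "in_hom2 ED \<phi> G H" and F: "in_hom1 ED F P R"
    and A: "A \<in> Obj P"
  shows "cmpt (dcell_vcomp \<phi> \<theta>) A = Cmp R (ob F A) (ob G A) (ob H A) (cmpt \<phi> A) (cmpt \<theta> A)"
  using ED_hom2D(2,3)[OF \<theta> F] ED_hom2D(3)[OF \<phi> ED_hom2_cod[OF \<theta> F]] ED_hom1D(3,4)[OF F] A
  by (simp add: dcell_vcomp_def)

lemma dcell_vcomp_hom: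
  assumes \<theta>: "in_hom2 ED \<theta> F G" and \<phi>: "in_hom2 ED \<phi> G H" and F: "in_hom1 ED F P R"
  shows "in_hom2 ED (dcell_vcomp \<phi> \<theta>) F H"
proof -
  interpret P: elementary_doctrine P by (rule ED_hom1_src[OF F])
  interpret R: elementary_doctrine R by (rule ED_hom1_trg[OF F])
  note G = ED_hom2_cod[OF \<theta> F]
  note H = ED_hom2_cod[OF \<phi> G]
  note t = cmpt_closed[OF \<theta> F] and u = cmpt_closed[OF \<phi> G]
  have "dcell_vcomp \<phi> \<theta> = \<lparr> ddom = F, dcod = H,
      cmpt = (\<lambda>A\<in>Obj P. Cmp R (ob F A) (ob G A) (ob H A) (cmpt \<phi> A) (cmpt \<theta> A)) \<rparr>"
    by (simp add: dcell_vcomp_def ED_hom2D[OF \<theta> F] ED_hom2D[OF \<phi> G] ED_hom1D[OF F])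
  then show ?thesis
  proof (rule ED_hom2I[OF _ F H])
    fix A B f assume f: "f \<in> Hom P A B"
    then have A: "A \<in> Obj P" and B: "B \<in> Obj P" by (rule P.Hom_ObjD)+
    show "Cmp R (ob F A) (ob F B) (ob H B) (Cmp R (ob F B) (ob G B) (ob H B) (cmpt \<phi> B) (cmpt \<theta> B)) (ar F A B f) =
       Cmp R (ob F A) (ob H A) (ob H B) (ar H A B f) (Cmp R (ob F A) (ob G A) (ob H A) (cmpt \<phi> A) (cmpt \<theta> A))"
      by (simp add: R.Cmp_assoc[OF ar_closed[OF F f] t[OF B] u[OF B]] cmpt_natural[OF \<theta> F f]
          R.Cmp_assoc[OF t[OF A] ar_closed[OF G f] u[OF B], symmetric] cmpt_natural[OF \<phi> G f]
          R.Cmp_assoc[OF t[OF A] u[OF A] ar_closed[OF H f]])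
  next
    fix A x assume A: "A \<in> Obj P" and x: "x \<in> carrier (fib P A)"
    note c = ob_closed[OF F A] el_closed[OF F A x] el_closed[OF G A x] el_closed[OF H A x]
    have "sub R (ob F A) (ob G A) (cmpt \<theta> A) (el G A x) \<sqsubseteq>\<^bsub>fib R (ob F A)\<^esub>
        sub R (ob F A) (ob G A) (cmpt \<theta> A) (sub R (ob G A) (ob H A) (cmpt \<phi> A) (el H A x))"
      by (rule R.sub_mono[OF t[OF A] cmpt_le[OF \<phi> G A x] c(3) R.sub_closed[OF u[OF A] c(4)]])
    then show "el F A x \<sqsubseteq>\<^bsub>fib R (ob F A)\<^esub>
        sub R (ob F A) (ob H A) (Cmp R (ob F A) (ob G A) (ob H A) (cmpt \<phi> A) (cmpt \<theta> A)) (el H A x)"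
      unfolding R.sub_Cmp[OF t[OF A] u[OF A] c(4)]
      using R.fib_le_trans[OF c(1) cmpt_le[OF \<theta> F A x]] c
        R.sub_closed[OF t[OF A]] R.sub_closed[OF u[OF A]] by simp
  qed (simp add: R.Cmp_Hom[OF t u])
qed

lemma dcell_hcomp_cmpt:
  assumes \<theta>: "in_hom2 ED \<theta> F F'" and \<phi>: "in_hom2 ED \<phi> G G'"
    and F: "in_hom1 ED F P Q" and G: "in_hom1 ED G Q R" and A: "A \<in> Obj P"
  shows "cmpt (dcell_hcomp \<phi> \<theta>) A =
    Cmp R (ob G (ob F A)) (ob G (ob F' A)) (ob G' (ob F' A))
      (cmpt \<phi> (ob F' A)) (ar G (ob F A) (ob F' A) (cmpt \<theta> A))"
  using ED_hom2D(2,3)[OF \<theta> F] ED_hom2D(2,3)[OF \<phi> G] ED_hom1D(3,4)[OF F] ED_hom1D(3,4)[OF G] A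
  by (simp add: dcell_hcomp_def)

lemma dcell_hcomp_hom:
  assumes \<theta>: "in_hom2 ED \<theta> F F'" and \<phi>: "in_hom2 ED \<phi> G G'"
    and F: "in_hom1 ED F P Q" and G: "in_hom1 ED G Q R"
  shows "in_hom2 ED (dcell_hcomp \<phi> \<theta>) (dmor_comp G F) (dmor_comp G' F')"
proof -
  interpret P: elementary_doctrine P by (rule ED_hom1_src[OF F])
  interpret Q: elementary_doctrine Q by (rule ED_hom1_src[OF G])
  interpret R: elementary_doctrine R by (rule ED_hom1_trg[OF G])
  note F' = ED_hom2_cod[OF \<theta> F] and G' = ED_hom2_cod[OF \<phi> G]
  note t = cmpt_closed[OF \<theta> F] and u = cmpt_closed[OF \<phi> G ob_closed[OF F']]
  note Gt = ar_closed[OF G t]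
  have "dcell_hcomp \<phi> \<theta> = \<lparr> ddom = dmor_comp G F, dcod = dmor_comp G' F',
      cmpt = (\<lambda>A\<in>Obj P. Cmp R (ob G (ob F A)) (ob G (ob F' A)) (ob G' (ob F' A))
        (cmpt \<phi> (ob F' A)) (ar G (ob F A) (ob F' A) (cmpt \<theta> A))) \<rparr>"
    by (simp add: dcell_hcomp_def ED_hom2D[OF \<theta> F] ED_hom2D[OF \<phi> G] ED_hom1D[OF F] ED_hom1D[OF G])
  then show ?thesis
  proof (rule ED_hom2I[OF _ dmor_comp_hom[OF F G] dmor_comp_hom[OF F' G']])
    fix A B f assume f: "f \<in> Hom P A B"
    then have A: "A \<in> Obj P" and B: "B \<in> Obj P" by (rule P.Hom_ObjD)+
    note Ff = ar_closed[OF F f] and F'f = ar_closed[OF F' f]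
    show "Cmp R (ob (dmor_comp G F) A) (ob (dmor_comp G F) B) (ob (dmor_comp G' F') B)
        (Cmp R (ob G (ob F B)) (ob G (ob F' B)) (ob G' (ob F' B)) (cmpt \<phi> (ob F' B))
          (ar G (ob F B) (ob F' B) (cmpt \<theta> B)))
        (ar (dmor_comp G F) A B f) =
       Cmp R (ob (dmor_comp G F) A) (ob (dmor_comp G' F') A) (ob (dmor_comp G' F') B)
        (ar (dmor_comp G' F') A B f)
        (Cmp R (ob G (ob F A)) (ob G (ob F' A)) (ob G' (ob F' A)) (cmpt \<phi> (ob F' A))
          (ar G (ob F A) (ob F' A) (cmpt \<theta> A)))"
      by (simp add: dmor_comp_sel[OF F] dmor_comp_sel[OF F'] A B f
          R.Cmp_assoc[OF ar_closed[OF G Ff] Gt[OF B] u[OF B]]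
          ar_Cmp[OF G Ff t[OF B], symmetric] cmpt_natural[OF \<theta> F f] ar_Cmp[OF G t[OF A] F'f]
          R.Cmp_assoc[OF Gt[OF A] ar_closed[OF G F'f] u[OF B], symmetric] cmpt_natural[OF \<phi> G F'f]
          R.Cmp_assoc[OF Gt[OF A] u[OF A] ar_closed[OF G' F'f]])
  next
    fix A x assume A: "A \<in> Obj P" and x: "x \<in> carrier (fib P A)"
    let ?FA = "ob F A" and ?F'A = "ob F' A" and ?Fx = "el F A x" and ?F'x = "el F' A x"
    note FA = ob_closed[OF F A] and F'A = ob_closed[OF F' A]
    note Fx = el_closed[OF F A x] and F'x = el_closed[OF F' A x]
    have 1: "el G ?FA ?Fx \<sqsubseteq>\<^bsub>fib R (ob G ?FA)\<^esub> el G ?FA (sub Q ?FA ?F'A (cmpt \<theta> A) ?F'x)"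
      by (rule el_mono[OF G FA Fx Q.sub_closed[OF t[OF A] F'x] cmpt_le[OF \<theta> F A x]])
    have 2: "sub R (ob G ?FA) (ob G ?F'A) (ar G ?FA ?F'A (cmpt \<theta> A)) (el G ?F'A ?F'x) \<sqsubseteq>\<^bsub>fib R (ob G ?FA)\<^esub>
        sub R (ob G ?FA) (ob G ?F'A) (ar G ?FA ?F'A (cmpt \<theta> A))
          (sub R (ob G ?F'A) (ob G' ?F'A) (cmpt \<phi> ?F'A) (el G' ?F'A ?F'x))"
      by (rule R.sub_mono[OF Gt[OF A] cmpt_le[OF \<phi> G F'A F'x] el_closed[OF G F'A F'x]
            R.sub_closed[OF u[OF A] el_closed[OF G' F'A F'x]]])
    show "el (dmor_comp G F) A x \<sqsubseteq>\<^bsub>fib R (ob (dmor_comp G F) A)\<^esub>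
        sub R (ob (dmor_comp G F) A) (ob (dmor_comp G' F') A)
          (Cmp R (ob G (ob F A)) (ob G (ob F' A)) (ob G' (ob F' A)) (cmpt \<phi> (ob F' A))
            (ar G (ob F A) (ob F' A) (cmpt \<theta> A)))
          (el (dmor_comp G' F') A x)"
      using R.fib_le_trans[OF ob_closed[OF G FA] 1[unfolded el_sub[OF G t[OF A] F'x]] 2]
      by (simp add: dmor_comp_sel[OF F] dmor_comp_sel[OF F'] A x
          R.sub_Cmp[OF Gt[OF A] u[OF A] el_closed[OF G' F'A F'x]]
          el_closed[OF G FA Fx] R.sub_closed[OF Gt[OF A]] el_closed[OF G F'A F'x]
          R.sub_closed[OF u[OF A]] el_closed[OF G' F'A F'x])
  qed (simp add: dmor_comp_sel[OF F] dmor_comp_sel[OF F'] R.Cmp_Hom[OF Gt u])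
qed

lemma dcell_vcomp_assoc:
  assumes s: "in_hom2 ED s F G" and t: "in_hom2 ED t G H" and u: "in_hom2 ED u H I"
    and F: "in_hom1 ED F P R"
  shows "dcell_vcomp (dcell_vcomp u t) s = dcell_vcomp u (dcell_vcomp t s)"
proof -
  interpret R: elementary_doctrine R by (rule ED_hom1_trg[OF F])
  note G = ED_hom2_cod[OF s F]
  note H = ED_hom2_cod[OF t G]
  note ts = dcell_vcomp_hom[OF s t F] and ut = dcell_vcomp_hom[OF t u G]
  show ?thesis
    by (rule ED_hom2_eqI[OF dcell_vcomp_hom[OF s ut F] dcell_vcomp_hom[OF ts u F] F])
      (simp add: dcell_vcomp_cmpt[OF s ut F] dcell_vcomp_cmpt[OF ts u F] dcell_vcomp_cmpt[OF s t F]
        dcell_vcomp_cmpt[OF t u G]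
        R.Cmp_assoc[OF cmpt_closed[OF s F] cmpt_closed[OF t G] cmpt_closed[OF u H]])
qed

lemma dcell_vcomp_id:
  assumes s: "in_hom2 ED s F G" and F: "in_hom1 ED F P R"
  shows "dcell_vcomp (dcell_id G) s = s" "dcell_vcomp s (dcell_id F) = s"
proof -
  interpret R: elementary_doctrine R by (rule ED_hom1_trg[OF F])
  note G = ED_hom2_cod[OF s F]
  note i = dcell_id_hom[OF F] and j = dcell_id_hom[OF G]
  show "dcell_vcomp (dcell_id G) s = s"
    by (rule ED_hom2_eqI[OF dcell_vcomp_hom[OF s j F] s F])
      (simp add: dcell_vcomp_cmpt[OF s j F] dcell_id_cmpt[OF G] R.Cmp_Idt_left[OF cmpt_closed[OF s F]])
  show "dcell_vcomp s (dcell_id F) = s"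
    by (rule ED_hom2_eqI[OF dcell_vcomp_hom[OF i s F] s F])
      (simp add: dcell_vcomp_cmpt[OF i s F] dcell_id_cmpt[OF F] R.Cmp_Idt_right[OF cmpt_closed[OF s F]])
qed

lemma dcell_hcomp_assoc:
  assumes s: "in_hom2 ED s F F'" and t: "in_hom2 ED t G G'" and u: "in_hom2 ED u H H'"
    and F: "in_hom1 ED F P Q" and G: "in_hom1 ED G Q R" and H: "in_hom1 ED H R S"
  shows "dcell_hcomp (dcell_hcomp u t) s = dcell_hcomp u (dcell_hcomp t s)"
proof -
  interpret R: elementary_doctrine R by (rule ED_hom1_src[OF H])
  interpret S: elementary_doctrine S by (rule ED_hom1_trg[OF H])
  note F' = ED_hom2_cod[OF s F] and G' = ED_hom2_cod[OF t G] and H' = ED_hom2_cod[OF u H]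
  note GF = dmor_comp_hom[OF F G] and HG = dmor_comp_hom[OF G H]
  note ts = dcell_hcomp_hom[OF s t F G] and ut = dcell_hcomp_hom[OF t u G H]
  note sA = cmpt_closed[OF s F] and tA = cmpt_closed[OF t G ob_closed[OF F']]
  note uA = cmpt_closed[OF u H ob_closed[OF G' ob_closed[OF F']]]
  note l = dcell_hcomp_hom[OF s ut F HG, unfolded dmor_comp_assoc[OF F G H] dmor_comp_assoc[OF F' G' H']]
  show ?thesis
    by (rule ED_hom2_eqI[OF l dcell_hcomp_hom[OF ts u GF H] dmor_comp_hom[OF GF H]])
      (simp add: dcell_hcomp_cmpt[OF s ut F HG] dcell_hcomp_cmpt[OF ts u GF H]
        dcell_hcomp_cmpt[OF s t F G] dcell_hcomp_cmpt[OF t u G H]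
        dmor_comp_sel[OF F] dmor_comp_sel[OF F'] dmor_comp_sel[OF G] dmor_comp_sel[OF G']
        ob_closed[OF F] ob_closed[OF F'] sA ar_Cmp[OF H ar_closed[OF G sA] tA]
        S.Cmp_assoc[OF ar_closed[OF H ar_closed[OF G sA]] ar_closed[OF H tA] uA])
qed

lemma dcell_hcomp_id:
  assumes s: "in_hom2 ED s F F'" and F: "in_hom1 ED F P Q"
  shows "dcell_hcomp (dcell_id (dmor_id Q)) s = s" "dcell_hcomp s (dcell_id (dmor_id P)) = s"
proof -
  interpret P: elementary_doctrine P by (rule ED_hom1_src[OF F])
  interpret Q: elementary_doctrine Q by (rule ED_hom1_trg[OF F])
  note F' = ED_hom2_cod[OF s F] and sA = cmpt_closed[OF s F]
  note iP = dmor_id_hom[OF ED_hom1_src[OF F]] and iQ = dmor_id_hom[OF ED_hom1_trg[OF F]]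
  note l = dcell_hcomp_hom[OF s dcell_id_hom[OF iQ] F iQ,
      unfolded dmor_comp_id_left[OF F] dmor_comp_id_left[OF F']]
  note r = dcell_hcomp_hom[OF dcell_id_hom[OF iP] s iP F,
      unfolded dmor_comp_id_right[OF F] dmor_comp_id_right[OF F']]
  show "dcell_hcomp (dcell_id (dmor_id Q)) s = s"
    by (rule ED_hom2_eqI[OF l s F])
      (simp add: dcell_hcomp_cmpt[OF s dcell_id_hom[OF iQ] F iQ] dcell_id_cmpt[OF iQ] dmor_id_sel
        ob_closed[OF F] ob_closed[OF F'] sA Q.Cmp_Idt_left[OF sA])
  show "dcell_hcomp s (dcell_id (dmor_id P)) = s"
    by (rule ED_hom2_eqI[OF r s F])
      (simp add: dcell_hcomp_cmpt[OF dcell_id_hom[OF iP] s iP F] dcell_id_cmpt[OF iP] dmor_id_sel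
        ar_Idt[OF F] Q.Cmp_Idt_right[OF sA])
qed

lemma dcell_hcomp_dcell_id:
  assumes F: "in_hom1 ED F P Q" and G: "in_hom1 ED G Q R"
  shows "dcell_hcomp (dcell_id G) (dcell_id F) = dcell_id (dmor_comp G F)"
proof -
  interpret R: elementary_doctrine R by (rule ED_hom1_trg[OF G])
  note i = dcell_id_hom[OF F] and j = dcell_id_hom[OF G] and GF = dmor_comp_hom[OF F G]
  show ?thesis
    by (rule ED_hom2_eqI[OF dcell_hcomp_hom[OF i j F G] dcell_id_hom[OF GF] GF])
      (simp add: dcell_hcomp_cmpt[OF i j F G] dcell_id_cmpt[OF GF] dcell_id_cmpt[OF F] dcell_id_cmpt[OF G]
        ob_closed[OF F] ob_closed[OF G] ar_Idt[OF G] dmor_comp_sel[OF F] R.Cmp_Idt_left R.Idt_Hom)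
qed

text \<open>Units, multiplications and the comparison cell enter horizontal composites by whiskering,
  whose components simplify because the identity factors cancel.\<close>
lemma dcell_whisker_right_cmpt:
  assumes F: "in_hom1 ED F P Q" and \<phi>: "in_hom2 ED \<phi> G G'" and G: "in_hom1 ED G Q R"
    and A: "A \<in> Obj P"
  shows "cmpt (dcell_hcomp \<phi> (dcell_id F)) A = cmpt \<phi> (ob F A)"
proof -
  interpret R: elementary_doctrine R by (rule ED_hom1_trg[OF G])
  show ?thesis
    using A by (simp add: dcell_hcomp_cmpt[OF dcell_id_hom[OF F] \<phi> F G] dcell_id_cmpt[OF F]
        ar_Idt[OF G] ob_closed[OF F] R.Cmp_Idt_right[OF cmpt_closed[OF \<phi> G]])
qed

lemma dcell_whisker_left_cmpt:
  assumes \<theta>: "in_hom2 ED \<theta> F F'" and F: "in_hom1 ED F P Q" and G: "in_hom1 ED G Q R"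
    and A: "A \<in> Obj P"
  shows "cmpt (dcell_hcomp (dcell_id G) \<theta>) A = ar G (ob F A) (ob F' A) (cmpt \<theta> A)"
proof -
  interpret R: elementary_doctrine R by (rule ED_hom1_trg[OF G])
  show ?thesis
    using A by (simp add: dcell_hcomp_cmpt[OF \<theta> dcell_id_hom[OF G] F G] dcell_id_cmpt[OF G]
        ob_closed[OF ED_hom2_cod[OF \<theta> F]] R.Cmp_Idt_left[OF ar_closed[OF G cmpt_closed[OF \<theta> F]]])
qed

lemma dcell_interchange:
  assumes s: "in_hom2 ED s F F'" and s': "in_hom2 ED s' F' F''"
    and t: "in_hom2 ED t G G'" and t': "in_hom2 ED t' G' G''"
    and F: "in_hom1 ED F P Q" and G: "in_hom1 ED G Q R"
  shows "dcell_hcomp (dcell_vcomp t' t) (dcell_vcomp s' s) =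
    dcell_vcomp (dcell_hcomp t' s') (dcell_hcomp t s)"
proof -
  interpret R: elementary_doctrine R by (rule ED_hom1_trg[OF G])
  note F' = ED_hom2_cod[OF s F] and G' = ED_hom2_cod[OF t G]
  note F'' = ED_hom2_cod[OF s' F']
  note ss = dcell_vcomp_hom[OF s s' F] and tt = dcell_vcomp_hom[OF t t' G]
  note ts = dcell_hcomp_hom[OF s t F G] and ts' = dcell_hcomp_hom[OF s' t' F' G']
  note sA = cmpt_closed[OF s F] and sA' = cmpt_closed[OF s' F']
  note GF = dmor_comp_hom[OF F G]
  show ?thesis
  proof (rule ED_hom2_eqI[OF dcell_hcomp_hom[OF ss tt F G] dcell_vcomp_hom[OF ts ts' GF] GF])
    fix A assume A: "A \<in> Obj P"
    note tA = cmpt_closed[OF t G ob_closed[OF F' A]] and tA' = cmpt_closed[OF t G ob_closed[OF F'' A]]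
    note tB = cmpt_closed[OF t' G' ob_closed[OF F'' A]]
    note Gs = ar_closed[OF G sA[OF A]] and Gs' = ar_closed[OF G sA'[OF A]]
    note G's' = ar_closed[OF G' sA'[OF A]]
    show "cmpt (dcell_hcomp (dcell_vcomp t' t) (dcell_vcomp s' s)) A =
      cmpt (dcell_vcomp (dcell_hcomp t' s') (dcell_hcomp t s)) A"
      by (simp add: A dcell_hcomp_cmpt[OF ss tt F G] dcell_vcomp_cmpt[OF ts ts' GF]
          dcell_hcomp_cmpt[OF s t F G] dcell_hcomp_cmpt[OF s' t' F' G']
          dcell_vcomp_cmpt[OF s s' F] dcell_vcomp_cmpt[OF t t' G] ob_closed[OF F'']
          dmor_comp_sel[OF F] dmor_comp_sel[OF F'] dmor_comp_sel[OF F'']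
          ar_Cmp[OF G sA[OF A] sA'[OF A]]
          R.Cmp_assoc[OF R.Cmp_Hom[OF Gs Gs'] tA' tB] R.Cmp_assoc[OF Gs Gs' tA', symmetric]
          cmpt_natural[OF t G sA'[OF A]] R.Cmp_assoc[OF Gs tA G's']
          R.Cmp_assoc[OF R.Cmp_Hom[OF Gs tA] G's' tB])
  qed
qed

lemma ED_sel:
  "src ED = dsrc" "trg ED = dtrg" "one1 ED = dmor_id" "comp1 ED = dmor_comp"
  "one2 ED = dcell_id" "vcomp ED = dcell_vcomp" "hcomp ED = dcell_hcomp"
  "dom2 ED = ddom" "cod2 ED = dcod"
  by (simp_all add: ED_def)

lemma ED_hom1_self:
  assumes "ed_morphism F"
  shows "in_hom1 ED F (dsrc F) (dtrg F)"
  using assms ed_morphism.src_elementary[OF assms] ed_morphism.trg_elementary[OF assms]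
  by (simp add: in_hom1_ED)

lemma ED_hom2_dom: "in_hom2 ED s F G \<Longrightarrow> in_hom1 ED F (dsrc F) (dtrg F)"
  by (simp add: in_hom2_ED ED_hom1_self)

theorem ED_two_category: "two_category ED"
proof (unfold_locales, unfold ED_sel)
  show "in_hom1 ED f (dsrc f) (dtrg f)" if "f \<in> cell1 ED" for f :: "('a, 'b, 'c) dmor"
    using that ED_hom1_self by (simp add: ED_def)
  show "in_hom2 ED (dcell_id f) f f" if "f \<in> cell1 ED" for f :: "('a, 'b, 'c) dmor"
    using that dcell_id_hom[OF ED_hom1_self] by (simp add: ED_def)
  show "in_hom2 ED s (ddom s) (dcod s)" if "s \<in> cell2 ED" for s :: "('a, 'b, 'c) dcell"
    using that ed_cell.dom_morphism[of s] ed_cell.cod_morphism[of s]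
    by (simp add: in_hom2_ED) (simp add: ED_def)
  show "dsrc (ddom s) = dsrc (dcod s) \<and> dtrg (ddom s) = dtrg (dcod s)"
    if "s \<in> cell2 ED" for s :: "('a, 'b, 'c) dcell"
    using that ed_cell.parallel[of s] by (simp add: ED_def)
  show "in_hom1 ED (dmor_id x) x x" if "x \<in> cell0 ED" for x :: "('a, 'b, 'c) doctrine"
    using that dmor_id_hom by (simp add: ED_def)
next
  fix s t :: "('a, 'b, 'c) dcell" and f f' g g'
  assume s: "in_hom2 ED s f f'" and t: "in_hom2 ED t g g'" and eq: "dtrg f = dsrc g"
  note f = ED_hom2_dom[OF s] and g = ED_hom2_dom[OF t, folded eq]
  show "in_hom2 ED (dcell_hcomp t s) (dmor_comp g f) (dmor_comp g' f')"
    by (rule dcell_hcomp_hom[OF s t f g])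
  show "dcell_hcomp (dcell_vcomp t' t) (dcell_vcomp s' s) =
      dcell_vcomp (dcell_hcomp t' s') (dcell_hcomp t s)"
    if s': "in_hom2 ED s' f' f''" and t': "in_hom2 ED t' g' g''" for s' t' f'' g''
    by (rule dcell_interchange[OF s s' t t' f g])
  show "dcell_hcomp (dcell_hcomp u t) s = dcell_hcomp u (dcell_hcomp t s)"
    if u: "in_hom2 ED u h h'" and eq': "dtrg g = dsrc h" for u h h'
    by (rule dcell_hcomp_assoc[OF s t u f g ED_hom2_dom[OF u, folded eq']])
qed (auto intro: dmor_comp_hom dmor_comp_assoc dmor_comp_id_left dmor_comp_id_right
    dcell_hcomp_dcell_id dcell_vcomp_hom dcell_vcomp_assoc dcell_vcomp_id dcell_hcomp_id ED_hom2_dom)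

section \<open>The comprehension completion of a doctrine\<close>

lemma Tc0_sel:
  "Idt (Tc0 P) X = Idt P (under X)"
  "Cmp (Tc0 P) X Y Z = Cmp P (under X) (under Y) (under Z)"
  "under (Prd (Tc0 P) X Y) = Prd P (under X) (under Y)"
  "pred (Prd (Tc0 P) X Y) =
    sub P (Prd P (under X) (under Y)) (under X) (Pr1 P (under X) (under Y)) (pred X)
      \<sqinter>\<^bsub>fib P (Prd P (under X) (under Y))\<^esub>
    sub P (Prd P (under X) (under Y)) (under Y) (Pr2 P (under X) (under Y)) (pred Y)"
  "Pr1 (Tc0 P) X Y = Pr1 P (under X) (under Y)"
  "Pr2 (Tc0 P) X Y = Pr2 P (under X) (under Y)"
  "le (fib (Tc0 P) X) = le (fib P (under X))"
  "sub (Tc0 P) X Y f x = sub P (under X) (under Y) f x \<sqinter>\<^bsub>fib P (under X)\<^esub> pred X"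
  by (simp_all add: Tc0_def Let_def)

lemma Obj_Tc0_iff:
  "X \<in> Obj (Tc0 P) \<longleftrightarrow>
    under X \<in> Obj P \<and> pred X \<in> carrier (fib P (under X)) \<and> X = Ext (under X) (pred X)"
  by (auto simp: Tc0_def Let_def)

lemma Hom_Tc0_iff:
  "f \<in> Hom (Tc0 P) X Y \<longleftrightarrow> X \<in> Obj (Tc0 P) \<and> Y \<in> Obj (Tc0 P) \<and> f \<in> Hom P (under X) (under Y) \<and>
    pred X \<sqsubseteq>\<^bsub>fib P (under X)\<^esub> sub P (under X) (under Y) f (pred Y)"
  by (auto simp: Tc0_def Let_def)

lemma carrier_Tc0_iff:
  "x \<in> carrier (fib (Tc0 P) X) \<longleftrightarrow> x \<in> carrier (fib P (under X)) \<and> x \<sqsubseteq>\<^bsub>fib P (under X)\<^esub> pred X"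
  by (simp add: Tc0_def Let_def)

lemma Obj_Tc0D:
  assumes "X \<in> Obj (Tc0 P)"
  shows "under X \<in> Obj P" "pred X \<in> carrier (fib P (under X))" "Ext (under X) (pred X) = X"
  using assms Obj_Tc0_iff[of X P] by auto

lemma Hom_Tc0D:
  assumes "f \<in> Hom (Tc0 P) X Y"
  shows "X \<in> Obj (Tc0 P)" "Y \<in> Obj (Tc0 P)" "f \<in> Hom P (under X) (under Y)"
    "pred X \<sqsubseteq>\<^bsub>fib P (under X)\<^esub> sub P (under X) (under Y) f (pred Y)"
  using assms by (simp_all add: Hom_Tc0_iff)

lemma carrier_Tc0D:
  assumes "x \<in> carrier (fib (Tc0 P) X)"
  shows "x \<in> carrier (fib P (under X))" "x \<sqsubseteq>\<^bsub>fib P (under X)\<^esub> pred X"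
  using assms by (simp_all add: carrier_Tc0_iff)

text \<open>Objects of the completion are built with the constructor \<open>Ext\<close>, which fixes the type of the
  objects of the doctrine that is completed.\<close>
locale obj_doctrine = doctrine P
  for P :: "('b, 'a, 'e) cdoctrine"
begin

lemma Tc0_fib_infsl:
  assumes X: "X \<in> Obj (Tc0 P)"
  shows "infsl (fib (Tc0 P) X)"
proof (rule infslI[where m = "\<lambda>x y. x \<sqinter>\<^bsub>fib P (under X)\<^esub> y" and t = "pred X"])
  note A = Obj_Tc0D(1)[OF X] and \<alpha> = Obj_Tc0D(2)[OF X]
  interpret po: partial_order "fib P (under X)" by (rule fib_po[OF A])
  have eq: "eq (fib (Tc0 P) X) = (=)" by (simp add: Tc0_def Let_def)
  show "partial_order (fib (Tc0 P) X)"
  proof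
    show "(.=\<^bsub>fib (Tc0 P) X\<^esub>) = (=)" by (rule eq)
    show "x \<sqsubseteq>\<^bsub>fib (Tc0 P) X\<^esub> z" if "x \<sqsubseteq>\<^bsub>fib (Tc0 P) X\<^esub> y" "y \<sqsubseteq>\<^bsub>fib (Tc0 P) X\<^esub> z"
      "x \<in> carrier (fib (Tc0 P) X)" "y \<in> carrier (fib (Tc0 P) X)" "z \<in> carrier (fib (Tc0 P) X)" for x y z
      using that fib_le_trans[OF A, of x y z] by (simp add: Tc0_sel carrier_Tc0_iff)
    show "x .=\<^bsub>fib (Tc0 P) X\<^esub> y" if "x \<sqsubseteq>\<^bsub>fib (Tc0 P) X\<^esub> y" "y \<sqsubseteq>\<^bsub>fib (Tc0 P) X\<^esub> x"
      "x \<in> carrier (fib (Tc0 P) X)" "y \<in> carrier (fib (Tc0 P) X)" for x y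
      using that fib_le_antisym[OF A, of x y] by (simp add: Tc0_sel carrier_Tc0_iff eq)
  qed (auto simp: eq Tc0_sel carrier_Tc0_iff)
  fix x y assume xy: "x \<in> carrier (fib (Tc0 P) X)" "y \<in> carrier (fib (Tc0 P) X)"
  note x = carrier_Tc0D[OF xy(1)] and y = carrier_Tc0D[OF xy(2)]
  have m: "x \<sqinter>\<^bsub>fib P (under X)\<^esub> y \<in> carrier (fib P (under X))" by (rule fib_meet[OF A x(1) y(1)])
  show "x \<sqinter>\<^bsub>fib P (under X)\<^esub> y \<in> carrier (fib (Tc0 P) X) \<and>
      x \<sqinter>\<^bsub>fib P (under X)\<^esub> y \<sqsubseteq>\<^bsub>fib (Tc0 P) X\<^esub> x \<and> x \<sqinter>\<^bsub>fib P (under X)\<^esub> y \<sqsubseteq>\<^bsub>fib (Tc0 P) X\<^esub> y"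
    using fib_le_trans[OF A fib_meet_left[OF A x(1) y(1)] x(2) m x(1) \<alpha>] m
      fib_meet_left[OF A x(1) y(1)] fib_meet_right[OF A x(1) y(1)]
    by (simp add: Tc0_sel carrier_Tc0_iff)
  show "z \<sqsubseteq>\<^bsub>fib (Tc0 P) X\<^esub> x \<sqinter>\<^bsub>fib P (under X)\<^esub> y"
    if "z \<in> carrier (fib (Tc0 P) X)" "z \<sqsubseteq>\<^bsub>fib (Tc0 P) X\<^esub> x" "z \<sqsubseteq>\<^bsub>fib (Tc0 P) X\<^esub> y" for z
    using that fib_le_meet_iff[OF A x(1) y(1), of z] by (simp add: Tc0_sel carrier_Tc0_iff)
next
  note A = Obj_Tc0D(1)[OF X] and \<alpha> = Obj_Tc0D(2)[OF X]
  show "pred X \<in> carrier (fib (Tc0 P) X)"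
    by (simp add: carrier_Tc0_iff \<alpha> fib_le_refl[OF A \<alpha>])
  show "x \<sqsubseteq>\<^bsub>fib (Tc0 P) X\<^esub> pred X" if "x \<in> carrier (fib (Tc0 P) X)" for x
    using that by (simp add: Tc0_sel carrier_Tc0_iff)
qed

text \<open>Meets and top elements are chosen separately in each poset, so those of the completion have to
  be identified; the top element over \<open>(A, \<alpha>)\<close> is \<open>\<alpha>\<close>.\<close>
lemma Tc0_meet:
  assumes X: "X \<in> Obj (Tc0 P)" and x: "x \<in> carrier (fib (Tc0 P) X)" and y: "y \<in> carrier (fib (Tc0 P) X)"
  shows "x \<sqinter>\<^bsub>fib (Tc0 P) X\<^esub> y = x \<sqinter>\<^bsub>fib P (under X)\<^esub> y"
proof (rule infsl.meet_unique[OF Tc0_fib_infsl[OF X] x y])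
  note A = Obj_Tc0D(1)[OF X] and \<alpha> = Obj_Tc0D(2)[OF X]
  note x' = carrier_Tc0D[OF x] and y' = carrier_Tc0D[OF y]
  have m: "x \<sqinter>\<^bsub>fib P (under X)\<^esub> y \<in> carrier (fib P (under X))" by (rule fib_meet[OF A x'(1) y'(1)])
  show "x \<sqinter>\<^bsub>fib P (under X)\<^esub> y \<in> carrier (fib (Tc0 P) X)"
    using fib_le_trans[OF A fib_meet_left[OF A x'(1) y'(1)] x'(2) m x'(1) \<alpha>] m
    by (simp add: carrier_Tc0_iff)
  show "x \<sqinter>\<^bsub>fib P (under X)\<^esub> y \<sqsubseteq>\<^bsub>fib (Tc0 P) X\<^esub> x" "x \<sqinter>\<^bsub>fib P (under X)\<^esub> y \<sqsubseteq>\<^bsub>fib (Tc0 P) X\<^esub> y"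
    using fib_meet_left[OF A x'(1) y'(1)] fib_meet_right[OF A x'(1) y'(1)] by (simp_all add: Tc0_sel)
  show "w \<sqsubseteq>\<^bsub>fib (Tc0 P) X\<^esub> x \<sqinter>\<^bsub>fib P (under X)\<^esub> y"
    if "w \<in> carrier (fib (Tc0 P) X)" "w \<sqsubseteq>\<^bsub>fib (Tc0 P) X\<^esub> x" "w \<sqsubseteq>\<^bsub>fib (Tc0 P) X\<^esub> y" for w
    using that fib_le_meet_iff[OF A x'(1) y'(1), of w] by (simp add: Tc0_sel carrier_Tc0_iff)
qed

lemma Tc0_top:
  assumes X: "X \<in> Obj (Tc0 P)"
  shows "\<top>\<^bsub>fib (Tc0 P) X\<^esub> = pred X"
  by (rule infsl.top_unique[OF Tc0_fib_infsl[OF X]])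
    (simp_all add: carrier_Tc0_iff Tc0_sel Obj_Tc0D[OF X] fib_le_refl)

lemma meet_pred_closed:
  assumes X: "X \<in> Obj (Tc0 P)" and x: "x \<in> carrier (fib P (under X))"
  shows "x \<sqinter>\<^bsub>fib P (under X)\<^esub> pred X \<in> carrier (fib (Tc0 P) X)"
  using Obj_Tc0D[OF X] x by (simp add: carrier_Tc0_iff fib_meet fib_meet_right)

text \<open>Reindexing in the completion truncates by the predicate of the source. As an arrow carries
  the predicate of its source into that of its target, truncating by the latter beforehand makes no
  difference. Functoriality of reindexing and the computations with equality predicates rest on
  this.\<close>
lemma sub_meet_pred_absorb:
  assumes f: "f \<in> Hom (Tc0 P) X Y" and x: "x \<in> carrier (fib P (under Y))"
  shows "sub P (under X) (under Y) f (x \<sqinter>\<^bsub>fib P (under Y)\<^esub> pred Y) \<sqinter>\<^bsub>fib P (under X)\<^esub> pred X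
    = sub P (under X) (under Y) f x \<sqinter>\<^bsub>fib P (under X)\<^esub> pred X"
proof -
  note f' = Hom_Tc0D[OF f]
  note X = Obj_Tc0D[OF f'(1)] and Y = Obj_Tc0D[OF f'(2)]
  note fY = sub_closed[OF f'(3) Y(2)]
  have "sub P (under X) (under Y) f (pred Y) \<sqinter>\<^bsub>fib P (under X)\<^esub> pred X = pred X"
    using f'(4) unfolding fib_le_iff_meet[OF X(1,2) fY] meet_comm[of _ "pred X"] .
  then show ?thesis
    by (simp add: sub_meet[OF f'(3) x Y(2)] fib_meet_assoc[OF X(1) sub_closed[OF f'(3) x] fY X(2)])
qed

lemma Tc0_Idt_Hom:
  assumes X: "X \<in> Obj (Tc0 P)"
  shows "Idt P (under X) \<in> Hom (Tc0 P) X X"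
  using Obj_Tc0D[OF X] X by (simp add: Hom_Tc0_iff Idt_Hom sub_Idt fib_le_refl)

lemma Tc0_Cmp_Hom:
  assumes f: "f \<in> Hom (Tc0 P) X Y" and g: "g \<in> Hom (Tc0 P) Y Z"
  shows "Cmp P (under X) (under Y) (under Z) g f \<in> Hom (Tc0 P) X Z"
proof -
  note f' = Hom_Tc0D[OF f] and g' = Hom_Tc0D[OF g]
  note X = Obj_Tc0D[OF f'(1)] and Y = Obj_Tc0D[OF f'(2)] and Z = Obj_Tc0D[OF g'(2)]
  note gZ = sub_closed[OF g'(3) Z(2)]
  have "pred X \<sqsubseteq>\<^bsub>fib P (under X)\<^esub> sub P (under X) (under Y) f (sub P (under Y) (under Z) g (pred Z))"
    by (rule fib_le_trans[OF X(1) f'(4) sub_mono[OF f'(3) g'(4) Y(2) gZ] X(2)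
          sub_closed[OF f'(3) Y(2)] sub_closed[OF f'(3) gZ]])
  then show ?thesis
    using f' g' by (simp add: Hom_Tc0_iff Cmp_Hom[OF f'(3) g'(3)] sub_Cmp[OF f'(3) g'(3) Z(2)])
qed

text \<open>This lemma and \<open>is_product_Tc0D\<close> below describe all products of \<open>(A, \<alpha>)\<close> and \<open>(B, \<beta>)\<close>: they
  lie over products of \<open>A\<close> and \<open>B\<close> and carry the meet of the reindexed predicates. The
  description covers arbitrary products, not only the chosen ones, because 1-cells must preserve
  every product.\<close>
lemma is_product_Tc0I:
  assumes XY: "X \<in> Obj (Tc0 P)" "Y \<in> Obj (Tc0 P)" and W: "W \<in> Obj (Tc0 P)"
    and prod: "is_product P (under X) (under Y) (under W) p q"
    and pred: "pred W = sub P (under W) (under X) p (pred X) \<sqinter>\<^bsub>fib P (under W)\<^esub>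
      sub P (under W) (under Y) q (pred Y)"
  shows "is_product (Tc0 P) X Y W p q"
proof -
  note X = Obj_Tc0D[OF XY(1)] and Y = Obj_Tc0D[OF XY(2)] and W' = Obj_Tc0D[OF W]
  have p: "p \<in> Hom P (under W) (under X)" and q: "q \<in> Hom P (under W) (under Y)"
    using prod by (auto simp: is_product_def)
  note pX = sub_closed[OF p X(2)] and qY = sub_closed[OF q Y(2)]
  have "p \<in> Hom (Tc0 P) W X" "q \<in> Hom (Tc0 P) W Y"
    by (simp_all add: Hom_Tc0_iff XY W p q) (simp_all add: pred fib_meet_left[OF W'(1) pX qY] fib_meet_right[OF W'(1) pX qY])
  moreover have "\<exists>!h. h \<in> Hom (Tc0 P) Z W \<and> Cmp (Tc0 P) Z W X p h = f \<and> Cmp (Tc0 P) Z W Y q h = g"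
    if Z: "Z \<in> Obj (Tc0 P)" and f: "f \<in> Hom (Tc0 P) Z X" and g: "g \<in> Hom (Tc0 P) Z Y" for Z f g
  proof -
    note Z' = Obj_Tc0D[OF Z] and f' = Hom_Tc0D[OF f] and g' = Hom_Tc0D[OF g]
    have ex: "\<exists>!h. h \<in> Hom P (under Z) (under W) \<and> Cmp P (under Z) (under W) (under X) p h = f \<and>
        Cmp P (under Z) (under W) (under Y) q h = g"
      using prod Z'(1) f'(3) g'(3) by (simp add: is_product_def)
    have "h \<in> Hom (Tc0 P) Z W"
      if h: "h \<in> Hom P (under Z) (under W)" and "Cmp P (under Z) (under W) (under X) p h = f"
        "Cmp P (under Z) (under W) (under Y) q h = g" for h
      using that f' g' sub_closed[OF h pX] sub_closed[OF h qY] sub_Cmp[OF h p X(2)] sub_Cmp[OF h q Y(2)]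
      by (simp add: Hom_Tc0_iff Z W pred sub_meet[OF h pX qY] fib_le_meet_iff[OF Z'(1)] Z'(2))
    then show ?thesis
      using ex by (auto simp: Tc0_sel Hom_Tc0_iff)
  qed
  ultimately show ?thesis
    using XY W by (simp add: is_product_def)
qed

lemma Tc0_Prd_product:
  assumes X: "X \<in> Obj (Tc0 P)" and Y: "Y \<in> Obj (Tc0 P)"
  shows "is_product (Tc0 P) X Y (Prd (Tc0 P) X Y) (Pr1 (Tc0 P) X Y) (Pr2 (Tc0 P) X Y)"
proof -
  note X' = Obj_Tc0D[OF X] and Y' = Obj_Tc0D[OF Y]
  have "Prd (Tc0 P) X Y \<in> Obj (Tc0 P)"
    unfolding Obj_Tc0_iff Tc0_sel(3,4) using X' Y'
    by (auto simp: Prd_Obj fib_meet sub_closed[OF Pr1_Hom] sub_closed[OF Pr2_Hom]) (simp add: Tc0_def Let_def)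
  then show ?thesis
    by (rule is_product_Tc0I[OF X Y]) (simp_all add: Tc0_sel Prd_product X' Y')
qed

lemma Tc0_doctrine: "doctrine (Tc0 P)"
proof (intro doctrine.intro product_category.intro doctrine_axioms.intro)
  show "A \<in> Obj (Tc0 P) \<and> B \<in> Obj (Tc0 P)" if "f \<in> Hom (Tc0 P) A B" for f A B
    using that by (simp add: Hom_Tc0_iff)
  show "Idt (Tc0 P) A \<in> Hom (Tc0 P) A A" if "A \<in> Obj (Tc0 P)" for A
    using Tc0_Idt_Hom[OF that] by (simp add: Tc0_sel)
  show "Cmp (Tc0 P) X Y Z g f \<in> Hom (Tc0 P) X Z"
    if "f \<in> Hom (Tc0 P) X Y" "g \<in> Hom (Tc0 P) Y Z" for f g X Y Z
    using Tc0_Cmp_Hom[OF that] by (simp add: Tc0_sel)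
  show "Cmp (Tc0 P) X Y Y (Idt (Tc0 P) Y) f = f" "Cmp (Tc0 P) X X Y f (Idt (Tc0 P) X) = f"
    if "f \<in> Hom (Tc0 P) X Y" for f X Y
    using Hom_Tc0D(3)[OF that] by (simp_all add: Tc0_sel Cmp_Idt_left Cmp_Idt_right)
  show "Cmp (Tc0 P) X Y W (Cmp (Tc0 P) Y Z W h g) f = Cmp (Tc0 P) X Z W h (Cmp (Tc0 P) X Y Z g f)"
    if "f \<in> Hom (Tc0 P) X Y" "g \<in> Hom (Tc0 P) Y Z" "h \<in> Hom (Tc0 P) Z W" for f g h X Y Z W
    unfolding Tc0_sel by (rule Cmp_assoc[OF that[THEN Hom_Tc0D(3)]])
  show "infsl_hom (fib (Tc0 P) B) (fib (Tc0 P) A) (sub (Tc0 P) A B f)" if f: "f \<in> Hom (Tc0 P) A B" for f A B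
  proof -
    note f' = Hom_Tc0D[OF f]
    note A = Obj_Tc0D[OF f'(1)] and B = Obj_Tc0D[OF f'(2)]
    note fB = sub_closed[OF f'(3) B(2)]
    have "sub P (under A) (under B) f (pred B) \<sqinter>\<^bsub>fib P (under A)\<^esub> pred A = pred A"
      using f'(4) unfolding fib_le_iff_meet[OF A(1,2) fB] meet_comm[of _ "pred A"] .
    moreover have "sub P (under A) (under B) f x \<sqinter>\<^bsub>fib P (under A)\<^esub> pred A \<in> carrier (fib (Tc0 P) A)"
      if "x \<in> carrier (fib P (under B))" for x
      by (rule meet_pred_closed[OF f'(1) sub_closed[OF f'(3) that]])
    moreover have "(u \<sqinter>\<^bsub>fib P (under A)\<^esub> v) \<sqinter>\<^bsub>fib P (under A)\<^esub> pred A =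
        (u \<sqinter>\<^bsub>fib P (under A)\<^esub> pred A) \<sqinter>\<^bsub>fib P (under A)\<^esub> (v \<sqinter>\<^bsub>fib P (under A)\<^esub> pred A)"
      if "u \<in> carrier (fib P (under A))" "v \<in> carrier (fib P (under A))" for u v
      using that A by (simp add: fib_meet_ac fib_meet)
    ultimately show ?thesis
      by (simp add: infsl_hom_def Tc0_top f' Tc0_sel Tc0_meet carrier_Tc0D sub_meet[OF f'(3)] sub_closed[OF f'(3)])
  qed
  show "sub (Tc0 P) A A (Idt (Tc0 P) A) x = x" if A: "A \<in> Obj (Tc0 P)" and x: "x \<in> carrier (fib (Tc0 P) A)" for A x
    using fib_le_iff_meet[OF Obj_Tc0D(1)[OF A] carrier_Tc0D(1)[OF x] Obj_Tc0D(2)[OF A]] carrier_Tc0D[OF x]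
    by (simp add: Tc0_sel sub_Idt[OF Obj_Tc0D(1)[OF A] carrier_Tc0D(1)[OF x]])
  show "sub (Tc0 P) X Z (Cmp (Tc0 P) X Y Z g f) x = sub (Tc0 P) X Y f (sub (Tc0 P) Y Z g x)"
    if f: "f \<in> Hom (Tc0 P) X Y" and g: "g \<in> Hom (Tc0 P) Y Z" and x: "x \<in> carrier (fib (Tc0 P) Z)" for f X Y g Z x
  proof -
    note f' = Hom_Tc0D[OF f] and g' = Hom_Tc0D[OF g] and x' = carrier_Tc0D(1)[OF x]
    show ?thesis
      by (simp add: Tc0_sel sub_Cmp[OF f'(3) g'(3) x'] sub_meet_pred_absorb[OF f sub_closed[OF g'(3) x']])
  qed
qed (fact Tc0_Prd_product Tc0_fib_infsl)+

text \<open>Let \<open>\<omega>\<close> be the meet of the reindexed predicates. The projections are also arrows out of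
  \<open>(W, \<omega>)\<close>, so they induce an arrow from \<open>(W, \<omega>)\<close> to the product, which uniqueness forces to be the
  identity of the underlying object; hence \<open>\<omega>\<close> lies below the predicate of the product. Universality
  in the base category follows by equipping a test object with the meet of the predicates
  reindexed along the two given arrows: then every arrow with these components is an arrow of the
  completion.\<close>
lemma is_product_Tc0D:
  assumes prod: "is_product (Tc0 P) X Y W p q"
  shows "is_product P (under X) (under Y) (under W) p q"
    and "pred W = sub P (under W) (under X) p (pred X) \<sqinter>\<^bsub>fib P (under W)\<^esub>
      sub P (under W) (under Y) q (pred Y)"
proof -
  interpret Q: doctrine "Tc0 P" by (rule Tc0_doctrine)
  let ?A = "under X" and ?B = "under Y" and ?C = "under W"
  have XYW: "X \<in> Obj (Tc0 P)" "Y \<in> Obj (Tc0 P)" "W \<in> Obj (Tc0 P)"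
    and pq: "p \<in> Hom (Tc0 P) W X" "q \<in> Hom (Tc0 P) W Y"
    using prod by (auto simp: is_product_def)
  note X = Obj_Tc0D[OF XYW(1)] and Y = Obj_Tc0D[OF XYW(2)] and W = Obj_Tc0D[OF XYW(3)]
  note p = Hom_Tc0D[OF pq(1)] and q = Hom_Tc0D[OF pq(2)]
  note pX = sub_closed[OF p(3) X(2)] and qY = sub_closed[OF q(3) Y(2)]
  define \<omega> where "\<omega> = sub P ?C ?A p (pred X) \<sqinter>\<^bsub>fib P ?C\<^esub> sub P ?C ?B q (pred Y)"
  have \<omega>: "\<omega> \<in> carrier (fib P ?C)" unfolding \<omega>_def by (rule fib_meet[OF W(1) pX qY])
  have le: "pred W \<sqsubseteq>\<^bsub>fib P ?C\<^esub> \<omega>"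
    using p(4) q(4) by (simp add: \<omega>_def fib_le_meet_iff[OF W(1) pX qY W(2)])
  let ?W' = "Ext ?C \<omega>"
  have W': "?W' \<in> Obj (Tc0 P)" using W(1) \<omega> by (simp add: Obj_Tc0_iff)
  have p': "p \<in> Hom (Tc0 P) ?W' X" and q': "q \<in> Hom (Tc0 P) ?W' Y"
    using fib_meet_left[OF W(1) pX qY] fib_meet_right[OF W(1) pX qY]
    by (simp_all add: Hom_Tc0_iff W' XYW p q \<omega>_def[symmetric])
  have "\<exists>!h. h \<in> Hom (Tc0 P) ?W' W \<and> Cmp (Tc0 P) ?W' W X p h = p \<and> Cmp (Tc0 P) ?W' W Y q h = q"
    using prod W' p' q' unfolding is_product_def by blast
  then obtain h where h: "h \<in> Hom (Tc0 P) ?W' W" "Cmp P ?C ?C ?A p h = p" "Cmp P ?C ?C ?B q h = q"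
    by (auto simp: Tc0_sel)
  have "Idt P ?C \<in> Hom (Tc0 P) W ?W'"
    by (simp add: Hom_Tc0_iff XYW W' Idt_Hom[OF W(1)] sub_Idt[OF W(1) \<omega>] le)
  from Tc0_Cmp_Hom[OF this h(1)] have hWW: "h \<in> Hom (Tc0 P) W W"
    using Hom_Tc0D(3)[OF h(1)] by (simp add: Cmp_Idt_right)
  have "h = Idt P ?C"
    by (rule Q.is_product_unique[OF prod hWW Tc0_Idt_Hom[OF XYW(3)]])
      (simp_all add: Tc0_sel h Cmp_Idt_right[OF p(3)] Cmp_Idt_right[OF q(3)])
  then have "\<omega> \<sqsubseteq>\<^bsub>fib P ?C\<^esub> pred W"
    using Hom_Tc0D(4)[OF h(1)] by (simp add: sub_Idt[OF W(1,2)])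
  then have \<omega>_eq: "pred W = \<omega>"
    using le by (intro fib_le_antisym[OF W(1)] W \<omega>)
  then show "pred W = sub P ?C ?A p (pred X) \<sqinter>\<^bsub>fib P ?C\<^esub> sub P ?C ?B q (pred Y)"
    by (simp add: \<omega>_def)
  have "\<exists>!h. h \<in> Hom P Z ?C \<and> Cmp P Z ?C ?A p h = f \<and> Cmp P Z ?C ?B q h = g"
    if Z: "Z \<in> Obj P" and f: "f \<in> Hom P Z ?A" and g: "g \<in> Hom P Z ?B" for Z f g
  proof -
    note fX = sub_closed[OF f X(2)] and gY = sub_closed[OF g Y(2)]
    let ?Z = "Ext Z (sub P Z ?A f (pred X) \<sqinter>\<^bsub>fib P Z\<^esub> sub P Z ?B g (pred Y))"
    have Z': "?Z \<in> Obj (Tc0 P)" by (simp add: Obj_Tc0_iff Z fib_meet[OF Z fX gY])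
    have "f \<in> Hom (Tc0 P) ?Z X" "g \<in> Hom (Tc0 P) ?Z Y"
      by (simp_all add: Hom_Tc0_iff Z' XYW f g fib_meet_left[OF Z fX gY] fib_meet_right[OF Z fX gY])
    then have "\<exists>!h. h \<in> Hom (Tc0 P) ?Z W \<and> Cmp (Tc0 P) ?Z W X p h = f \<and> Cmp (Tc0 P) ?Z W Y q h = g"
      using prod Z' unfolding is_product_def by blast
    then have "\<exists>!h. h \<in> Hom (Tc0 P) ?Z W \<and> Cmp P Z ?C ?A p h = f \<and> Cmp P Z ?C ?B q h = g"
      by (simp add: Tc0_sel)
    moreover have "h \<in> Hom (Tc0 P) ?Z W"
      if h: "h \<in> Hom P Z ?C" and "Cmp P Z ?C ?A p h = f" "Cmp P Z ?C ?B q h = g" for h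
    proof -
      have "sub P Z ?C h (pred W) = pred ?Z"
        using that sub_Cmp[OF h p(3) X(2)] sub_Cmp[OF h q(3) Y(2)]
        by (simp add: \<omega>_eq \<omega>_def sub_meet[OF h pX qY])
      then show ?thesis
        using h Z' XYW(3) fib_le_refl[OF Z fib_meet[OF Z fX gY]] by (simp add: Hom_Tc0_iff)
    qed
    ultimately show ?thesis
      by (auto simp: Hom_Tc0_iff)
  qed
  then show "is_product P ?A ?B ?C p q"
    using X(1) Y(1) W(1) p(3) q(3) by (simp add: is_product_def)
qed

lemma Tc0_Pair_arr:
  assumes f: "f \<in> Hom (Tc0 P) Z X" and g: "g \<in> Hom (Tc0 P) Z Y"
  shows "Pair_arr (Tc0 P) Z X Y f g = Pair_arr P (under Z) (under X) (under Y) f g"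
proof -
  interpret Q: doctrine "Tc0 P" by (rule Tc0_doctrine)
  note X = Obj_Tc0D[OF Hom_Tc0D(2)[OF f]] and Y = Obj_Tc0D[OF Hom_Tc0D(2)[OF g]]
  note h = Q.Pair_arr_Hom[OF f g] and h1 = Q.Pr1_Pair_arr[OF f g] and h2 = Q.Pr2_Pair_arr[OF f g]
  show ?thesis
    by (rule Pair_arr_unique[symmetric])
      (use Hom_Tc0D(3)[OF h] h1 h2 X Y in \<open>simp_all add: Tc0_sel\<close>)
qed

text \<open>Why the equality predicates survive the completion: a left adjoint of the form
  \<open>x \<mapsto> P\<^sub>p x \<sqinter> d\<close> to reindexing along \<open>e\<close> sends everything below \<open>v\<close> to something below \<open>w\<close>, as
  soon as \<open>e\<close> carries \<open>v\<close> into \<open>w\<close>. The truncations by \<open>w\<close> in the completion then change nothing, and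
  the adjunction restricts to the elements below \<open>v\<close> and \<open>w\<close>. Both adjunctions that define an
  equality predicate have this form.\<close>
lemma adjunction_restrict:
  assumes p: "p \<in> Hom P W V" and e: "e \<in> Hom P V W"
    and v: "v \<in> carrier (fib P V)" and w: "w \<in> carrier (fib P W)" and d: "d \<in> carrier (fib P W)"
    and ve: "v \<sqsubseteq>\<^bsub>fib P V\<^esub> sub P V W e w"
    and adj: "\<And>x y. \<lbrakk>x \<in> carrier (fib P V); y \<in> carrier (fib P W)\<rbrakk> \<Longrightarrow>
      sub P W V p x \<sqinter>\<^bsub>fib P W\<^esub> d \<sqsubseteq>\<^bsub>fib P W\<^esub> y \<longleftrightarrow> x \<sqsubseteq>\<^bsub>fib P V\<^esub> sub P V W e y"
    and x: "x \<in> carrier (fib P V)" and xv: "x \<sqsubseteq>\<^bsub>fib P V\<^esub> v" and y: "y \<in> carrier (fib P W)"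
  shows "(sub P W V p x \<sqinter>\<^bsub>fib P W\<^esub> w) \<sqinter>\<^bsub>fib P W\<^esub> (d \<sqinter>\<^bsub>fib P W\<^esub> w) \<sqsubseteq>\<^bsub>fib P W\<^esub> y \<longleftrightarrow>
    x \<sqsubseteq>\<^bsub>fib P V\<^esub> sub P V W e y \<sqinter>\<^bsub>fib P V\<^esub> v"
proof -
  note V = Hom_ObjD(1)[OF e] and W = Hom_ObjD(2)[OF e]
  note px = sub_closed[OF p x] and ew = sub_closed[OF e w] and ey = sub_closed[OF e y]
  have "x \<sqsubseteq>\<^bsub>fib P V\<^esub> sub P V W e w" by (rule fib_le_trans[OF V xv ve x v ew])
  then have le: "sub P W V p x \<sqinter>\<^bsub>fib P W\<^esub> d \<sqsubseteq>\<^bsub>fib P W\<^esub> w" by (simp add: adj[OF x w])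
  have "(sub P W V p x \<sqinter>\<^bsub>fib P W\<^esub> w) \<sqinter>\<^bsub>fib P W\<^esub> (d \<sqinter>\<^bsub>fib P W\<^esub> w)
      = (sub P W V p x \<sqinter>\<^bsub>fib P W\<^esub> d) \<sqinter>\<^bsub>fib P W\<^esub> w"
    using W px w d by (simp add: fib_meet_ac fib_meet)
  also have "\<dots> = sub P W V p x \<sqinter>\<^bsub>fib P W\<^esub> d"
    using le fib_le_iff_meet[OF W fib_meet[OF W px d] w] by simp
  finally show ?thesis
    by (simp add: adj[OF x y] fib_le_meet_iff[OF V ey v x] xv)
qed

end

locale obj_elementary_doctrine = elementary_doctrine P
  for P :: "('b, 'a, 'e) cdoctrine"
begin

sublocale obj_doctrine ..

lemma Tc0_is_delta:
  assumes X: "X \<in> Obj (Tc0 P)"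
  shows "is_delta (Tc0 P) X
    (delta P (under X) \<sqinter>\<^bsub>fib P (Prd P (under X) (under X))\<^esub> pred (Prd (Tc0 P) X X))"
proof -
  interpret Q: doctrine "Tc0 P" by (rule Tc0_doctrine)
  let ?Q = "Tc0 P" and ?A = "under X"
  let ?XX = "Prd ?Q X X" and ?AA = "Prd P ?A ?A"
  note A = Obj_Tc0D(1)[OF X] and XX = Q.Prd_Obj[OF X X]
  note AA = Prd_Obj[OF A A] and \<alpha>\<alpha> = Obj_Tc0D(2)[OF XX, unfolded Tc0_sel(3)]
  note \<delta> = delta_closed[OF A] and is\<delta> = delta_is_delta[OF A]
  let ?d = "delta P ?A \<sqinter>\<^bsub>fib P ?AA\<^esub> pred ?XX"
  have d: "?d \<in> carrier (fib ?Q ?XX)"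
    using meet_pred_closed[OF XX, unfolded Tc0_sel(3), OF \<delta>] .
  have "is_delta1 ?Q X ?d"
    unfolding Q.is_delta1_iff[OF X d]
  proof (intro ballI)
    fix x y assume x: "x \<in> carrier (fib ?Q X)" and y: "y \<in> carrier (fib ?Q ?XX)"
    note D = Q.diag_Hom[OF X] and p = Q.Pr1_Hom[OF X X]
    note D' = Hom_Tc0D[OF D, unfolded Tc0_sel] and p' = Hom_Tc0D[OF p, unfolded Tc0_sel]
    have diag: "Q.diag X = diag ?A"
      using Tc0_Pair_arr[OF Q.Idt_Hom[OF X] Q.Idt_Hom[OF X]] by (simp add: Tc0_sel)
    note x' = carrier_Tc0D[OF x] and y' = carrier_Tc0D[OF y, unfolded Tc0_sel(3)]
    have "is_delta1 P ?A (delta P ?A)" using is\<delta> by (simp add: is_delta_def)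
    note adj = this[unfolded is_delta1_iff[OF A \<delta>], rule_format]
    have "Q.diag X \<in> Hom P ?A ?AA" using diag diag_Hom[OF A] by simp
    show "sub ?Q ?XX X (Pr1 ?Q X X) x \<sqinter>\<^bsub>fib ?Q ?XX\<^esub> ?d \<sqsubseteq>\<^bsub>fib ?Q ?XX\<^esub> y \<longleftrightarrow>
        x \<sqsubseteq>\<^bsub>fib ?Q X\<^esub> sub ?Q X ?XX (Q.diag X) y"
      unfolding Tc0_meet[OF XX Q.sub_closed[OF p x] d]
      unfolding Tc0_sel(1-3,5-8) diag[unfolded Tc0_sel]
      by (rule adjunction_restrict[OF Pr1_Hom[OF A A] diag_Hom[OF A] Obj_Tc0D(2)[OF X] \<alpha>\<alpha> \<delta> _ adj x' y'(1)])
        (use Hom_Tc0D(4)[OF D] diag in \<open>simp_all add: Tc0_sel(3)\<close>)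
  qed
  moreover have "is_delta2 ?Q X ?d Z" if Z: "Z \<in> Obj ?Q" for Z
    unfolding Q.is_delta2_iff[OF X d Z]
  proof (intro ballI)
    let ?C = "under Z" and ?ZX = "Prd ?Q Z X"
    let ?ZXX = "Prd ?Q ?ZX X" and ?CA = "Prd P ?C ?A"
    let ?CAA = "Prd P ?CA ?A"
    note C = Obj_Tc0D(1)[OF Z] and ZX = Q.Prd_Obj[OF Z X]
    note ZXX = Q.Prd_Obj[OF ZX X] and CA = Prd_Obj[OF C A]
    note CAA = Prd_Obj[OF CA A]
    fix x y assume x: "x \<in> carrier (fib ?Q ?ZX)" and y: "y \<in> carrier (fib ?Q ?ZXX)"
    note x' = carrier_Tc0D[OF x, unfolded Tc0_sel(3)] and y' = carrier_Tc0D[OF y, unfolded Tc0_sel(3)]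
    note e = Q.param_diag_Hom[OF Z X] and t = Q.triple_proj_Hom[OF Z X] and p = Q.Pr1_Hom[OF ZX X]
    note t0 = triple_proj_Hom[OF C A]
    have e_eq: "Q.param_diag Z X = param_diag ?C ?A"
      using Tc0_Pair_arr[OF Q.Idt_Hom[OF ZX] Q.Pr2_Hom[OF Z X]] by (simp add: Tc0_sel)
    have t_eq: "Q.triple_proj Z X = triple_proj ?C ?A"
      using Tc0_Pair_arr[OF Q.Cmp_Hom[OF Q.Pr1_Hom[OF ZX X] Q.Pr2_Hom[OF Z X]] Q.Pr2_Hom[OF ZX X]]
      by (simp add: Tc0_sel)
    note \<omega> = Obj_Tc0D(2)[OF ZXX, unfolded Tc0_sel(3)] and \<zeta>\<alpha> = Obj_Tc0D(2)[OF ZX, unfolded Tc0_sel(3)]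
    note t\<delta> = sub_closed[OF t0 \<delta>]
    have td: "sub P ?CAA ?AA (triple_proj ?C ?A) ?d \<sqinter>\<^bsub>fib P ?CAA\<^esub> pred ?ZXX
        = sub P ?CAA ?AA (triple_proj ?C ?A) (delta P ?A) \<sqinter>\<^bsub>fib P ?CAA\<^esub> pred ?ZXX"
      using sub_meet_pred_absorb[OF t, unfolded t_eq Tc0_sel(3), OF \<delta>] .
    have "is_delta2 P ?A (delta P ?A) ?C" using is\<delta> C by (simp add: is_delta_def)
    note adj = this[unfolded is_delta2_iff[OF A \<delta> C], rule_format]
    show "sub ?Q ?ZXX ?ZX (Pr1 ?Q ?ZX X) x \<sqinter>\<^bsub>fib ?Q ?ZXX\<^esub>
          sub ?Q ?ZXX ?XX (Q.triple_proj Z X) ?d \<sqsubseteq>\<^bsub>fib ?Q ?ZXX\<^esub> y \<longleftrightarrow>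
        x \<sqsubseteq>\<^bsub>fib ?Q ?ZX\<^esub> sub ?Q ?ZX ?ZXX (Q.param_diag Z X) y"
      unfolding Tc0_meet[OF ZXX Q.sub_closed[OF p x] Q.sub_closed[OF t d]]
      unfolding t_eq e_eq
      unfolding Tc0_sel(1-3,5-8) td
      by (rule adjunction_restrict[OF Pr1_Hom[OF CA A] param_diag_Hom[OF C A] \<zeta>\<alpha> \<omega> t\<delta> _ adj x' y'(1)])
        (use Hom_Tc0D(4)[OF e] in \<open>simp_all add: Tc0_sel(3) e_eq[symmetric]\<close>)
  qed
  ultimately show ?thesis
    using d by (simp add: is_delta_def)
qed

lemma Tc0_elementary: "elementary_doctrine (Tc0 P)"
  using Tc0_doctrine Tc0_is_delta
  by (auto simp: elementary_doctrine_def elementary_doctrine_axioms_def)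

lemma Tc0_delta:
  assumes X: "X \<in> Obj (Tc0 P)"
  shows "delta (Tc0 P) X =
    delta P (under X) \<sqinter>\<^bsub>fib P (Prd P (under X) (under X))\<^esub> pred (Prd (Tc0 P) X X)"
  by (rule doctrine.delta_eq[OF Tc0_doctrine X Tc0_is_delta[OF X]])

end

section \<open>The comprehension completion on 1-cells and 2-cells\<close>

lemma obj_elementary_doctrineI: "elementary_doctrine P \<Longrightarrow> obj_elementary_doctrine P"
  by (simp add: obj_elementary_doctrine_def)

lemma elementary_doctrine_Tc0: "elementary_doctrine P \<Longrightarrow> elementary_doctrine (Tc0 P)"
  by (rule obj_elementary_doctrine.Tc0_elementary[OF obj_elementary_doctrineI])

lemma Tc1_sel:
  assumes "in_hom1 ED F P R"
  shows "X \<in> Obj (Tc0 P) \<Longrightarrow> ob (Tc1 F) X = Ext (ob F (under X)) (el F (under X) (pred X))"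
    and "f \<in> Hom (Tc0 P) X Y \<Longrightarrow> ar (Tc1 F) X Y f = ar F (under X) (under Y) f"
    and "\<lbrakk>X \<in> Obj (Tc0 P); x \<in> carrier (fib (Tc0 P) X)\<rbrakk> \<Longrightarrow> el (Tc1 F) X x = el F (under X) x"
  using ED_hom1_dsrc[OF assms] by (simp_all add: Tc1_def Let_def)

lemma Tc1_hom:
  assumes F: "in_hom1 ED F P R"
  shows "in_hom1 ED (Tc1 F) (Tc0 P) (Tc0 R)"
proof -
  interpret P: obj_elementary_doctrine P by (rule obj_elementary_doctrineI[OF ED_hom1_src[OF F]])
  interpret R: obj_elementary_doctrine R by (rule obj_elementary_doctrineI[OF ED_hom1_trg[OF F]])
  interpret Q: elementary_doctrine "Tc0 P" by (rule P.Tc0_elementary)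
  interpret S: elementary_doctrine "Tc0 R" by (rule R.Tc0_elementary)
  let ?h = "\<lambda>X. Ext (ob F (under X)) (el F (under X) (pred X))"
  have h: "?h X \<in> Obj (Tc0 R)" if "X \<in> Obj (Tc0 P)" for X
    using Obj_Tc0D[OF that] by (simp add: Obj_Tc0_iff ob_closed[OF F] el_closed[OF F])
  have a: "ar F (under X) (under Y) f \<in> Hom (Tc0 R) (?h X) (?h Y)" if f: "f \<in> Hom (Tc0 P) X Y" for X Y f
  proof -
    note f' = Hom_Tc0D[OF f]
    note X = Obj_Tc0D[OF f'(1)] and Y = Obj_Tc0D[OF f'(2)]
    show ?thesis
      using el_mono[OF F X(1,2) P.sub_closed[OF f'(3) Y(2)] f'(4)]
      by (simp add: Hom_Tc0_iff h f' ar_closed[OF F] el_sub[OF F f'(3) Y(2)])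
  qed
  have e: "el F (under X) x \<in> carrier (fib (Tc0 R) (?h X))"
    if X: "X \<in> Obj (Tc0 P)" and x: "x \<in> carrier (fib (Tc0 P) X)" for X x
    using Obj_Tc0D[OF X] carrier_Tc0D[OF x]
    by (simp add: carrier_Tc0_iff el_closed[OF F] el_mono[OF F])
  have "Tc1 F = \<lparr> dsrc = Tc0 P, dtrg = Tc0 R, ob = (\<lambda>X\<in>Obj (Tc0 P). ?h X),
      ar = (\<lambda>X Y. \<lambda>f\<in>Hom (Tc0 P) X Y. ar F (under X) (under Y) f),
      el = (\<lambda>X\<in>Obj (Tc0 P). \<lambda>x\<in>carrier (fib (Tc0 P) X). el F (under X) x) \<rparr>"
    by (simp add: Tc1_def Let_def ED_hom1_dsrc[OF F] ED_hom1_dtrg[OF F])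
  then show ?thesis
  proof (rule ED_hom1I)
    show "is_product (Tc0 R) (?h X) (?h Y) (?h W) (ar F (under W) (under X) p) (ar F (under W) (under Y) q)"
      if prod: "is_product (Tc0 P) X Y W p q" for X Y W p q
    proof (rule R.is_product_Tc0I)
      note prod' = P.is_product_Tc0D[OF prod]
      have XYW: "X \<in> Obj (Tc0 P)" "Y \<in> Obj (Tc0 P)" "W \<in> Obj (Tc0 P)"
        and p: "p \<in> Hom P (under W) (under X)" and q: "q \<in> Hom P (under W) (under Y)"
        using prod Hom_Tc0D(3) unfolding is_product_def by auto
      note X = Obj_Tc0D[OF XYW(1)] and Y = Obj_Tc0D[OF XYW(2)] and W = Obj_Tc0D[OF XYW(3)]
      show "?h X \<in> Obj (Tc0 R)" "?h Y \<in> Obj (Tc0 R)" "?h W \<in> Obj (Tc0 R)"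
        by (rule h, rule XYW)+
      show "is_product R (under (?h X)) (under (?h Y)) (under (?h W))
          (ar F (under W) (under X) p) (ar F (under W) (under Y) q)"
        using ar_product[OF F prod'(1)] by simp
      show "pred (?h W) = sub R (under (?h W)) (under (?h X)) (ar F (under W) (under X) p) (pred (?h X))
          \<sqinter>\<^bsub>fib R (under (?h W))\<^esub>
          sub R (under (?h W)) (under (?h Y)) (ar F (under W) (under Y) q) (pred (?h Y))"
        unfolding prod'(2)
        by (simp add: el_meet[OF F W(1) P.sub_closed[OF p X(2)] P.sub_closed[OF q Y(2)]]
            el_sub[OF F p X(2)] el_sub[OF F q Y(2)])
    qed
    show "el F (under X) \<top>\<^bsub>fib (Tc0 P) X\<^esub> = \<top>\<^bsub>fib (Tc0 R) (?h X)\<^esub>" if "X \<in> Obj (Tc0 P)" for X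
      using that by (simp add: P.Tc0_top R.Tc0_top[OF h])
    show "el F (under X) (x \<sqinter>\<^bsub>fib (Tc0 P) X\<^esub> y) = el F (under X) x \<sqinter>\<^bsub>fib (Tc0 R) (?h X)\<^esub> el F (under X) y"
      if "X \<in> Obj (Tc0 P)" "x \<in> carrier (fib (Tc0 P) X)" "y \<in> carrier (fib (Tc0 P) X)" for X x y
      using that by (simp add: P.Tc0_meet R.Tc0_meet[OF h e e] el_meet[OF F] Obj_Tc0D(1) carrier_Tc0D(1))
    show "el F (under X) (sub (Tc0 P) X Y f x) =
        sub (Tc0 R) (?h X) (?h Y) (ar F (under X) (under Y) f) (el F (under Y) x)"
      if f: "f \<in> Hom (Tc0 P) X Y" and x: "x \<in> carrier (fib (Tc0 P) Y)" for X Y f x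
    proof -
      note f' = Hom_Tc0D[OF f] and x' = carrier_Tc0D(1)[OF x]
      note X = Obj_Tc0D[OF f'(1)]
      show ?thesis
        by (simp add: Tc0_sel el_meet[OF F X(1) P.sub_closed[OF f'(3) x'] X(2)] el_sub[OF F f'(3) x'])
    qed
    fix X assume X: "X \<in> Obj (Tc0 P)"
    let ?A = "under X" and ?XX = "Prd (Tc0 P) X X"
    let ?AA = "Prd P ?A ?A" and ?FA = "ob F (under X)"
    let ?p = "ar F ?AA ?A (Pr1 P ?A ?A)" and ?q = "ar F ?AA ?A (Pr2 P ?A ?A)"
    let ?k = "Pair_arr R (ob F ?AA) ?FA ?FA ?p ?q" and ?hh = "Prd (Tc0 R) (?h X) (?h X)"
    note A = Obj_Tc0D[OF X] and XX = Q.Prd_Obj[OF X X]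
    note AA = P.Prd_Obj[OF A(1) A(1)] and \<alpha>\<alpha> = Obj_Tc0D(2)[OF XX, unfolded Tc0_sel(3)]
    note \<delta> = P.delta_closed[OF A(1)] and \<delta>' = R.delta_closed[OF ob_closed[OF F A(1)]]
    have p: "?p \<in> Hom (Tc0 R) (?h ?XX) (?h X)" and q: "?q \<in> Hom (Tc0 R) (?h ?XX) (?h X)"
      using a[OF Q.Pr1_Hom[OF X X]] a[OF Q.Pr2_Hom[OF X X]] by (simp_all add: Tc0_sel(3,5,6))
    have k_eq: "Pair_arr (Tc0 R) (?h ?XX) (?h X) (?h X) ?p ?q = ?k"
      using R.Tc0_Pair_arr[OF p q] by (simp add: Tc0_sel(3))
    have k: "?k \<in> Hom (Tc0 R) (?h ?XX) ?hh"
      using S.Pair_arr_Hom[OF p q] by (simp add: k_eq)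
    \<comment> \<open>The induced arrow \<open>?k\<close> into the chosen product is an arrow of the completion, so the
      predicate that distinguishes the equality predicate of \<open>?h X\<close> from that of \<open>F A\<close> is absorbed.\<close>
    have "el F ?AA (delta (Tc0 P) X) = sub R (ob F ?AA) (Prd R ?FA ?FA) ?k (delta R ?FA)
        \<sqinter>\<^bsub>fib R (ob F ?AA)\<^esub> el F ?AA (pred ?XX)"
      by (simp add: P.Tc0_delta[OF X] el_meet[OF F AA \<delta> \<alpha>\<alpha>] el_delta[OF F A(1)])
    also have "\<dots> = sub R (ob F ?AA) (Prd R ?FA ?FA) ?k (delta R ?FA \<sqinter>\<^bsub>fib R (Prd R ?FA ?FA)\<^esub> pred ?hh)
        \<sqinter>\<^bsub>fib R (ob F ?AA)\<^esub> el F ?AA (pred ?XX)"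
      using R.sub_meet_pred_absorb[OF k, of "delta R ?FA"] \<delta>' by (simp add: Tc0_sel(3))
    also have "\<dots> = sub (Tc0 R) (?h ?XX) ?hh ?k (delta (Tc0 R) (?h X))"
      by (simp add: R.Tc0_delta[OF h[OF X]] Tc0_sel(3,8))
    finally show "el F (under (Prd (Tc0 P) X X)) (delta (Tc0 P) X) =
        sub (Tc0 R) (?h (Prd (Tc0 P) X X)) (Prd (Tc0 R) (?h X) (?h X))
          (Pair_arr (Tc0 R) (?h (Prd (Tc0 P) X X)) (?h X) (?h X)
            (ar F (under (Prd (Tc0 P) X X)) (under X) (Pr1 (Tc0 P) X X))
            (ar F (under (Prd (Tc0 P) X X)) (under X) (Pr2 (Tc0 P) X X)))
          (delta (Tc0 R) (?h X))"
      unfolding Tc0_sel(3,5,6) k_eq[unfolded Tc0_sel(3)] .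
  next
    show "ar F (under X) (under X) (Idt (Tc0 P) X) = Idt (Tc0 R) (?h X)" if "X \<in> Obj (Tc0 P)" for X
      using Obj_Tc0D(1)[OF that] by (simp add: Tc0_sel ar_Idt[OF F])
    show "ar F (under X) (under Z) (Cmp (Tc0 P) X Y Z g f) =
        Cmp (Tc0 R) (?h X) (?h Y) (?h Z) (ar F (under Y) (under Z) g) (ar F (under X) (under Y) f)"
      if "f \<in> Hom (Tc0 P) X Y" "g \<in> Hom (Tc0 P) Y Z" for X Y Z f g
      using that[THEN Hom_Tc0D(3)] by (simp add: Tc0_sel ar_Cmp[OF F])
  qed (fact h a e P.Tc0_elementary R.Tc0_elementary)+
qed

lemma Tc2_cmpt:
  assumes "in_hom2 ED \<theta> F G" "in_hom1 ED F P R" "X \<in> Obj (Tc0 P)"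
  shows "cmpt (Tc2 \<theta>) X = cmpt \<theta> (under X)"
  using assms ED_hom2_ddom[OF assms(1,2)] ED_hom1_dsrc[OF assms(2)] by (simp add: Tc2_def)

lemma Tc2_hom:
  assumes \<theta>: "in_hom2 ED \<theta> F G" and F: "in_hom1 ED F P R"
  shows "in_hom2 ED (Tc2 \<theta>) (Tc1 F) (Tc1 G)"
proof -
  interpret P: obj_elementary_doctrine P by (rule obj_elementary_doctrineI[OF ED_hom1_src[OF F]])
  interpret R: obj_elementary_doctrine R by (rule obj_elementary_doctrineI[OF ED_hom1_trg[OF F]])
  note G = ED_hom2_cod[OF \<theta> F]
  note obF = ob_closed[OF Tc1_hom[OF F]] and obG = ob_closed[OF Tc1_hom[OF G]]
  have "Tc2 \<theta> = \<lparr> ddom = Tc1 F, dcod = Tc1 G, cmpt = (\<lambda>X\<in>Obj (Tc0 P). cmpt \<theta> (under X)) \<rparr>"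
    by (simp add: Tc2_def ED_hom2D(2,3)[OF \<theta> F] ED_hom1_dsrc[OF F])
  then show ?thesis
  proof (rule ED_hom2I[OF _ Tc1_hom[OF F] Tc1_hom[OF G]])
    fix X assume X: "X \<in> Obj (Tc0 P)"
    note A = Obj_Tc0D[OF X]
    show "cmpt \<theta> (under X) \<in> Hom (Tc0 R) (ob (Tc1 F) X) (ob (Tc1 G) X)"
      using obF[OF X] obG[OF X] cmpt_closed[OF \<theta> F A(1)] cmpt_le[OF \<theta> F A(1,2)]
      by (simp add: Hom_Tc0_iff Tc1_sel[OF F] Tc1_sel[OF G] X)
  next
    fix X Y f assume f: "f \<in> Hom (Tc0 P) X Y"
    note f' = Hom_Tc0D[OF f]
    show "Cmp (Tc0 R) (ob (Tc1 F) X) (ob (Tc1 F) Y) (ob (Tc1 G) Y) (cmpt \<theta> (under Y)) (ar (Tc1 F) X Y f) =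
        Cmp (Tc0 R) (ob (Tc1 F) X) (ob (Tc1 G) X) (ob (Tc1 G) Y) (ar (Tc1 G) X Y f) (cmpt \<theta> (under X))"
      by (simp add: Tc1_sel[OF F] Tc1_sel[OF G] f f' Tc0_sel cmpt_natural[OF \<theta> F f'(3)])
  next
    fix X x assume X: "X \<in> Obj (Tc0 P)" and x: "x \<in> carrier (fib (Tc0 P) X)"
    note A = Obj_Tc0D[OF X] and x' = carrier_Tc0D[OF x]
    note Fx = el_closed[OF F A(1) x'(1)] and Gx = el_closed[OF G A(1) x'(1)] and F\<alpha> = el_closed[OF F A(1,2)]
    note t = R.sub_closed[OF cmpt_closed[OF \<theta> F A(1)] Gx]
    show "el (Tc1 F) X x \<sqsubseteq>\<^bsub>fib (Tc0 R) (ob (Tc1 F) X)\<^esub>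
        sub (Tc0 R) (ob (Tc1 F) X) (ob (Tc1 G) X) (cmpt \<theta> (under X)) (el (Tc1 G) X x)"
      using cmpt_le[OF \<theta> F A(1) x'(1)] el_mono[OF F A(1) x'(1) A(2) x'(2)]
      by (simp add: Tc1_sel[OF F] Tc1_sel[OF G] X x Tc0_sel
          R.fib_le_meet_iff[OF ob_closed[OF F A(1)] t F\<alpha> Fx])
  qed
qed

section \<open>Unit and multiplication\<close>

lemma Tc_unit_sel:
  "A \<in> Obj P \<Longrightarrow> ob (Tc_unit P) A = Ext A \<top>\<^bsub>fib P A\<^esub>"
  "f \<in> Hom P A B \<Longrightarrow> ar (Tc_unit P) A B f = f"
  "\<lbrakk>A \<in> Obj P; x \<in> carrier (fib P A)\<rbrakk> \<Longrightarrow> el (Tc_unit P) A x = x"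
  by (simp_all add: Tc_unit_def)

lemma Tc_unit_hom:
  assumes P: "elementary_doctrine P"
  shows "in_hom1 ED (Tc_unit P) P (Tc0 P)"
proof -
  interpret P: obj_elementary_doctrine P by (rule obj_elementary_doctrineI[OF P])
  interpret Q: elementary_doctrine "Tc0 P" by (rule P.Tc0_elementary)
  let ?h = "\<lambda>A. Ext A \<top>\<^bsub>fib P A\<^esub>"
  have h: "?h A \<in> Obj (Tc0 P)" if "A \<in> Obj P" for A
    using that by (simp add: Obj_Tc0_iff P.fib_top)
  have a: "f \<in> Hom (Tc0 P) (?h A) (?h B)" if f: "f \<in> Hom P A B" for f A B
    using f P.Hom_ObjD[OF f] by (simp add: Hom_Tc0_iff h P.sub_top P.fib_le_refl P.fib_top)
  have e: "x \<in> carrier (fib (Tc0 P) (?h A))" if "A \<in> Obj P" "x \<in> carrier (fib P A)" for A x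
    using that by (simp add: carrier_Tc0_iff P.fib_le_top)
  show ?thesis
  proof (rule ED_hom1I[OF Tc_unit_def])
    show "is_product (Tc0 P) (?h A) (?h B) (?h W) p q" if prod: "is_product P A B W p q" for A B W p q
    proof -
      have ABW: "A \<in> Obj P" "B \<in> Obj P" "W \<in> Obj P" and pq: "p \<in> Hom P W A" "q \<in> Hom P W B"
        using prod by (auto simp: is_product_def)
      show ?thesis
        by (rule P.is_product_Tc0I)
          (simp_all add: ABW h prod P.sub_top[OF pq(1)] P.sub_top[OF pq(2)] P.fib_meet_top P.fib_top)
    qed
    show "\<top>\<^bsub>fib P A\<^esub> = \<top>\<^bsub>fib (Tc0 P) (?h A)\<^esub>" if "A \<in> Obj P" for A
      using that by (simp add: P.Tc0_top h)
    show "x \<sqinter>\<^bsub>fib P A\<^esub> y = x \<sqinter>\<^bsub>fib (Tc0 P) (?h A)\<^esub> y"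
      if "A \<in> Obj P" "x \<in> carrier (fib P A)" "y \<in> carrier (fib P A)" for A x y
      using that by (simp add: P.Tc0_meet h e)
    show "sub P A B f x = sub (Tc0 P) (?h A) (?h B) f x"
      if f: "f \<in> Hom P A B" and x: "x \<in> carrier (fib P B)" for A B f x
      using P.Hom_ObjD[OF f] by (simp add: Tc0_sel P.fib_meet_top P.sub_closed[OF f x])
    fix A assume A: "A \<in> Obj P"
    let ?AA = "Prd P A A"
    note AA = P.Prd_Obj[OF A A] and \<delta> = P.delta_closed[OF A]
    note p = a[OF P.Pr1_Hom[OF A A]] and q = a[OF P.Pr2_Hom[OF A A]]
    have k_eq: "Pair_arr (Tc0 P) (?h ?AA) (?h A) (?h A) (Pr1 P A A) (Pr2 P A A) = Idt P ?AA"
      using P.Tc0_Pair_arr[OF p q] by (simp add: P.Pair_arr_proj A)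
    have k: "Idt P ?AA \<in> Hom (Tc0 P) (?h ?AA) (Prd (Tc0 P) (?h A) (?h A))"
      using Q.Pair_arr_Hom[OF p q] by (simp add: k_eq)
    show "delta P A = sub (Tc0 P) (?h ?AA) (Prd (Tc0 P) (?h A) (?h A))
        (Pair_arr (Tc0 P) (?h ?AA) (?h A) (?h A) (Pr1 P A A) (Pr2 P A A)) (delta (Tc0 P) (?h A))"
      using P.sub_meet_pred_absorb[OF k, of "delta P A"] \<delta> AA
      by (simp add: k_eq P.Tc0_delta[OF h[OF A]] Tc0_sel(3,8) P.sub_Idt P.fib_meet_top)
  qed (simp_all add: P P.Tc0_elementary h a e Tc0_sel)
qed

lemma Tc_mult_sel:
  "X \<in> Obj (Tc0 (Tc0 P)) \<Longrightarrow> ob (Tc_mult P) X = Ext (under (under X)) (pred X)"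
  "f \<in> Hom (Tc0 (Tc0 P)) X Y \<Longrightarrow> ar (Tc_mult P) X Y f = f"
  "\<lbrakk>X \<in> Obj (Tc0 (Tc0 P)); x \<in> carrier (fib (Tc0 (Tc0 P)) X)\<rbrakk> \<Longrightarrow> el (Tc_mult P) X x = x"
  by (simp_all add: Tc_mult_def Let_def)

lemma Tc_mult_hom:
  assumes P: "elementary_doctrine P"
  shows "in_hom1 ED (Tc_mult P) (Tc0 (Tc0 P)) (Tc0 P)"
proof -
  interpret P: obj_elementary_doctrine P by (rule obj_elementary_doctrineI[OF P])
  interpret Q: obj_elementary_doctrine "Tc0 P" by (rule obj_elementary_doctrineI[OF P.Tc0_elementary])
  interpret QQ: elementary_doctrine "Tc0 (Tc0 P)" by (rule Q.Tc0_elementary)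
  let ?Q = "Tc0 P" and ?QQ = "Tc0 (Tc0 P)"
  let ?h = "\<lambda>X. Ext (under (under X)) (pred X)"
  have ObjD: "under (under X) \<in> Obj P" "pred X \<in> carrier (fib P (under (under X)))"
    "pred (under X) \<in> carrier (fib P (under (under X)))"
    "pred X \<sqsubseteq>\<^bsub>fib P (under (under X))\<^esub> pred (under X)" "under X \<in> Obj ?Q"
    if "X \<in> Obj ?QQ" for X
    using Obj_Tc0D[OF that] Obj_Tc0D[OF Obj_Tc0D(1)[OF that]] carrier_Tc0D[OF Obj_Tc0D(2)[OF that]]
    by simp_all
  \<comment> \<open>In \<open>((A, \<alpha>), \<gamma>)\<close> the predicate \<open>\<gamma>\<close> lies below \<open>\<alpha>\<close>, so truncation by \<open>\<alpha>\<close> followed by \<open>\<gamma>\<close> is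
    truncation by \<open>\<gamma>\<close>; this is why the multiplication may forget \<open>\<alpha>\<close>.\<close>
  have absorb: "(x \<sqinter>\<^bsub>fib P (under (under X))\<^esub> pred (under X)) \<sqinter>\<^bsub>fib P (under (under X))\<^esub> pred X
      = x \<sqinter>\<^bsub>fib P (under (under X))\<^esub> pred X"
    if X: "X \<in> Obj ?QQ" and x: "x \<in> carrier (fib P (under (under X)))" for X x
  proof -
    note X' = ObjD[OF X]
    have "pred (under X) \<sqinter>\<^bsub>fib P (under (under X))\<^esub> pred X = pred X"
      using X'(4) unfolding P.fib_le_iff_meet[OF X'(1,2,3)] meet_comm[of _ "pred X"] .
    then show ?thesis by (simp add: P.fib_meet_assoc[OF X'(1) x X'(3,2)])
  qed
  have h: "?h X \<in> Obj ?Q" if "X \<in> Obj ?QQ" for X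
    using ObjD[OF that] by (simp add: Obj_Tc0_iff)
  have carD: "x \<in> carrier (fib P (under (under X)))" "x \<sqsubseteq>\<^bsub>fib P (under (under X))\<^esub> pred X"
    "x \<in> carrier (fib ?Q (under X))"
    if "x \<in> carrier (fib ?QQ X)" for X x
    using carrier_Tc0D[OF that] carrier_Tc0D[OF carrier_Tc0D(1)[OF that]] by (simp_all add: Tc0_sel)
  have sub_QQ: "sub ?QQ X Y f x = sub P (under (under X)) (under (under Y)) f x
      \<sqinter>\<^bsub>fib P (under (under X))\<^esub> pred X"
    if f: "f \<in> Hom ?QQ X Y" and x: "x \<in> carrier (fib ?Q (under Y))" for X Y f x
  proof -
    note f' = Hom_Tc0D[OF f]
    show ?thesis
      unfolding Tc0_sel(8)[of ?Q] Q.fib_meet[THEN carrier_Tc0D(1)]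
        P.Tc0_meet[OF ObjD(5)[OF f'(1)] Q.sub_closed[OF f'(3) x] Obj_Tc0D(2)[OF f'(1)]]
      unfolding Tc0_sel(8)
      by (rule absorb[OF f'(1) P.sub_closed[OF Hom_Tc0D(3)[OF f'(3)] carrier_Tc0D(1)[OF x]]])
  qed
  have a: "f \<in> Hom ?Q (?h X) (?h Y)" if f: "f \<in> Hom ?QQ X Y" for f X Y
  proof -
    note f' = Hom_Tc0D[OF f]
    note f'' = Hom_Tc0D[OF f'(3)] and X = ObjD[OF f'(1)] and Y = ObjD[OF f'(2)]
    note fY = P.sub_closed[OF f''(3) Y(2)]
    show ?thesis
      using f'(4) P.fib_le_meet_iff[OF X(1) fY X(3,2)]
      by (simp add: Hom_Tc0_iff h f' f'' Tc0_sel)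
  qed
  have e: "x \<in> carrier (fib ?Q (?h X))" if "x \<in> carrier (fib ?QQ X)" for X x
    using carD[OF that] by (simp add: carrier_Tc0_iff)
  have "Tc_mult P = \<lparr> dsrc = ?QQ, dtrg = ?Q, ob = (\<lambda>X\<in>Obj ?QQ. ?h X),
      ar = (\<lambda>X Y. \<lambda>f\<in>Hom ?QQ X Y. f), el = (\<lambda>X\<in>Obj ?QQ. \<lambda>x\<in>carrier (fib ?QQ X). x) \<rparr>"
    by (simp add: Tc_mult_def Let_def)
  then show ?thesis
  proof (rule ED_hom1I)
    show "is_product ?Q (?h X) (?h Y) (?h W) p q" if prod: "is_product ?QQ X Y W p q" for X Y W p q
    proof -
      have XYW: "X \<in> Obj ?QQ" "Y \<in> Obj ?QQ" "W \<in> Obj ?QQ"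
        and pq: "p \<in> Hom ?QQ W X" "q \<in> Hom ?QQ W Y"
        using prod by (auto simp: is_product_def)
      note X = ObjD[OF XYW(1)] and Y = ObjD[OF XYW(2)] and W = ObjD[OF XYW(3)]
      note p' = Hom_Tc0D[OF pq(1)] and q' = Hom_Tc0D[OF pq(2)]
      note p = Hom_Tc0D(3)[OF p'(3)] and q = Hom_Tc0D(3)[OF q'(3)]
      note prod1 = Q.is_product_Tc0D[OF prod]
      note prod2 = P.is_product_Tc0D[OF prod1(1)]
      let ?C = "under (under W)"
      let ?L = "fib P ?C" and ?u = "sub P ?C (under (under X)) p" and ?v = "sub P ?C (under (under Y)) q"
      note pX = P.sub_closed[OF p X(2)] and qY = P.sub_closed[OF q Y(2)]
      note pX' = P.sub_closed[OF p X(3)] and qY' = P.sub_closed[OF q Y(3)]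
      have "pred W = (?u (pred X) \<sqinter>\<^bsub>?L\<^esub> pred (under W)) \<sqinter>\<^bsub>?L\<^esub> (?v (pred Y) \<sqinter>\<^bsub>?L\<^esub> pred (under W))"
        using prod1(2) P.Tc0_meet[OF W(5) Q.sub_closed[OF p'(3) Obj_Tc0D(2)[OF XYW(1)]]
            Q.sub_closed[OF q'(3) Obj_Tc0D(2)[OF XYW(2)]]] by (simp add: Tc0_sel)
      also have "\<dots> = (?u (pred X) \<sqinter>\<^bsub>?L\<^esub> ?v (pred Y)) \<sqinter>\<^bsub>?L\<^esub> pred (under W)"
        using W pX qY by (simp add: P.fib_meet_ac P.fib_meet)
      also have "\<dots> = ?u (pred X) \<sqinter>\<^bsub>?L\<^esub> ?v (pred Y)"
      proof -
        have "?u (pred X) \<sqinter>\<^bsub>?L\<^esub> ?v (pred Y) \<sqsubseteq>\<^bsub>?L\<^esub> pred (under W)"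
          unfolding prod2(2)
          by (rule P.fib_meet_mono[OF W(1) P.sub_mono[OF p X(4,2,3)] P.sub_mono[OF q Y(4,2,3)] pX pX' qY qY'])
        then show ?thesis
          using P.fib_le_iff_meet[OF W(1) P.fib_meet[OF W(1) pX qY] W(3)] by simp
      qed
      finally have "pred W = ?u (pred X) \<sqinter>\<^bsub>?L\<^esub> ?v (pred Y)" .
      then show ?thesis
        by (intro P.is_product_Tc0I h XYW) (simp_all add: prod2(1))
    qed
    show "\<top>\<^bsub>fib ?QQ X\<^esub> = \<top>\<^bsub>fib ?Q (?h X)\<^esub>" if "X \<in> Obj ?QQ" for X
      using that by (simp add: P.Tc0_top Q.Tc0_top h)
    show "x \<sqinter>\<^bsub>fib ?QQ X\<^esub> y = x \<sqinter>\<^bsub>fib ?Q (?h X)\<^esub> y"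
      if "X \<in> Obj ?QQ" "x \<in> carrier (fib ?QQ X)" "y \<in> carrier (fib ?QQ X)" for X x y
      using that by (simp add: Q.Tc0_meet P.Tc0_meet[OF h e e] P.Tc0_meet[OF ObjD(5) carD(3) carD(3)])
    show "sub ?QQ X Y f x = sub ?Q (?h X) (?h Y) f x"
      if f: "f \<in> Hom ?QQ X Y" and x: "x \<in> carrier (fib ?QQ Y)" for X Y f x
      unfolding sub_QQ[OF f carD(3)[OF x]] by (simp add: Tc0_sel)
    fix X assume X: "X \<in> Obj ?QQ"
    let ?A = "under (under X)" and ?XX = "Prd ?QQ X X"
    let ?AA = "Prd P ?A ?A"
    note A = ObjD[OF X] and XX = QQ.Prd_Obj[OF X X]
    note AA = P.Prd_Obj[OF A(1) A(1)] and XX' = ObjD[OF XX, unfolded Tc0_sel(3)] and \<delta> = P.delta_closed[OF A(1)]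
    have p: "Pr1 P ?A ?A \<in> Hom ?Q (?h ?XX) (?h X)" and q: "Pr2 P ?A ?A \<in> Hom ?Q (?h ?XX) (?h X)"
      using a[OF QQ.Pr1_Hom[OF X X]] a[OF QQ.Pr2_Hom[OF X X]] by (simp_all add: Tc0_sel(3,5,6))
    have k_eq: "Pair_arr ?Q (?h ?XX) (?h X) (?h X) (Pr1 P ?A ?A) (Pr2 P ?A ?A) = Idt P ?AA"
      using P.Tc0_Pair_arr[OF p q] by (simp add: Tc0_sel(3) P.Pair_arr_proj A)
    have k: "Idt P ?AA \<in> Hom ?Q (?h ?XX) (Prd ?Q (?h X) (?h X))"
      using Q.Pair_arr_Hom[OF p q] by (simp add: k_eq)
    have "delta ?QQ X = delta ?Q (under X) \<sqinter>\<^bsub>fib ?Q (Prd ?Q (under X) (under X))\<^esub> pred ?XX"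
      by (rule Q.Tc0_delta[OF X])
    also have "\<dots> = delta ?Q (under X) \<sqinter>\<^bsub>fib P ?AA\<^esub> pred ?XX"
      using P.Tc0_meet[OF Q.Prd_Obj[OF A(5) A(5)] Q.delta_closed[OF A(5)] Obj_Tc0D(2)[OF XX, unfolded Tc0_sel(3)]]
      by (simp add: Tc0_sel(3))
    also have "\<dots> = delta P ?A \<sqinter>\<^bsub>fib P ?AA\<^esub> pred ?XX"
      unfolding P.Tc0_delta[OF A(5)] using absorb[OF XX, unfolded Tc0_sel(3), OF \<delta>] .
    also have "\<dots> = sub ?Q (?h ?XX) (Prd ?Q (?h X) (?h X)) (Idt P ?AA) (delta ?Q (?h X))"
      using P.sub_meet_pred_absorb[OF k, of "delta P ?A"] \<delta> AA
      by (simp add: P.Tc0_delta[OF h[OF X]] Tc0_sel(3,8) P.sub_Idt)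
    finally show "delta ?QQ X = sub ?Q (?h (Prd ?QQ X X)) (Prd ?Q (?h X) (?h X))
        (Pair_arr ?Q (?h (Prd ?QQ X X)) (?h X) (?h X) (Pr1 ?QQ X X) (Pr2 ?QQ X X)) (delta ?Q (?h X))"
      unfolding Tc0_sel(5,6) k_eq .
  qed (simp_all add: P.Tc0_elementary Q.Tc0_elementary h a e Tc0_sel)
qed

section \<open>The 2-monad\<close>

lemma Tc_fields:
  "fun0 Tc = Tc0" "fun1 Tc = Tc1" "fun2 Tc = Tc2" "two_monad.unit Tc = Tc_unit" "mult Tc = Tc_mult"
  by (simp_all add: Tc_def)

lemma Tc1_dmor_id:
  assumes P: "elementary_doctrine P"
  shows "Tc1 (dmor_id P) = dmor_id (Tc0 P)"
  by (rule ED_hom1_eqI[OF Tc1_hom[OF dmor_id_hom[OF P]] dmor_id_hom[OF elementary_doctrine_Tc0[OF P]]])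
    (simp_all add: Tc1_sel[OF dmor_id_hom[OF P]] dmor_id_sel Obj_Tc0D Hom_Tc0D carrier_Tc0D)

lemma Tc1_dmor_comp:
  assumes F: "in_hom1 ED F P Q" and G: "in_hom1 ED G Q R"
  shows "Tc1 (dmor_comp G F) = dmor_comp (Tc1 G) (Tc1 F)"
proof -
  note GF = dmor_comp_hom[OF F G] and TF = Tc1_hom[OF F] and TG = Tc1_hom[OF G]
  show ?thesis
  proof (rule ED_hom1_eqI[OF Tc1_hom[OF GF] dmor_comp_hom[OF TF TG]])
    show "ob (Tc1 (dmor_comp G F)) X = ob (dmor_comp (Tc1 G) (Tc1 F)) X" if X: "X \<in> Obj (Tc0 P)" for X
      using ob_closed[OF TF X]
      by (simp add: X Tc1_sel[OF GF] Tc1_sel[OF F] Tc1_sel[OF G] dmor_comp_sel[OF F] dmor_comp_sel[OF TF] Obj_Tc0D[OF X])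
    show "ar (Tc1 (dmor_comp G F)) X Y f = ar (dmor_comp (Tc1 G) (Tc1 F)) X Y f"
      if f: "f \<in> Hom (Tc0 P) X Y" for X Y f
      using ar_closed[OF TF f] Hom_Tc0D[OF f]
      by (simp add: f Tc1_sel[OF GF] Tc1_sel[OF F] Tc1_sel[OF G] dmor_comp_sel[OF F] dmor_comp_sel[OF TF])
    show "el (Tc1 (dmor_comp G F)) X x = el (dmor_comp (Tc1 G) (Tc1 F)) X x"
      if X: "X \<in> Obj (Tc0 P)" and x: "x \<in> carrier (fib (Tc0 P) X)" for X x
      using ob_closed[OF TF X] el_closed[OF TF X x] Obj_Tc0D[OF X] carrier_Tc0D[OF x]
      by (simp add: X x Tc1_sel[OF GF] Tc1_sel[OF F] Tc1_sel[OF G] dmor_comp_sel[OF F] dmor_comp_sel[OF TF])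
  qed
qed

lemma Tc2_dcell_id:
  assumes F: "in_hom1 ED F P R"
  shows "Tc2 (dcell_id F) = dcell_id (Tc1 F)"
  by (rule ED_hom2_eqI[OF Tc2_hom[OF dcell_id_hom[OF F] F] dcell_id_hom[OF Tc1_hom[OF F]] Tc1_hom[OF F]])
    (simp add: Tc2_cmpt[OF dcell_id_hom[OF F] F] dcell_id_cmpt[OF F] dcell_id_cmpt[OF Tc1_hom[OF F]]
      Obj_Tc0D Tc0_sel Tc1_sel[OF F])

lemma Tc2_dcell_vcomp:
  assumes s: "in_hom2 ED s F G" and t: "in_hom2 ED t G H" and F: "in_hom1 ED F P R"
  shows "Tc2 (dcell_vcomp t s) = dcell_vcomp (Tc2 t) (Tc2 s)"
proof -
  note G = ED_hom2_cod[OF s F]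
  note H = ED_hom2_cod[OF t G]
  note ts = dcell_vcomp_hom[OF s t F] and Ts = Tc2_hom[OF s F] and Tt = Tc2_hom[OF t G] and TF = Tc1_hom[OF F]
  show ?thesis
    by (rule ED_hom2_eqI[OF Tc2_hom[OF ts F] dcell_vcomp_hom[OF Ts Tt TF] TF])
      (simp add: Tc2_cmpt[OF ts F] dcell_vcomp_cmpt[OF Ts Tt TF] dcell_vcomp_cmpt[OF s t F]
        Tc2_cmpt[OF s F] Tc2_cmpt[OF t G] Obj_Tc0D Tc0_sel Tc1_sel[OF F] Tc1_sel[OF G] Tc1_sel[OF H])
qed

lemma Tc2_dcell_hcomp:
  assumes s: "in_hom2 ED s F F'" and t: "in_hom2 ED t G G'"
    and F: "in_hom1 ED F P Q" and G: "in_hom1 ED G Q R"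
  shows "Tc2 (dcell_hcomp t s) = dcell_hcomp (Tc2 t) (Tc2 s)"
proof -
  note F' = ED_hom2_cod[OF s F] and G' = ED_hom2_cod[OF t G]
  note ts = dcell_hcomp_hom[OF s t F G] and Ts = Tc2_hom[OF s F] and Tt = Tc2_hom[OF t G]
  note TF = Tc1_hom[OF F] and TG = Tc1_hom[OF G] and GF = dmor_comp_hom[OF F G]
  note TF' = Tc1_hom[OF F']
  note r = dcell_hcomp_hom[OF Ts Tt TF TG, folded Tc1_dmor_comp[OF F G] Tc1_dmor_comp[OF F' G']]
  show ?thesis
  proof (rule ED_hom2_eqI[OF Tc2_hom[OF ts GF] r Tc1_hom[OF GF]])
    fix X assume X: "X \<in> Obj (Tc0 P)"
    note FX = ob_closed[OF TF X] and F'X = ob_closed[OF TF' X] and sX = cmpt_closed[OF Ts TF X]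
    show "cmpt (Tc2 (dcell_hcomp t s)) X = cmpt (dcell_hcomp (Tc2 t) (Tc2 s)) X"
      using FX F'X sX Obj_Tc0D[OF X]
      by (simp add: X Tc2_cmpt[OF ts GF] dcell_hcomp_cmpt[OF Ts Tt TF TG] dcell_hcomp_cmpt[OF s t F G]
          Tc2_cmpt[OF s F] Tc2_cmpt[OF t G] Tc0_sel Tc1_sel[OF F] Tc1_sel[OF F'] Tc1_sel[OF G] Tc1_sel[OF G'])
  qed
qed

lemma Tc_unit_natural:
  assumes F: "in_hom1 ED F P R"
  shows "dmor_comp (Tc1 F) (Tc_unit P) = dmor_comp (Tc_unit R) F"
proof -
  note \<eta>P = Tc_unit_hom[OF ED_hom1_src[OF F]] and \<eta>R = Tc_unit_hom[OF ED_hom1_trg[OF F]]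
  note TF = Tc1_hom[OF F]
  show ?thesis
  proof (rule ED_hom1_eqI[OF dmor_comp_hom[OF \<eta>P TF] dmor_comp_hom[OF F \<eta>R]])
    show "ob (dmor_comp (Tc1 F) (Tc_unit P)) A = ob (dmor_comp (Tc_unit R) F) A" if A: "A \<in> Obj P" for A
      using ob_closed[OF \<eta>P A] ob_closed[OF F A]
      by (simp add: A dmor_comp_sel[OF \<eta>P] dmor_comp_sel[OF F] Tc1_sel[OF F] Tc_unit_sel el_top[OF F])
    show "ar (dmor_comp (Tc1 F) (Tc_unit P)) A B f = ar (dmor_comp (Tc_unit R) F) A B f"
      if f: "f \<in> Hom P A B" for A B f
    proof -
      have "A \<in> Obj P" "B \<in> Obj P"
        using product_category.Hom_ObjD[OF elementary_doctrine_locales(2)[OF ED_hom1_src[OF F]] f] by auto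
      then show ?thesis
        using ar_closed[OF \<eta>P f] ar_closed[OF F f]
        by (simp add: f dmor_comp_sel[OF \<eta>P] dmor_comp_sel[OF F] Tc1_sel[OF F] Tc_unit_sel)
    qed
    show "el (dmor_comp (Tc1 F) (Tc_unit P)) A x = el (dmor_comp (Tc_unit R) F) A x"
      if A: "A \<in> Obj P" and x: "x \<in> carrier (fib P A)" for A x
      using ob_closed[OF \<eta>P A] el_closed[OF \<eta>P A x] ob_closed[OF F A] el_closed[OF F A x]
      by (simp add: A x dmor_comp_sel[OF \<eta>P] dmor_comp_sel[OF F] Tc1_sel[OF F] Tc_unit_sel)
  qed
qed

lemma Tc_unit_natural2:
  assumes s: "in_hom2 ED s F G" and F: "in_hom1 ED F P R"
  shows "dcell_hcomp (Tc2 s) (dcell_id (Tc_unit P)) = dcell_hcomp (dcell_id (Tc_unit R)) s"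
proof -
  note G = ED_hom2_cod[OF s F]
  note \<eta>P = Tc_unit_hom[OF ED_hom1_src[OF F]] and \<eta>R = Tc_unit_hom[OF ED_hom1_trg[OF F]]
  note TF = Tc1_hom[OF F] and Ts = Tc2_hom[OF s F]
  note l = dcell_hcomp_hom[OF dcell_id_hom[OF \<eta>P] Ts \<eta>P TF, unfolded Tc_unit_natural[OF F] Tc_unit_natural[OF G]]
  show ?thesis
  proof (rule ED_hom2_eqI[OF l dcell_hcomp_hom[OF s dcell_id_hom[OF \<eta>R] F \<eta>R] dmor_comp_hom[OF F \<eta>R]])
    fix A assume A: "A \<in> Obj P"
    show "cmpt (dcell_hcomp (Tc2 s) (dcell_id (Tc_unit P))) A = cmpt (dcell_hcomp (dcell_id (Tc_unit R)) s) A"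
      using ob_closed[OF \<eta>P A] cmpt_closed[OF s F A]
      by (simp add: A dcell_whisker_right_cmpt[OF \<eta>P Ts TF] dcell_whisker_left_cmpt[OF s F \<eta>R]
          Tc2_cmpt[OF s F] Tc_unit_sel)
  qed
qed

lemma Tc_mult_natural:
  assumes F: "in_hom1 ED F P R"
  shows "dmor_comp (Tc1 F) (Tc_mult P) = dmor_comp (Tc_mult R) (Tc1 (Tc1 F))"
proof -
  note \<mu>P = Tc_mult_hom[OF ED_hom1_src[OF F]] and \<mu>R = Tc_mult_hom[OF ED_hom1_trg[OF F]]
  note TF = Tc1_hom[OF F]
  note TTF = Tc1_hom[OF TF]
  show ?thesis
  proof (rule ED_hom1_eqI[OF dmor_comp_hom[OF \<mu>P TF] dmor_comp_hom[OF TTF \<mu>R]])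
    show "ob (dmor_comp (Tc1 F) (Tc_mult P)) X = ob (dmor_comp (Tc_mult R) (Tc1 (Tc1 F))) X"
      if X: "X \<in> Obj (Tc0 (Tc0 P))" for X
      using ob_closed[OF \<mu>P X] ob_closed[OF TTF X] Obj_Tc0D[OF X]
      by (simp add: X dmor_comp_sel[OF \<mu>P] dmor_comp_sel[OF TTF] Tc1_sel[OF F] Tc1_sel[OF TF] Tc_mult_sel)
    show "ar (dmor_comp (Tc1 F) (Tc_mult P)) X Y f = ar (dmor_comp (Tc_mult R) (Tc1 (Tc1 F))) X Y f"
      if f: "f \<in> Hom (Tc0 (Tc0 P)) X Y" for X Y f
      using ar_closed[OF \<mu>P f] ar_closed[OF TTF f] Hom_Tc0D[OF f]
      by (simp add: f dmor_comp_sel[OF \<mu>P] dmor_comp_sel[OF TTF] Tc1_sel[OF F] Tc1_sel[OF TF] Tc_mult_sel)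
    show "el (dmor_comp (Tc1 F) (Tc_mult P)) X x = el (dmor_comp (Tc_mult R) (Tc1 (Tc1 F))) X x"
      if X: "X \<in> Obj (Tc0 (Tc0 P))" and x: "x \<in> carrier (fib (Tc0 (Tc0 P)) X)" for X x
      using ob_closed[OF \<mu>P X] ob_closed[OF TTF X] el_closed[OF \<mu>P X x] el_closed[OF TTF X x]
        Obj_Tc0D[OF X] carrier_Tc0D[OF x]
      by (simp add: X x dmor_comp_sel[OF \<mu>P] dmor_comp_sel[OF TTF] Tc1_sel[OF F] Tc1_sel[OF TF] Tc_mult_sel)
  qed
qed

lemma Tc_mult_natural2:
  assumes s: "in_hom2 ED s F G" and F: "in_hom1 ED F P R"
  shows "dcell_hcomp (Tc2 s) (dcell_id (Tc_mult P)) = dcell_hcomp (dcell_id (Tc_mult R)) (Tc2 (Tc2 s))"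
proof -
  note G = ED_hom2_cod[OF s F]
  note \<mu>P = Tc_mult_hom[OF ED_hom1_src[OF F]] and \<mu>R = Tc_mult_hom[OF ED_hom1_trg[OF F]]
  note TF = Tc1_hom[OF F] and Ts = Tc2_hom[OF s F]
  note TTF = Tc1_hom[OF TF] and TTs = Tc2_hom[OF Ts TF]
  note l = dcell_hcomp_hom[OF dcell_id_hom[OF \<mu>P] Ts \<mu>P TF, unfolded Tc_mult_natural[OF F] Tc_mult_natural[OF G]]
  show ?thesis
  proof (rule ED_hom2_eqI[OF l dcell_hcomp_hom[OF TTs dcell_id_hom[OF \<mu>R] TTF \<mu>R] dmor_comp_hom[OF TTF \<mu>R]])
    fix X assume X: "X \<in> Obj (Tc0 (Tc0 P))"
    show "cmpt (dcell_hcomp (Tc2 s) (dcell_id (Tc_mult P))) X =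
        cmpt (dcell_hcomp (dcell_id (Tc_mult R)) (Tc2 (Tc2 s))) X"
      using ob_closed[OF \<mu>P X] cmpt_closed[OF TTs TTF X] Obj_Tc0D[OF X]
      by (simp add: X dcell_whisker_right_cmpt[OF \<mu>P Ts TF] dcell_whisker_left_cmpt[OF TTs TTF \<mu>R]
          Tc2_cmpt[OF s F] Tc2_cmpt[OF Ts TF] Tc_mult_sel)
  qed
qed

lemma Tc_mult_assoc:
  assumes P: "elementary_doctrine P"
  shows "dmor_comp (Tc_mult P) (Tc1 (Tc_mult P)) = dmor_comp (Tc_mult P) (Tc_mult (Tc0 P))"
proof -
  note \<mu> = Tc_mult_hom[OF P] and \<mu>T = Tc_mult_hom[OF elementary_doctrine_Tc0[OF P]]
  note T\<mu> = Tc1_hom[OF \<mu>]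
  show ?thesis
  proof (rule ED_hom1_eqI[OF dmor_comp_hom[OF T\<mu> \<mu>] dmor_comp_hom[OF \<mu>T \<mu>]])
    let ?T3 = "Tc0 (Tc0 (Tc0 P))"
    show "ob (dmor_comp (Tc_mult P) (Tc1 (Tc_mult P))) X = ob (dmor_comp (Tc_mult P) (Tc_mult (Tc0 P))) X"
      if X: "X \<in> Obj ?T3" for X
      using ob_closed[OF T\<mu> X] ob_closed[OF \<mu>T X] Obj_Tc0D[OF X] carrier_Tc0D[OF Obj_Tc0D(2)[OF X]]
      by (simp add: X dmor_comp_sel[OF T\<mu>] dmor_comp_sel[OF \<mu>T] Tc1_sel[OF \<mu>] Tc_mult_sel)
    show "ar (dmor_comp (Tc_mult P) (Tc1 (Tc_mult P))) X Y f = ar (dmor_comp (Tc_mult P) (Tc_mult (Tc0 P))) X Y f"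
      if f: "f \<in> Hom ?T3 X Y" for X Y f
      using ar_closed[OF T\<mu> f] ar_closed[OF \<mu>T f] Hom_Tc0D[OF f]
      by (simp add: f dmor_comp_sel[OF T\<mu>] dmor_comp_sel[OF \<mu>T] Tc1_sel[OF \<mu>] Tc_mult_sel)
    show "el (dmor_comp (Tc_mult P) (Tc1 (Tc_mult P))) X x = el (dmor_comp (Tc_mult P) (Tc_mult (Tc0 P))) X x"
      if X: "X \<in> Obj ?T3" and x: "x \<in> carrier (fib ?T3 X)" for X x
      using ob_closed[OF T\<mu> X] ob_closed[OF \<mu>T X] el_closed[OF T\<mu> X x] el_closed[OF \<mu>T X x]
        Obj_Tc0D[OF X] carrier_Tc0D[OF x]
      by (simp add: X x dmor_comp_sel[OF T\<mu>] dmor_comp_sel[OF \<mu>T] Tc1_sel[OF \<mu>] Tc_mult_sel)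
  qed
qed

lemma Tc_mult_unit:
  assumes P: "elementary_doctrine P"
  shows "dmor_comp (Tc_mult P) (Tc_unit (Tc0 P)) = dmor_id (Tc0 P)"
proof -
  interpret P: obj_elementary_doctrine P by (rule obj_elementary_doctrineI[OF P])
  note TP = elementary_doctrine_Tc0[OF P]
  note \<mu> = Tc_mult_hom[OF P] and \<eta>T = Tc_unit_hom[OF TP]
  show ?thesis
  proof (rule ED_hom1_eqI[OF dmor_comp_hom[OF \<eta>T \<mu>] dmor_id_hom[OF TP]])
    show "ob (dmor_comp (Tc_mult P) (Tc_unit (Tc0 P))) X = ob (dmor_id (Tc0 P)) X"
      if X: "X \<in> Obj (Tc0 P)" for X
      using ob_closed[OF \<eta>T X] Obj_Tc0D[OF X]
      by (simp add: X dmor_comp_sel[OF \<eta>T] dmor_id_sel Tc_unit_sel Tc_mult_sel P.Tc0_top)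
    show "ar (dmor_comp (Tc_mult P) (Tc_unit (Tc0 P))) X Y f = ar (dmor_id (Tc0 P)) X Y f"
      if f: "f \<in> Hom (Tc0 P) X Y" for X Y f
      using ar_closed[OF \<eta>T f]
      by (simp add: f dmor_comp_sel[OF \<eta>T] dmor_id_sel Tc_unit_sel Tc_mult_sel)
    show "el (dmor_comp (Tc_mult P) (Tc_unit (Tc0 P))) X x = el (dmor_id (Tc0 P)) X x"
      if X: "X \<in> Obj (Tc0 P)" and x: "x \<in> carrier (fib (Tc0 P) X)" for X x
      using ob_closed[OF \<eta>T X] el_closed[OF \<eta>T X x]
      by (simp add: X x dmor_comp_sel[OF \<eta>T] dmor_id_sel Tc_unit_sel Tc_mult_sel)
  qed
qed

lemma Tc_mult_Tc1_unit:
  assumes P: "elementary_doctrine P"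
  shows "dmor_comp (Tc_mult P) (Tc1 (Tc_unit P)) = dmor_id (Tc0 P)"
proof -
  note TP = elementary_doctrine_Tc0[OF P]
  note \<mu> = Tc_mult_hom[OF P] and \<eta> = Tc_unit_hom[OF P]
  note T\<eta> = Tc1_hom[OF \<eta>]
  show ?thesis
  proof (rule ED_hom1_eqI[OF dmor_comp_hom[OF T\<eta> \<mu>] dmor_id_hom[OF TP]])
    show "ob (dmor_comp (Tc_mult P) (Tc1 (Tc_unit P))) X = ob (dmor_id (Tc0 P)) X"
      if X: "X \<in> Obj (Tc0 P)" for X
      using ob_closed[OF T\<eta> X] Obj_Tc0D[OF X]
      by (simp add: X dmor_comp_sel[OF T\<eta>] dmor_id_sel Tc1_sel[OF \<eta>] Tc_unit_sel Tc_mult_sel)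
    show "ar (dmor_comp (Tc_mult P) (Tc1 (Tc_unit P))) X Y f = ar (dmor_id (Tc0 P)) X Y f"
      if f: "f \<in> Hom (Tc0 P) X Y" for X Y f
      using ar_closed[OF T\<eta> f] Hom_Tc0D[OF f]
      by (simp add: f dmor_comp_sel[OF T\<eta>] dmor_id_sel Tc1_sel[OF \<eta>] Tc_unit_sel Tc_mult_sel)
    show "el (dmor_comp (Tc_mult P) (Tc1 (Tc_unit P))) X x = el (dmor_id (Tc0 P)) X x"
      if X: "X \<in> Obj (Tc0 P)" and x: "x \<in> carrier (fib (Tc0 P) X)" for X x
      using ob_closed[OF T\<eta> X] el_closed[OF T\<eta> X x] Obj_Tc0D[OF X] carrier_Tc0D[OF x]
      by (simp add: X x dmor_comp_sel[OF T\<eta>] dmor_id_sel Tc1_sel[OF \<eta>] Tc_unit_sel Tc_mult_sel)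
  qed
qed

lemma cell0_ED: "P \<in> cell0 ED \<longleftrightarrow> elementary_doctrine P"
  and cell1_ED: "F \<in> cell1 ED \<longleftrightarrow> ed_morphism F"
  by (simp_all add: ED_def)

lemma Tc_two_monad:
  "two_monad (ED :: (('b, 'a, 'e) cdoctrine, ('b, 'a, 'e) cdmor, ('b, 'a, 'e) cdcell) two_cat) Tc"
proof (intro two_monad.intro two_endofunctor.intro two_endofunctor_axioms.intro
    two_monad_axioms.intro ED_two_category, unfold ED_sel Tc_fields cell0_ED cell1_ED)
  show "Tc2 (dcell_id F) = dcell_id (Tc1 F)" if "ed_morphism F" for F :: "('b, 'a, 'e) cdmor"
    by (rule Tc2_dcell_id[OF ED_hom1_self[OF that]])
next
  fix s t :: "('b, 'a, 'e) cdcell" and F F' G G'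
  assume s: "in_hom2 ED s F F'" and t: "in_hom2 ED t G G'" and eq: "dtrg F = dsrc G"
  show "Tc2 (dcell_hcomp t s) = dcell_hcomp (Tc2 t) (Tc2 s)"
    by (rule Tc2_dcell_hcomp[OF s t ED_hom2_dom[OF s] ED_hom2_dom[OF t, folded eq]])
qed (auto intro: elementary_doctrine_Tc0 Tc1_hom Tc1_dmor_id Tc1_dmor_comp Tc2_hom Tc2_dcell_vcomp
    Tc_unit_hom Tc_unit_natural Tc_unit_natural2 Tc_mult_hom Tc_mult_natural Tc_mult_natural2
    Tc_mult_assoc Tc_mult_unit Tc_mult_Tc1_unit ED_hom2_dom)

section \<open>Colax idempotency\<close>

text \<open>The unit of the completed doctrine sends \<open>(A, \<alpha>)\<close> to \<open>((A, \<alpha>), \<alpha>)\<close>, since \<open>\<alpha>\<close> is the top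
  element over \<open>(A, \<alpha>)\<close>, whereas the completion of the unit sends it to \<open>((A, \<top>), \<alpha>)\<close>. The identity
  of \<open>A\<close> is an arrow from the former to the latter; in the other direction it would be one only for
  \<open>\<alpha> = \<top>\<close>.\<close>
definition Tc_lambda :: "('b, 'a, 'e) cdoctrine \<Rightarrow> ('b, 'a, 'e) cdcell" where
  "Tc_lambda P = \<lparr> ddom = Tc_unit (Tc0 P), dcod = Tc1 (Tc_unit P),
     cmpt = (\<lambda>X\<in>Obj (Tc0 P). Idt P (under X)) \<rparr>"

lemma Tc_lambda_hom:
  assumes P: "elementary_doctrine P"
  shows "in_hom2 ED (Tc_lambda P) (Tc_unit (Tc0 P)) (Tc1 (Tc_unit P))"
proof -
  interpret P: obj_elementary_doctrine P by (rule obj_elementary_doctrineI[OF P])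
  interpret Q: obj_elementary_doctrine "Tc0 P" by (rule obj_elementary_doctrineI[OF P.Tc0_elementary])
  let ?Q = "Tc0 P" and ?u = "Tc_unit (Tc0 P)" and ?v = "Tc1 (Tc_unit P)"
  note \<eta> = Tc_unit_hom[OF P] and u = Tc_unit_hom[OF P.Tc0_elementary]
  note v = Tc1_hom[OF \<eta>]
  have u_ob: "ob ?u X = Ext X (pred X)" if "X \<in> Obj ?Q" for X
    using that by (simp add: Tc_unit_sel P.Tc0_top)
  have v_ob: "ob ?v X = Ext (Ext (under X) \<top>\<^bsub>fib P (under X)\<^esub>) (pred X)" if "X \<in> Obj ?Q" for X
    using that Obj_Tc0D[OF that] by (simp add: Tc1_sel[OF \<eta>] Tc_unit_sel)
  have sub: "sub ?Q X (Ext (under X) \<top>\<^bsub>fib P (under X)\<^esub>) (Idt P (under X)) x = x"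
    if X: "X \<in> Obj ?Q" and x: "x \<in> carrier (fib ?Q X)" for X x
    using Obj_Tc0D[OF X] carrier_Tc0D[OF x] P.fib_le_iff_meet[of "under X" x "pred X"]
    by (simp add: Tc0_sel P.sub_Idt)
  have idt: "Idt P (under X) \<in> Hom ?Q X (Ext (under X) \<top>\<^bsub>fib P (under X)\<^esub>)" if X: "X \<in> Obj ?Q" for X
    using Obj_Tc0D[OF X] X
    by (simp add: Hom_Tc0_iff Obj_Tc0_iff[of "Ext _ _"] P.Idt_Hom P.fib_top P.sub_top P.fib_le_top)
  show ?thesis
  proof (rule ED_hom2I[OF Tc_lambda_def u v])
    fix X assume X: "X \<in> Obj ?Q"
    note A = Obj_Tc0D[OF X]
    have \<alpha>: "pred X \<in> carrier (fib ?Q X)" using A by (simp add: carrier_Tc0_iff P.fib_le_refl)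
    show "Idt P (under X) \<in> Hom (Tc0 ?Q) (ob ?u X) (ob ?v X)"
      using ob_closed[OF u X] ob_closed[OF v X] Q.fib_le_refl[OF X \<alpha>]
      by (simp add: Hom_Tc0_iff[of _ ?Q] u_ob[OF X] v_ob[OF X] idt[OF X] sub[OF X \<alpha>])
    fix x assume x: "x \<in> carrier (fib ?Q X)"
    have "x \<sqinter>\<^bsub>fib ?Q X\<^esub> pred X = x"
      using carrier_Tc0D[OF x] P.Tc0_meet[OF X x \<alpha>] P.fib_le_iff_meet[OF A(1) carrier_Tc0D(1)[OF x] A(2)] by simp
    then show "el ?u X x \<sqsubseteq>\<^bsub>fib (Tc0 ?Q) (ob ?u X)\<^esub> sub (Tc0 ?Q) (ob ?u X) (ob ?v X) (Idt P (under X)) (el ?v X x)"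
      using Q.fib_le_refl[OF X x] A carrier_Tc0D(1)[OF x]
      by (simp add: u_ob[OF X] v_ob[OF X] Tc0_sel(7,8)[of ?Q] sub[OF X x] Tc1_sel[OF \<eta>] Tc_unit_sel X x)
  next
    fix X Y f assume f: "f \<in> Hom ?Q X Y"
    note f' = Hom_Tc0D[OF f]
    show "Cmp (Tc0 ?Q) (ob ?u X) (ob ?u Y) (ob ?v Y) (Idt P (under Y)) (ar ?u X Y f) =
        Cmp (Tc0 ?Q) (ob ?u X) (ob ?v X) (ob ?v Y) (ar ?v X Y f) (Idt P (under X))"
      using f f' by (simp add: u_ob v_ob Tc0_sel Tc_unit_sel Tc1_sel[OF \<eta>]
          P.Cmp_Idt_left[OF f'(3)] P.Cmp_Idt_right[OF f'(3)])
  qed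
qed

lemma Tc_lambda_cmpt: "X \<in> Obj (Tc0 P) \<Longrightarrow> cmpt (Tc_lambda P) X = Idt P (under X)"
  by (simp add: Tc_lambda_def)

lemma Tc_lambda_unit:
  assumes P: "elementary_doctrine P"
  shows "dcell_hcomp (Tc_lambda P) (dcell_id (Tc_unit P)) = dcell_id (dmor_comp (Tc_unit (Tc0 P)) (Tc_unit P))"
proof -
  note TP = elementary_doctrine_Tc0[OF P]
  note \<eta> = Tc_unit_hom[OF P] and \<eta>T = Tc_unit_hom[OF TP] and l = Tc_lambda_hom[OF P]
  note c = dmor_comp_hom[OF \<eta> \<eta>T]
  note lh = dcell_hcomp_hom[OF dcell_id_hom[OF \<eta>] l \<eta> \<eta>T, unfolded Tc_unit_natural[OF \<eta>]]
  show ?thesis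
  proof (rule ED_hom2_eqI[OF lh dcell_id_hom[OF c] c])
    fix A assume A: "A \<in> Obj P"
    show "cmpt (dcell_hcomp (Tc_lambda P) (dcell_id (Tc_unit P))) A =
        cmpt (dcell_id (dmor_comp (Tc_unit (Tc0 P)) (Tc_unit P))) A"
      using ob_closed[OF \<eta> A]
      by (simp add: A dcell_whisker_right_cmpt[OF \<eta> l \<eta>T] dcell_id_cmpt[OF c] Tc_lambda_cmpt
          dmor_comp_sel[OF \<eta>] Tc_unit_sel Tc0_sel)
  qed
qed

lemma Tc_mult_lambda:
  assumes P: "elementary_doctrine P"
  shows "dcell_hcomp (dcell_id (Tc_mult P)) (Tc_lambda P) = dcell_id (dmor_id (Tc0 P))"
proof -
  note TP = elementary_doctrine_Tc0[OF P]
  note \<mu> = Tc_mult_hom[OF P] and \<eta>T = Tc_unit_hom[OF TP] and l = Tc_lambda_hom[OF P]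
  note i = dmor_id_hom[OF TP]
  note lh = dcell_hcomp_hom[OF l dcell_id_hom[OF \<mu>] \<eta>T \<mu>, unfolded Tc_mult_unit[OF P] Tc_mult_Tc1_unit[OF P]]
  show ?thesis
  proof (rule ED_hom2_eqI[OF lh dcell_id_hom[OF i] i])
    fix X assume X: "X \<in> Obj (Tc0 P)"
    show "cmpt (dcell_hcomp (dcell_id (Tc_mult P)) (Tc_lambda P)) X = cmpt (dcell_id (dmor_id (Tc0 P))) X"
      using cmpt_closed[OF l \<eta>T X]
      by (simp add: X dcell_whisker_left_cmpt[OF l \<eta>T \<mu>] dcell_id_cmpt[OF i] Tc_lambda_cmpt
          Tc_mult_sel dmor_id_sel Tc0_sel)
  qed
qed

theorem theorem4p16:
  shows "colax_idempotent_two_monad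
    (ED :: (('b, 'a, 'e) cdoctrine, ('b, 'a, 'e) cdmor, ('b, 'a, 'e) cdcell) two_cat) Tc"
proof (rule comparison_two_monad.colax_idempotent)
  show "comparison_two_monad
      (ED :: (('b, 'a, 'e) cdoctrine, ('b, 'a, 'e) cdmor, ('b, 'a, 'e) cdcell) two_cat) Tc Tc_lambda"
    by (intro comparison_two_monad.intro comparison_two_monad_axioms.intro Tc_two_monad, unfold ED_sel Tc_fields cell0_ED)
      (fact Tc_lambda_hom Tc_lambda_unit Tc_mult_lambda)+
qed

end
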